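(* Let $\alpha\in\mathbb{R}$ and $p>1$. If $\omega>-e_\alpha$, then the set $\mathcal{G}_\omega$ of ground states of $-\Delta_\alpha\phi+\omega\phi-|\phi|^{p-1}\phi=0$ on $\mathbb{R}^2$ is not empty.
   Context: Let $\alpha\in\mathbb{R}$, $p>1$, $e_\alpha:=-4e^{-4\pi\alpha-2\gamma}<0$ ($\gamma$ the Euler--Mascheroni constant). For $\lambda>0$ put $\beta_\alpha(\lambda):=\alpha+\frac{\gamma}{2\pi}+\frac1{2\pi}\ln\frac{\sqrt\lambda}{2}=\frac1{4\pi}\ln\frac{\lambda}{-e_\alpha}$ and $G_\lambda(x):=\frac1{2\pi}K_0(\sqrt\lambda|x|)$, the Green function of $-\Delta+\lambda$ on $\mathbb{R}^2$ ($K_0$ the modified Bessel function of the second kind). The self-adjoint operator $-\Delta_\alpha$ on $L^2(\mathbb{R}^2)$ is defined, for any fixed $\lambda>0$, $\lambda\neq-e_\alpha$ (the definition does not depend on $\lambda$), by $D(-\Delta_\alpha)=\{f+\frac{f(0)}{\beta_\alpha(\lambda)}G_\lambda: f\in H^2(\mathbb{R}^2)\}$ and $(-\Delta_\alpha+\lambda)g=(-\Delta+\lambda)f$ for $g=f+\frac{f(0)}{\beta_\alpha(\lambda)}G_\lambda$. Its form domain is $H^1_\alpha(\mathbb{R}^2)=\{f+cG_\lambda: f\in H^1(\mathbb{R}^2),\ c\in\mathbb{C}\}$ (independent of $\lambda>0$), and for $\lambda>-e_\alpha$ and $g=f+cG_\lambda$, $\|g\|_{H^1_{\alpha,\lambda}}^2:=\langle(-\Delta_\alpha+\lambda)g,g\rangle=\|\nabla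 f\|_{L^2}^2+\lambda\|f\|_{L^2}^2+\beta_\alpha(\lambda)|c|^2$; these norms are equivalent for different $\lambda>-e_\alpha$. For $\omega>-e_\alpha$, $S_\omega(v):=\frac12\|v\|_{H^1_{\alpha,\omega}}^2-\frac1{p+1}\|v\|_{L^{p+1}}^{p+1}$ for $v\in H^1_\alpha(\mathbb{R}^2)$; $\mathcal{A}_\omega:=\{\phi\in H^1_\alpha(\mathbb{R}^2):\phi\neq0,\ S_\omega'(\phi)=0\}$ (nontrivial solutions of the stationary equation); $\mathcal{G}_\omega:=\{\phi\in\mathcal{A}_\omega: S_\omega(\phi)\le S_\omega(\psi)\text{ for all }\psi\in\mathcal{A}_\omega\}$ (ground states). *)

theory Defs
  imports "HOL-Analysis.Analysis"
begin

text \<open>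
  Elements of function spaces on \<open>\<real>\<^sup>2\<close> are represented by Borel functions instead of classes
  modulo equality almost everywhere. All functionals below depend only on the class,
  and ``nonzero'' means not almost everywhere zero.
\<close>

subsection \<open>The Sobolev space of order one on the plane\<close>

primrec Ck :: "nat \<Rightarrow> (real^2 \<Rightarrow> real) \<Rightarrow> bool" where
  "Ck 0 \<phi> \<longleftrightarrow> continuous_on UNIV \<phi>"
| "Ck (Suc k) \<phi> \<longleftrightarrow> (\<forall>x. \<phi> differentiable (at x)) \<and>
     (\<forall>v. Ck k (\<lambda>x. frechet_derivative \<phi> (at x) v))"

definition test_function :: "(real^2 \<Rightarrow> real) \<Rightarrow> bool" where
  "test_function \<phi> \<longleftrightarrow> (\<forall>k. Ck k \<phi>) \<and> compact (closure {x. \<phi> x \<noteq> 0})"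

definition locally_integrable :: "(real^2 \<Rightarrow> complex) \<Rightarrow> bool" where
  "locally_integrable f \<longleftrightarrow> f \<in> borel_measurable borel \<and>
     (\<forall>K. compact K \<longrightarrow> set_integrable lborel K f)"

definition has_weak_partial :: "2 \<Rightarrow> (real^2 \<Rightarrow> complex) \<Rightarrow> (real^2 \<Rightarrow> complex) \<Rightarrow> bool" where
  "has_weak_partial i f g \<longleftrightarrow> locally_integrable f \<and> locally_integrable g \<and>
     (\<forall>\<phi>. test_function \<phi> \<longrightarrow>
        (LINT x|lborel. frechet_derivative \<phi> (at x) (axis i 1) *\<^sub>R f x)
          = - (LINT x|lborel. \<phi> x *\<^sub>R g x))"

text \<open>Unique up to null sets, so the choice does not affect integrals.\<close>
definition weak_partial :: "2 \<Rightarrow> (real^2 \<Rightarrow> complex) \<Rightarrow> (real^2 \<Rightarrow> complex)" where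
  "weak_partial i f = (SOME g. has_weak_partial i f g)"

definition L2 :: "(real^2 \<Rightarrow> complex) set" where
  "L2 = {f \<in> borel_measurable borel. integrable lborel (\<lambda>x. (cmod (f x))\<^sup>2)}"

definition L2_norm_sq :: "(real^2 \<Rightarrow> complex) \<Rightarrow> real" where
  "L2_norm_sq f = (LINT x|lborel. (cmod (f x))\<^sup>2)"

definition H1 :: "(real^2 \<Rightarrow> complex) set" where
  "H1 = {f \<in> L2. \<forall>i. \<exists>g \<in> L2. has_weak_partial i f g}"

definition grad_norm_sq :: "(real^2 \<Rightarrow> complex) \<Rightarrow> real" where
  "grad_norm_sq f = (\<Sum>i\<in>UNIV. L2_norm_sq (weak_partial i f))"

subsection \<open>The point interaction\<close>

definition e_alpha :: "real \<Rightarrow> real" where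
  "e_alpha \<alpha> = - 4 * exp (- 4 * pi * \<alpha> - 2 * euler_mascheroni)"

text \<open>The spectral parameter, usually called \<open>\<lambda>\<close>, is written \<open>\<kappa>\<close>.\<close>
definition beta :: "real \<Rightarrow> real \<Rightarrow> real" where
  "beta \<alpha> \<kappa> = \<alpha> + euler_mascheroni / (2 * pi) + 1 / (2 * pi) * ln (sqrt \<kappa> / 2)"

lemma beta_eq_ln:
  assumes "\<kappa> > 0"
  shows "beta \<alpha> \<kappa> = 1 / (4 * pi) * ln (\<kappa> / (- e_alpha \<alpha>))"
proof -
  have "ln (4::real) = 2 * ln 2"
    using ln_realpow[of "2::real" 2] by simp
  then have A: "ln (\<kappa> / (- e_alpha \<alpha>)) = ln \<kappa> - 2 * ln 2 + 4 * pi * \<alpha> + 2 * euler_mascheroni"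
    using assms by (simp add: e_alpha_def ln_div ln_mult)
  have B: "ln (sqrt \<kappa> / 2) = ln \<kappa> / 2 - ln 2"
    using assms by (simp add: ln_div ln_sqrt)
  show ?thesis
    unfolding beta_def A B by (simp add: field_simps)
qed

text \<open>
  The modified Bessel function of the second kind of order zero, by its integral
  representation on the positive half-line. The value at 0 is irrelevant (a null set below).
\<close>
definition bessel_K0 :: "real \<Rightarrow> real" where
  "bessel_K0 r = (LINT t:{0..}|lborel. exp (- r * cosh t))"

definition green :: "real \<Rightarrow> real^2 \<Rightarrow> complex" where
  "green \<kappa> x = complex_of_real (1 / (2 * pi) * bessel_K0 (sqrt \<kappa> * norm x))"

text \<open>
  The form domain, the same set for every \<open>\<kappa> > 0\<close> and every \<open>\<alpha>\<close>;
  \<open>\<alpha>\<close> enters only through the form.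
\<close>
definition H1_alpha :: "real \<Rightarrow> (real^2 \<Rightarrow> complex) set" where
  "H1_alpha \<kappa> = {\<lambda>x. f x + c * green \<kappa> x | f c. f \<in> H1}"

text \<open>
  The coefficient \<open>c\<close> of \<open>g = f + c G\<^sub>\<kappa>\<close>; it is unique because \<open>G\<^sub>\<kappa>\<close> is not in \<open>H1\<close>.
\<close>
definition charge :: "real \<Rightarrow> (real^2 \<Rightarrow> complex) \<Rightarrow> complex" where
  "charge \<kappa> g = (THE c. \<exists>f\<in>H1. g = (\<lambda>x. f x + c * green \<kappa> x))"

definition regular_part :: "real \<Rightarrow> (real^2 \<Rightarrow> complex) \<Rightarrow> (real^2 \<Rightarrow> complex)" where
  "regular_part \<kappa> g = (\<lambda>x. g x - charge \<kappa> g * green \<kappa> x)"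

definition form_norm_sq :: "real \<Rightarrow> real \<Rightarrow> (real^2 \<Rightarrow> complex) \<Rightarrow> real" where
  "form_norm_sq \<alpha> \<kappa> g =
     grad_norm_sq (regular_part \<kappa> g) + \<kappa> * L2_norm_sq (regular_part \<kappa> g)
       + beta \<alpha> \<kappa> * (cmod (charge \<kappa> g))\<^sup>2"

definition form_norm :: "real \<Rightarrow> real \<Rightarrow> (real^2 \<Rightarrow> complex) \<Rightarrow> real" where
  "form_norm \<alpha> \<kappa> g = sqrt (form_norm_sq \<alpha> \<kappa> g)"

subsection \<open>Action and ground states\<close>

definition action :: "real \<Rightarrow> real \<Rightarrow> real \<Rightarrow> (real^2 \<Rightarrow> complex) \<Rightarrow> real" where
  "action \<alpha> p \<omega> v =
     1 / 2 * form_norm_sq \<alpha> \<omega> v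
       - 1 / (p + 1) * (LINT x|lborel. cmod (v x) powr (p + 1))"

text \<open>
  Real Frechet derivative of a functional \<open>F\<close> on the space \<open>V\<close> of functions with (semi)norm \<open>N\<close>.
  This spells out \<open>has_derivative\<close>, which is available only for normed spaces that are types.
\<close>
definition has_frechet_derivative_on ::
  "('a \<Rightarrow> complex) set \<Rightarrow> (('a \<Rightarrow> complex) \<Rightarrow> real) \<Rightarrow> (('a \<Rightarrow> complex) \<Rightarrow> real)
     \<Rightarrow> ('a \<Rightarrow> complex) \<Rightarrow> (('a \<Rightarrow> complex) \<Rightarrow> real) \<Rightarrow> bool" where
  "has_frechet_derivative_on V N F v D \<longleftrightarrow>
     (\<forall>h\<in>V. \<forall>k\<in>V. D (\<lambda>x. h x + k x) = D h + D k) \<and>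
     (\<forall>h\<in>V. \<forall>r. D (\<lambda>x. r *\<^sub>R h x) = r * D h) \<and>
     (\<exists>C. \<forall>h\<in>V. \<bar>D h\<bar> \<le> C * N h) \<and>
     (\<forall>\<epsilon>>0. \<exists>\<delta>>0. \<forall>h\<in>V. N h < \<delta> \<longrightarrow>
        \<bar>F (\<lambda>x. v x + h x) - F v - D h\<bar> \<le> \<epsilon> * N h)"

definition stationary_states :: "real \<Rightarrow> real \<Rightarrow> real \<Rightarrow> (real^2 \<Rightarrow> complex) set" where
  "stationary_states \<alpha> p \<omega> =
     {\<phi> \<in> H1_alpha \<omega>. \<not> (AE x in lborel. \<phi> x = 0) \<and>
        has_frechet_derivative_on (H1_alpha \<omega>) (form_norm \<alpha> \<omega>) (action \<alpha> p \<omega>) \<phi> (\<lambda>h. 0)}"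

definition ground_states :: "real \<Rightarrow> real \<Rightarrow> real \<Rightarrow> (real^2 \<Rightarrow> complex) set" where
  "ground_states \<alpha> p \<omega> =
     {\<phi> \<in> stationary_states \<alpha> p \<omega>.
        \<forall>\<psi> \<in> stationary_states \<alpha> p \<omega>. action \<alpha> p \<omega> \<phi> \<le> action \<alpha> p \<omega> \<psi>}"

end

theory Submission
  imports Defs "HOL-Library.Diagonal_Subsequence"
begin

text \<open>
  A form domain element with regular part \<open>f\<close> and charge \<open>c\<close> is identified with the pair
  \<open>((\<surd>\<omega> f, \<partial>\<^sub>1 f, \<partial>\<^sub>2 f), \<surd>\<beta> c)\<close> in a Hilbert space, where the form norm is the norm. Let \<open>W\<close> be the
  supremum of \<open>T(u) = \<parallel>u\<parallel>\<^sub>q\<^sup>q\<close>, \<open>q = p + 1\<close>, over the unit ball. Testing a stationary state against itself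
  gives \<open>N\<^sup>2 = T \<le> W N\<^sup>q\<close> for its form norm \<open>N\<close>, so its action \<open>(1/2 - 1/q) N\<^sup>2\<close> is smallest if \<open>W N\<^sup>q\<^sup>-\<^sup>2 = 1\<close>,
  and this value is attained by a rescaled maximizer.

  A maximizing sequence with a nonzero weak limit converges to a maximizer by the Brezis-Lieb
  argument and the strict superadditivity of \<open>t\<^sup>q\<^sup>/\<^sup>2\<close>. If the weak limit is 0 then the charges tend to 0,
  so the regular parts form a maximizing sequence as well; these cannot vanish, and since the energy of
  charge-free functions is translation invariant, suitable translates have a nonzero weak limit.
  Hence no comparison with the level of the problem without point interaction is needed.

  Sobolev embedding, non-vanishing and local compactness all rest on one estimate:
  the mean square oscillation of \<open>f\<close> over squares of side \<open>h\<close> has integral at most \<open>2 h\<^sup>2 \<parallel>\<nabla>f\<parallel>\<^sup>2\<close>.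
\<close>

subsection \<open>Weak sequential compactness in Hilbert spaces\<close>

text \<open>The hypothesis \<open>\<omega> > - e_alpha \<alpha>\<close> enters as
  \<open>beta \<alpha> \<omega> > 0\<close>: it makes the form the square of a Hilbert norm in which
  the charge is one complex coordinate, so weak convergence forces convergence of the charges.
  Charge and regular part are meaningful only because the Green function is not in
  \<open>H1\<close>; its singularity is therefore studied twice, from above for the
  \<open>q\<close>-th power integral and from below for this exclusion. The Brezis-Lieb splitting is
  used as an inequality: convexity of \<open>t powr q\<close> gives a nonnegative defect, to which
  Fatou's lemma applies. The derivative at the rescaled maximizer \<open>U\<close> comes from a
  squeeze. The action lies above a function of the norm that touches it at \<open>U\<close> and is
  flat there. Midpoint convexity of \<open>T\<close> turns this lower bound at \<open>U - k\<close>
  into an upper bound at \<open>U + k\<close>, so the derivative at \<open>U\<close> exists and is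
  0. Any other stationary state is tested along its own ray, where the action is an explicit
  function of one real variable.\<close>

lemma nested_convex_Inter_nonempty:
  fixes K :: "nat \<Rightarrow> 'h::{real_inner,complete_space} set"
  assumes cl: "\<And>n. closed (K n)" and cv: "\<And>n. convex (K n)" and ne: "\<And>n. K n \<noteq> {}"
    and dec: "\<And>n m. n \<le> m \<Longrightarrow> K m \<subseteq> K n"
    and bd: "\<And>v. v \<in> K 0 \<Longrightarrow> norm v \<le> B"
  obtains L where "\<And>n. L \<in> K n"
proof -
  \<comment> \<open>Elements of almost minimal norm are picked in each set. The minimal norms
    increase to a limit, and the parallelogram law makes such a choice a Cauchy sequence, whose
    limit lies in every closed set.\<close>
  define d where "d n = Inf (norm ` K n)" for n
  have bdd: "bdd_below (norm ` K n)" for n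
    by (intro bdd_belowI[of _ 0]) auto
  have dle: "d n \<le> norm v" if "v \<in> K n" for n v
    unfolding d_def using that bdd by (auto intro: cInf_lower)
  have dinc: "d n \<le> d m" if "n \<le> m" for n m
    unfolding d_def using dec[OF that] ne bdd by (intro cInf_superset_mono) auto
  have d0: "0 \<le> d n" for n
    unfolding d_def using ne by (intro cInf_greatest) auto
  have "\<exists>v\<in>K n. norm v < d n + 1 / Suc n" for n
  proof -
    have "Inf (norm ` K n) < d n + 1 / Suc n"
      unfolding d_def by simp
    from cInf_lessD[OF _ this] show ?thesis
      using ne[of n] by auto
  qed
  then obtain v where v: "\<And>n. v n \<in> K n" "\<And>n. norm (v n) < d n + 1 / Suc n"
    by metis
  have dB: "d n \<le> B" for n
    using dle[OF v(1)] bd dec[of 0 n] v(1) by (metis order_trans subsetD zero_le)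
  have "incseq d"
    using dinc by (simp add: incseq_def)
  then obtain D where D: "d \<longlonglongrightarrow> D"
    using incseq_convergent[of d B] dB by metis
  have aD: "(\<lambda>n. norm (v n)) \<longlonglongrightarrow> D"
  proof (rule tendsto_sandwich[OF _ _ D])
    show "\<forall>\<^sub>F n in sequentially. d n \<le> norm (v n)"
      using dle v(1) by simp
    show "\<forall>\<^sub>F n in sequentially. norm (v n) \<le> d n + 1 / Suc n"
      using v(2) by (simp add: less_imp_le)
    show "(\<lambda>n. d n + 1 / Suc n) \<longlonglongrightarrow> D"
      using tendsto_add[OF D LIMSEQ_Suc[OF lim_1_over_n]] by simp
  qed
  \<comment> \<open>The midpoint of \<open>v n\<close> and \<open>v m\<close> lies in the convex set
    \<open>K n\<close>, so its norm is at least \<open>d n\<close>.\<close>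
  have par: "(norm (v n - v m))\<^sup>2 \<le> 2 * ((norm (v n))\<^sup>2 - (d n)\<^sup>2) + 2 * ((norm (v m))\<^sup>2 - (d n)\<^sup>2)"
    if "n \<le> m" for n m
  proof -
    have "(1/2) *\<^sub>R v n + (1/2) *\<^sub>R v m \<in> K n"
      using v(1)[of n] v(1)[of m] dec[OF that] cv[of n] by (intro convexD) auto
    then have "d n \<le> norm ((1/2) *\<^sub>R v n + (1/2) *\<^sub>R v m)"
      by (rule dle)
    then have "(d n)\<^sup>2 \<le> (norm ((1/2) *\<^sub>R v n + (1/2) *\<^sub>R v m))\<^sup>2"
      using d0 by (intro power_mono)
    then show ?thesis
      by (simp add: power2_norm_eq_inner inner_add inner_diff inner_commute field_simps)
  qed
  have "Cauchy v"
  proof (rule metric_CauchyI)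
    fix e :: real assume e: "e > 0"
    \<comment> \<open>Each squared norm and each squared infimum will be within
      \<open>\<epsilon>\<close> of the common limit, so \<open>par\<close> gives less than
      \<open>8 * \<epsilon>\<close>, which is below \<open>e\<^sup>2\<close>.\<close>
    define \<epsilon> where "\<epsilon> = e\<^sup>2 / 9"
    have ep: "\<epsilon> > 0" using e by (simp add: \<epsilon>_def)
    have A: "(\<lambda>n. (norm (v n))\<^sup>2) \<longlonglongrightarrow> D\<^sup>2" "(\<lambda>n. (d n)\<^sup>2) \<longlonglongrightarrow> D\<^sup>2"
      by (intro tendsto_power aD D)+
    from tendstoD[OF A(1) ep] tendstoD[OF A(2) ep]
    have "\<forall>\<^sub>F n in sequentially. dist ((norm (v n))\<^sup>2) (D\<^sup>2) < \<epsilon> \<and> dist ((d n)\<^sup>2) (D\<^sup>2) < \<epsilon>"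
      by eventually_elim auto
    then obtain N where N: "\<And>n. n \<ge> N \<Longrightarrow> dist ((norm (v n))\<^sup>2) (D\<^sup>2) < \<epsilon> \<and> dist ((d n)\<^sup>2) (D\<^sup>2) < \<epsilon>"
      by (auto simp: eventually_sequentially)
    have main: "dist (v n) (v m) < e" if "N \<le> n" "n \<le> m" for n m
    proof -
      have "(norm (v n - v m))\<^sup>2 < 9 * \<epsilon>"
        using par[OF that(2)] N[of n] N[of m] that ep by (simp add: dist_real_def abs_less_iff)
      then have "(norm (v n - v m))\<^sup>2 < e\<^sup>2"
        by (simp add: \<epsilon>_def)
      then show ?thesis
        using e by (simp add: dist_norm power_less_imp_less_base)
    qed
    show "\<exists>M. \<forall>m\<ge>M. \<forall>n\<ge>M. dist (v m) (v n) < e"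
      by (rule exI[of _ N]) (metis main dist_commute nle_le)
  qed
  then obtain L where L: "v \<longlonglongrightarrow> L"
    using Cauchy_convergent convergent_def by blast
  have "L \<in> K n" for n
  proof (rule Lim_in_closed_set[OF cl _ _ L])
    show "\<forall>\<^sub>F m in sequentially. v m \<in> K n"
      unfolding eventually_sequentially using v(1) dec by blast
  qed simp
  then show thesis by (rule that)
qed

definition weak_conv :: "(nat \<Rightarrow> 'h::real_inner) \<Rightarrow> 'h \<Rightarrow> bool" where
  "weak_conv x L \<longleftrightarrow> (\<forall>a. (\<lambda>n. x n \<bullet> a) \<longlonglongrightarrow> L \<bullet> a)"

text \<open>The closed convex hulls of the tails are nested and bounded, and any common point
  serves. If the inner products with \<open>a\<close> converge to \<open>l\<close>, then each late
  tail lies in a thin closed slab around the hyperplane of value \<open>l\<close>, and so does its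
  closed convex hull.\<close>

lemma bounded_hull_limit:
  fixes x :: "nat \<Rightarrow> 'h::{real_inner,complete_space}"
  assumes "\<And>n. norm (x n) \<le> B"
  obtains L where "L \<in> closure (span (range x))"
    and "\<And>a l. (\<lambda>n. x n \<bullet> a) \<longlonglongrightarrow> l \<Longrightarrow> L \<bullet> a = l"
proof -
  define K where "K n = closure (convex hull (x ` {n..}))" for n
  have "\<exists>L. \<forall>n. L \<in> K n"
  proof (rule nested_convex_Inter_nonempty[of K B])
    show "closed (K n)" "convex (K n)" "K n \<noteq> {}" for n
      by (auto simp: K_def convex_closure convex_convex_hull)
    show "K m \<subseteq> K n" if "n \<le> m" for n m
      unfolding K_def using that by (intro closure_mono hull_mono) auto
    have "K 0 \<subseteq> cball 0 B"
      unfolding K_def using assms by (intro closure_minimal hull_minimal) auto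
    then show "norm v \<le> B" if "v \<in> K 0" for v
      using that by auto
  qed blast
  then obtain L where L: "\<And>n. L \<in> K n"
    by blast
  have "K 0 \<subseteq> closure (span (range x))"
    unfolding K_def by (intro closure_mono hull_minimal)
      (auto intro: span_base subspace_imp_convex)
  then have "L \<in> closure (span (range x))"
    using L by auto
  moreover have "L \<bullet> a = l" if lim: "(\<lambda>n. x n \<bullet> a) \<longlonglongrightarrow> l" for a l
  proof -
    have "\<bar>L \<bullet> a - l\<bar> \<le> e" if "e > 0" for e
    proof -
      from tendstoD[OF lim that] obtain N where N: "\<And>n. n \<ge> N \<Longrightarrow> dist (x n \<bullet> a) l < e"
        by (auto simp: eventually_sequentially)
      have eq: "{v. \<bar>v \<bullet> a - l\<bar> \<le> e} = {v. a \<bullet> v \<le> l + e} \<inter> {v. a \<bullet> v \<ge> l - e}"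
        by (auto simp: inner_commute)
      have "K N \<subseteq> {v. \<bar>v \<bullet> a - l\<bar> \<le> e}"
        unfolding K_def
      proof (intro closure_minimal hull_minimal)
        show "x ` {N..} \<subseteq> {v. \<bar>v \<bullet> a - l\<bar> \<le> e}"
          using N by (auto simp: dist_real_def less_imp_le)
        show "convex {v. \<bar>v \<bullet> a - l\<bar> \<le> e}"
          unfolding eq by (intro convex_Int convex_halfspace_le convex_halfspace_ge)
        show "closed {v. \<bar>v \<bullet> a - l\<bar> \<le> e}"
          unfolding eq by (intro closed_Int closed_halfspace_le closed_halfspace_ge)
      qed
      then show ?thesis using L by auto
    qed
    then have "\<bar>L \<bullet> a - l\<bar> \<le> 0"
      by (rule field_le_epsilon) simp
    then show ?thesis by simp
  qed
  ultimately show thesis by (rule that)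
qed

lemma orthogonal_closure_span:
  fixes u :: "'h::real_inner"
  assumes "w \<in> closure (span S)" "\<And>s. s \<in> S \<Longrightarrow> u \<bullet> s = 0"
  shows "u \<bullet> w = 0"
proof -
  have "span S \<subseteq> {v. u \<bullet> v = 0}"
    using assms(2) by (intro span_minimal) (auto simp: subspace_hyperplane)
  then have "closure (span S) \<subseteq> {v. u \<bullet> v = 0}"
    by (intro closure_minimal) (auto simp: closed_hyperplane)
  then show ?thesis using assms(1) by auto
qed

lemma bounded_real_subseq:
  fixes x :: "nat \<Rightarrow> real"
  assumes "\<And>n. \<bar>x n\<bar> \<le> B"
  obtains l r where "strict_mono (r :: nat \<Rightarrow> nat)" "(x \<circ> r) \<longlonglongrightarrow> l"
proof -
  have "\<forall>n. x n \<in> cball 0 B" using assms by auto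
  then show thesis
    using compact_cball[of "0::real" B] that unfolding compact_def by blast
qed

text \<open>A diagonal subsequence converges when tested against every \<open>x m\<close>, and
  \<open>bounded_hull_limit\<close> supplies a candidate \<open>L\<close>. If testing against some
  \<open>a\<close> failed, a further subsequence would converge to another value and have its own
  candidate \<open>L'\<close>. Both candidates lie in the closed span of the \<open>x m\<close> and
  have the same inner products with all of them, so they coincide.\<close>

theorem bounded_weakly_convergent_subseq:
  fixes x :: "nat \<Rightarrow> 'h::{real_inner,complete_space}"
  assumes B: "\<And>n. norm (x n) \<le> B"
  obtains r L where "strict_mono (r :: nat \<Rightarrow> nat)" "weak_conv (x \<circ> r) L"
proof -
  have ib: "\<bar>x n \<bullet> a\<bar> \<le> B * norm a" for n a
    using Cauchy_Schwarz_ineq2[of "x n" a] mult_right_mono[OF B[of n], of "norm a"] by simp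
  interpret subseqs "\<lambda>m s. convergent (\<lambda>n. x (s n) \<bullet> x m)"
  proof
    fix m :: nat and s :: "nat \<Rightarrow> nat"
    obtain l r where "strict_mono (r :: nat \<Rightarrow> nat)" "((\<lambda>n. x (s n) \<bullet> x m) \<circ> r) \<longlonglongrightarrow> l"
      using bounded_real_subseq[of "\<lambda>n. x (s n) \<bullet> x m"] ib by metis
    then show "\<exists>r'. strict_mono r' \<and> convergent (\<lambda>n. x ((s \<circ> r') n) \<bullet> x m)"
      by (auto simp: o_def convergent_def)
  qed
  define r where "r = diagseq"
  have r: "strict_mono r"
    unfolding r_def by (rule subseq_diagseq)
  have conv: "convergent (\<lambda>n. x (r n) \<bullet> x m)" for m
  proof -
    \<comment> \<open>The diagonal sequence is a subsequence of the one adapted to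
      \<open>x m\<close> only after an initial segment, hence the shift by
      \<open>Suc m\<close>.\<close>
    have "convergent (\<lambda>n. x ((diagseq \<circ> ((+) (Suc m))) n) \<bullet> x m)"
      by (rule diagseq_holds) (auto dest: convergent_subseq_convergent simp: o_def)
    then have "convergent (\<lambda>n. (\<lambda>i. x (r i) \<bullet> x m) (n + Suc m))"
      by (simp add: r_def o_def add.commute)
    then show ?thesis
      by (rule convergent_ignore_initial_segment[THEN iffD1])
  qed
  define y where "y = x \<circ> r"
  have By: "norm (y n) \<le> B" for n
    using B by (simp add: y_def)
  obtain L where L: "L \<in> closure (span (range y))"
    and Ll: "\<And>a l. (\<lambda>n. y n \<bullet> a) \<longlonglongrightarrow> l \<Longrightarrow> L \<bullet> a = l"
    using bounded_hull_limit[of y B, OF By] by metis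
  have "(\<lambda>n. y n \<bullet> a) \<longlonglongrightarrow> L \<bullet> a" for a
  proof (rule ccontr)
    assume "\<not> (\<lambda>n. y n \<bullet> a) \<longlonglongrightarrow> L \<bullet> a"
    then obtain e where e: "e > 0" "\<exists>\<^sub>F n in sequentially. \<not> dist (y n \<bullet> a) (L \<bullet> a) < e"
      by (auto simp: tendsto_iff not_eventually)
    then have "infinite {n. \<not> dist (y n \<bullet> a) (L \<bullet> a) < e}"
      by (simp add: frequently_cofinite cofinite_eq_sequentially[symmetric])
    then obtain s :: "nat \<Rightarrow> nat" where s: "strict_mono s" "\<And>n. \<not> dist (y (s n) \<bullet> a) (L \<bullet> a) < e"
      using infinite_enumerate[of "{n. \<not> dist (y n \<bullet> a) (L \<bullet> a) < e}"] by auto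
    have "\<bar>y (s n) \<bullet> a\<bar> \<le> B * norm a" for n
      using ib by (simp add: y_def)
    then obtain l t where t: "strict_mono (t :: nat \<Rightarrow> nat)" "((\<lambda>n. y (s n) \<bullet> a) \<circ> t) \<longlonglongrightarrow> l"
      using bounded_real_subseq[of "\<lambda>n. y (s n) \<bullet> a"] by metis
    define z where "z = (\<lambda>n. y (s (t n)))"
    have "norm (z n) \<le> B" for n
      using By by (simp add: z_def)
    then obtain L' where L': "L' \<in> closure (span (range z))"
      and Ll': "\<And>a l. (\<lambda>n. z n \<bullet> a) \<longlonglongrightarrow> l \<Longrightarrow> L' \<bullet> a = l"
      using bounded_hull_limit[of z B] by metis
    have st: "strict_mono (s \<circ> t)" using s t by (intro strict_mono_o)
    have eqx: "L \<bullet> x m = L' \<bullet> x m" for m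
    proof -
      obtain l where l: "(\<lambda>n. x (r n) \<bullet> x m) \<longlonglongrightarrow> l"
        using conv[of m] by (auto simp: convergent_def)
      have "(\<lambda>n. z n \<bullet> x m) \<longlonglongrightarrow> l"
        using LIMSEQ_subseq_LIMSEQ[OF l st] by (simp add: z_def y_def o_def)
      then show ?thesis
        using Ll[of "x m" l] Ll'[of "x m" l] l by (simp add: y_def o_def)
    qed
    have "range y \<subseteq> range x" "range z \<subseteq> range x"
      by (auto simp: y_def z_def)
    then have "closure (span (range y)) \<subseteq> closure (span (range x))"
      "closure (span (range z)) \<subseteq> closure (span (range x))"
      by (simp_all add: closure_mono span_mono)
    then have mem: "L \<in> closure (span (range x))" "L' \<in> closure (span (range x))"
      using L L' by blast+
    have orth: "(L - L') \<bullet> w = 0" if "w \<in> closure (span (range x))" for w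
      using that by (rule orthogonal_closure_span) (auto simp: eqx inner_diff)
    have "(L - L') \<bullet> (L - L') = 0"
      using orth[OF mem(1)] orth[OF mem(2)] by (simp only: inner_diff_right)
    then have LL: "L = L'"
      by (metis eq_iff_diff_eq_0 inner_eq_zero_iff)
    have l: "L' \<bullet> a = l"
      using Ll' t(2) by (simp add: z_def o_def)
    have "(\<lambda>n. dist (y (s (t n)) \<bullet> a) (L \<bullet> a)) \<longlonglongrightarrow> dist l (L \<bullet> a)"
      using t(2) by (intro tendsto_dist) (auto simp: o_def)
    then have "e \<le> dist l (L \<bullet> a)"
      by (rule tendsto_lowerbound) (use s(2) in \<open>auto simp: not_less\<close>)
    with LL l e(1) show False
      by (metis dist_self not_less)
  qed
  then have "weak_conv (x \<circ> r) L"
    by (simp add: weak_conv_def y_def)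
  with r show thesis by (rule that)
qed

subsection \<open>The Hilbert space of square integrable functions\<close>

definition sq_integrable :: "('a::euclidean_space \<Rightarrow> 'b::euclidean_space) \<Rightarrow> bool" where
  "sq_integrable f \<longleftrightarrow> f \<in> borel_measurable borel \<and> integrable lborel (\<lambda>x. (norm (f x))\<^sup>2)"

lemma sq_integrableD:
  assumes "sq_integrable f"
  shows "f \<in> borel_measurable borel" "f \<in> borel_measurable lborel"
    "integrable lborel (\<lambda>x. (norm (f x))\<^sup>2)"
  using assms by (auto simp: sq_integrable_def)

lemma sq_integrable_zero [simp]: "sq_integrable (\<lambda>x. 0)"
  by (simp add: sq_integrable_def)

lemma sq_integrable_scaleR:
  assumes "sq_integrable f"
  shows "sq_integrable (\<lambda>x. r *\<^sub>R f x)"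
  using assms by (auto simp: sq_integrable_def power_mult_distrib)

lemma sq_integrable_bound:
  fixes f :: "'a::euclidean_space \<Rightarrow> 'b::euclidean_space" and g :: "'a \<Rightarrow> 'c::euclidean_space"
  assumes "sq_integrable f" "g \<in> borel_measurable borel" "\<And>x. norm (g x) \<le> C * norm (f x)"
  shows "sq_integrable g"
proof -
  have "integrable lborel (\<lambda>x. (norm (g x))\<^sup>2)"
  proof (rule Bochner_Integration.integrable_bound)
    show "integrable lborel (\<lambda>x. C\<^sup>2 * (norm (f x))\<^sup>2)"
      using assms(1) by (auto simp: sq_integrable_def)
    show "(\<lambda>x. (norm (g x))\<^sup>2) \<in> borel_measurable lborel"
      using assms(2) by simp
    have "(norm (g x))\<^sup>2 \<le> C\<^sup>2 * (norm (f x))\<^sup>2" for x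
      using power_mono[OF assms(3), of x 2] by (simp add: power_mult_distrib)
    then show "AE x in lborel. norm ((norm (g x))\<^sup>2) \<le> norm (C\<^sup>2 * (norm (f x))\<^sup>2)"
      by simp
  qed
  with assms(2) show ?thesis
    by (simp add: sq_integrable_def)
qed

lemma sq_integrable_add:
  fixes f g :: "'a::euclidean_space \<Rightarrow> 'b::euclidean_space"
  assumes "sq_integrable f" "sq_integrable g"
  shows "sq_integrable (\<lambda>x. f x + g x)"
proof -
  note [measurable] = sq_integrableD(1)[OF assms(1)] sq_integrableD(1)[OF assms(2)]
  have "integrable lborel (\<lambda>x. (norm (f x + g x))\<^sup>2)"
  proof (rule Bochner_Integration.integrable_bound)
    show "integrable lborel (\<lambda>x. 2 * (norm (f x))\<^sup>2 + 2 * (norm (g x))\<^sup>2)"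
      using assms by (auto simp: sq_integrable_def)
    have "(norm (f x + g x))\<^sup>2 \<le> 2 * (norm (f x))\<^sup>2 + 2 * (norm (g x))\<^sup>2" for x
    proof -
      have "(norm (f x + g x))\<^sup>2 + (norm (f x - g x))\<^sup>2 = 2 * (norm (f x))\<^sup>2 + 2 * (norm (g x))\<^sup>2"
        by (simp add: power2_norm_eq_inner inner_add inner_diff inner_commute)
      then show ?thesis by (smt (verit) zero_le_power2)
    qed
    then show "AE x in lborel. norm ((norm (f x + g x))\<^sup>2) \<le> norm (2 * (norm (f x))\<^sup>2 + 2 * (norm (g x))\<^sup>2)"
      by simp
  qed simp
  then show ?thesis
    by (simp add: sq_integrable_def)
qed

lemma sq_integrable_diff:
  fixes f g :: "'a::euclidean_space \<Rightarrow> 'b::euclidean_space"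
  assumes "sq_integrable f" "sq_integrable g"
  shows "sq_integrable (\<lambda>x. f x - g x)"
  using sq_integrable_add[OF assms(1) sq_integrable_scaleR[OF assms(2), of "-1"]] by simp

lemma sq_integrable_inner:
  fixes f g :: "'a::euclidean_space \<Rightarrow> 'b::euclidean_space"
  assumes "sq_integrable f" "sq_integrable g"
  shows "integrable lborel (\<lambda>x. f x \<bullet> g x)"
proof -
  note [measurable] = sq_integrableD(1)[OF assms(1)] sq_integrableD(1)[OF assms(2)]
  show ?thesis
  proof (rule Bochner_Integration.integrable_bound)
    show "integrable lborel (\<lambda>x. (norm (f x))\<^sup>2 + (norm (g x))\<^sup>2)"
      using assms by (auto simp: sq_integrable_def)
    have "\<bar>f x \<bullet> g x\<bar> \<le> (norm (f x))\<^sup>2 + (norm (g x))\<^sup>2" for x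
    proof -
      have "\<bar>f x \<bullet> g x\<bar> \<le> norm (f x) * norm (g x)"
        by (rule Cauchy_Schwarz_ineq2)
      moreover have "2 * (norm (f x) * norm (g x)) \<le> (norm (f x))\<^sup>2 + (norm (g x))\<^sup>2"
        using sum_squares_bound[of "norm (f x)" "norm (g x)"] by simp
      moreover have "0 \<le> norm (f x) * norm (g x)" by simp
      ultimately show ?thesis by linarith
    qed
    then show "AE x in lborel. norm (f x \<bullet> g x) \<le> norm ((norm (f x))\<^sup>2 + (norm (g x))\<^sup>2)"
      by simp
  qed simp
qed

lemma AE_trans_eq:
  assumes "AE x in M. f x = g x" "AE x in M. g x = h x"
  shows "AE x in M. f x = h x"
  using assms by eventually_elim simp

text \<open>A partial equivalence: exactly the square integrable functions are related to
  themselves, so the quotient has no other classes.\<close>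

definition l2_rel :: "('a::euclidean_space \<Rightarrow> 'b::euclidean_space) \<Rightarrow> ('a \<Rightarrow> 'b) \<Rightarrow> bool" where
  "l2_rel f g \<longleftrightarrow> sq_integrable f \<and> sq_integrable g \<and> (AE x in lborel. f x = g x)"

quotient_type (overloaded) ('a, 'b) l2 = "'a::euclidean_space \<Rightarrow> 'b::euclidean_space" / partial: l2_rel
proof (rule part_equivpI)
  show "\<exists>x. l2_rel x x"
    by (rule exI[of _ "\<lambda>x. 0"]) (simp add: l2_rel_def)
  show "symp l2_rel"
    by (rule sympI) (auto simp: l2_rel_def)
  show "transp l2_rel"
    by (rule transpI) (auto simp: l2_rel_def elim: AE_trans_eq)
qed

lemma sq_integrable_rep_l2: "sq_integrable (rep_l2 F)"
  using Quotient3_rep_reflp[OF Quotient3_l2] by (simp add: l2_rel_def)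

lemma borel_measurable_rep_l2 [measurable]: "rep_l2 F \<in> borel_measurable borel"
  using sq_integrable_rep_l2 by (rule sq_integrableD)

lemma abs_rep_l2 [simp]: "abs_l2 (rep_l2 F) = F"
  by (rule Quotient3_abs_rep[OF Quotient3_l2])

lemma AE_rep_abs_l2:
  assumes "sq_integrable f"
  shows "AE x in lborel. rep_l2 (abs_l2 f) x = f x"
  using rep_abs_rsp_left[OF Quotient3_l2, of f f] assms by (simp add: l2_rel_def)

lemma l2_eqI:
  assumes "AE x in lborel. rep_l2 F x = rep_l2 G x"
  shows "F = G"
  using Quotient3_rel_rep[OF Quotient3_l2, of F G] assms sq_integrable_rep_l2
  by (auto simp: l2_rel_def)

instantiation l2 :: (euclidean_space, euclidean_space) real_inner
begin

definition zero_l2 :: "('a, 'b) l2" where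
  "zero_l2 = abs_l2 (\<lambda>x. 0)"

definition plus_l2 :: "('a, 'b) l2 \<Rightarrow> ('a, 'b) l2 \<Rightarrow> ('a, 'b) l2" where
  "plus_l2 F G = abs_l2 (\<lambda>x. rep_l2 F x + rep_l2 G x)"

definition minus_l2 :: "('a, 'b) l2 \<Rightarrow> ('a, 'b) l2 \<Rightarrow> ('a, 'b) l2" where
  "minus_l2 F G = abs_l2 (\<lambda>x. rep_l2 F x - rep_l2 G x)"

definition scaleR_l2 :: "real \<Rightarrow> ('a, 'b) l2 \<Rightarrow> ('a, 'b) l2" where
  "scaleR_l2 r F = abs_l2 (\<lambda>x. r *\<^sub>R rep_l2 F x)"

definition uminus_l2 :: "('a, 'b) l2 \<Rightarrow> ('a, 'b) l2" where
  "uminus_l2 F = (-1) *\<^sub>R F"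

definition inner_l2 :: "('a, 'b) l2 \<Rightarrow> ('a, 'b) l2 \<Rightarrow> real" where
  "inner_l2 F G = (LINT x|lborel. rep_l2 F x \<bullet> rep_l2 G x)"

definition norm_l2 :: "('a, 'b) l2 \<Rightarrow> real" where
  "norm_l2 F = sqrt (F \<bullet> F)"

definition dist_l2 :: "('a, 'b) l2 \<Rightarrow> ('a, 'b) l2 \<Rightarrow> real" where
  "dist_l2 F G = norm (F - G)"

definition sgn_l2 :: "('a, 'b) l2 \<Rightarrow> ('a, 'b) l2" where
  "sgn_l2 F = inverse (norm F) *\<^sub>R F"

definition uniformity_l2 :: "(('a, 'b) l2 \<times> ('a, 'b) l2) filter" where
  "uniformity_l2 = (INF e\<in>{0<..}. principal {(x, y). dist x y < e})"

definition open_l2 :: "('a, 'b) l2 set \<Rightarrow> bool" where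
  "open_l2 U = (\<forall>x\<in>U. \<forall>\<^sub>F (x', y) in uniformity. x' = x \<longrightarrow> y \<in> U)"

text \<open>Representatives are chosen, so the vector operations act on them pointwise only up to
  null sets. All later computations with representatives go through these rules.\<close>

lemma AE_rep_l2_simps:
  fixes F G :: "('a, 'b) l2"
  shows AE_rep_l2_zero: "AE x in lborel. rep_l2 (0 :: ('a, 'b) l2) x = 0"
    and AE_rep_l2_plus: "AE x in lborel. rep_l2 (F + G) x = rep_l2 F x + rep_l2 G x"
    and AE_rep_l2_minus: "AE x in lborel. rep_l2 (F - G) x = rep_l2 F x - rep_l2 G x"
    and AE_rep_l2_scaleR: "AE x in lborel. rep_l2 (r *\<^sub>R F) x = r *\<^sub>R rep_l2 F x"
    and AE_rep_l2_uminus: "AE x in lborel. rep_l2 (- F) x = - rep_l2 F x"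
proof -
  have *: "AE x in lborel. rep_l2 (r *\<^sub>R F) x = r *\<^sub>R rep_l2 F x" for r
    unfolding scaleR_l2_def by (rule AE_rep_abs_l2) (intro sq_integrable_scaleR sq_integrable_rep_l2)
  show "AE x in lborel. rep_l2 (r *\<^sub>R F) x = r *\<^sub>R rep_l2 F x"
    by (rule *)
  show "AE x in lborel. rep_l2 (- F) x = - rep_l2 F x"
    using *[of "-1"] by (simp add: uminus_l2_def)
  show "AE x in lborel. rep_l2 (0 :: ('a, 'b) l2) x = 0"
    unfolding zero_l2_def by (rule AE_rep_abs_l2) simp
  show "AE x in lborel. rep_l2 (F + G) x = rep_l2 F x + rep_l2 G x"
    unfolding plus_l2_def by (rule AE_rep_abs_l2) (intro sq_integrable_add sq_integrable_rep_l2)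
  show "AE x in lborel. rep_l2 (F - G) x = rep_l2 F x - rep_l2 G x"
    unfolding minus_l2_def by (rule AE_rep_abs_l2) (intro sq_integrable_diff sq_integrable_rep_l2)
qed

instance
proof
  fix F G H :: "('a, 'b) l2" and r s :: real
  note [intro] = sq_integrable_inner sq_integrable_rep_l2
  show "F + G + H = F + (G + H)"
    by (rule l2_eqI) (use AE_rep_l2_plus[of "F + G" H] AE_rep_l2_plus[of F G] AE_rep_l2_plus[of F "G + H"]
      AE_rep_l2_plus[of G H] in \<open>eventually_elim, simp\<close>)
  show "F + G = G + F"
    by (rule l2_eqI) (use AE_rep_l2_plus[of F G] AE_rep_l2_plus[of G F] in \<open>eventually_elim, simp\<close>)
  show "0 + F = F"
    by (rule l2_eqI) (use AE_rep_l2_plus[of 0 F] AE_rep_l2_zero in \<open>eventually_elim, simp\<close>)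
  show "- F + F = 0"
    by (rule l2_eqI) (use AE_rep_l2_plus[of "- F" F] AE_rep_l2_zero AE_rep_l2_uminus[of F] in \<open>eventually_elim, simp\<close>)
  show "F - G = F + - G"
    by (rule l2_eqI) (use AE_rep_l2_plus[of F "- G"] AE_rep_l2_minus[of F G] AE_rep_l2_uminus[of G] in \<open>eventually_elim, simp\<close>)
  show "r *\<^sub>R (F + G) = r *\<^sub>R F + r *\<^sub>R G"
    by (rule l2_eqI) (use AE_rep_l2_scaleR[of r "F + G"] AE_rep_l2_plus[of F G]
      AE_rep_l2_plus[of "r *\<^sub>R F" "r *\<^sub>R G"] AE_rep_l2_scaleR[of r F] AE_rep_l2_scaleR[of r G] in \<open>eventually_elim, simp add: scaleR_right_distrib\<close>)
  show "(r + s) *\<^sub>R F = r *\<^sub>R F + s *\<^sub>R F"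
    by (rule l2_eqI) (use AE_rep_l2_scaleR[of "r + s" F]
      AE_rep_l2_plus[of "r *\<^sub>R F" "s *\<^sub>R F"] AE_rep_l2_scaleR[of r F] AE_rep_l2_scaleR[of s F] in \<open>eventually_elim, simp add: scaleR_left_distrib\<close>)
  show "r *\<^sub>R s *\<^sub>R F = (r * s) *\<^sub>R F"
    by (rule l2_eqI) (use AE_rep_l2_scaleR[of r "s *\<^sub>R F"] AE_rep_l2_scaleR[of s F] AE_rep_l2_scaleR[of "r * s" F] in \<open>eventually_elim, simp\<close>)
  show "1 *\<^sub>R F = F"
    by (rule l2_eqI) (use AE_rep_l2_scaleR[of 1 F] in \<open>eventually_elim, simp\<close>)
  show "dist F G = norm (F - G)" "sgn F = inverse (norm F) *\<^sub>R F" "norm F = sqrt (F \<bullet> F)"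
    by (rule dist_l2_def sgn_l2_def norm_l2_def)+
  show "uniformity = (INF e\<in>{0<..}. principal {(x, y :: ('a, 'b) l2). dist x y < e})"
    by (rule uniformity_l2_def)
  show "open U = (\<forall>x\<in>U. \<forall>\<^sub>F (x', y) in uniformity. x' = x \<longrightarrow> y \<in> U)" for U :: "('a, 'b) l2 set"
    by (rule open_l2_def)
  show "F \<bullet> G = G \<bullet> F"
    by (simp add: inner_l2_def inner_commute)
  have "(F + G) \<bullet> H = (LINT x|lborel. rep_l2 F x \<bullet> rep_l2 H x + rep_l2 G x \<bullet> rep_l2 H x)"
    unfolding inner_l2_def
    by (rule integral_cong_AE)
      (use AE_rep_l2_plus[of F G] in \<open>auto elim!: eventually_mono simp: inner_add_left\<close>)
  also have "\<dots> = F \<bullet> H + G \<bullet> H"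
    unfolding inner_l2_def by (intro Bochner_Integration.integral_add) auto
  finally show "(F + G) \<bullet> H = F \<bullet> H + G \<bullet> H" .
  have "(r *\<^sub>R F) \<bullet> H = (LINT x|lborel. r * (rep_l2 F x \<bullet> rep_l2 H x))"
    unfolding inner_l2_def
    by (rule integral_cong_AE)
      (use AE_rep_l2_scaleR[of r F] in \<open>auto elim!: eventually_mono\<close>)
  then show "(r *\<^sub>R F) \<bullet> H = r * (F \<bullet> H)"
    by (simp add: inner_l2_def)
  show "0 \<le> F \<bullet> F"
    by (simp add: inner_l2_def integral_nonneg_AE)
  have "F \<bullet> F = 0 \<longleftrightarrow> (AE x in lborel. rep_l2 F x \<bullet> rep_l2 F x = 0)"
    unfolding inner_l2_def by (rule integral_nonneg_eq_0_iff_AE) auto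
  also have "\<dots> \<longleftrightarrow> F = 0"
  proof
    assume "AE x in lborel. rep_l2 F x \<bullet> rep_l2 F x = 0"
    with AE_rep_l2_zero show "F = 0"
      by (intro l2_eqI) (auto elim!: eventually_elim2)
  next
    assume "F = 0"
    then show "AE x in lborel. rep_l2 F x \<bullet> rep_l2 F x = 0"
      using AE_rep_l2_zero by (auto elim!: eventually_mono)
  qed
  finally show "F \<bullet> F = 0 \<longleftrightarrow> F = 0" .
qed

end

lemma norm_l2_sq:
  "(norm F)\<^sup>2 = (LINT x|lborel. (norm (rep_l2 F x))\<^sup>2)"
  by (simp add: power2_norm_eq_inner inner_l2_def)

lemma inner_abs_l2:
  assumes "sq_integrable f" "sq_integrable g"
  shows "abs_l2 f \<bullet> abs_l2 g = (LINT x|lborel. f x \<bullet> g x)"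
proof -
  note [measurable] = sq_integrableD(1)[OF assms(1)] sq_integrableD(1)[OF assms(2)]
  show ?thesis
    unfolding inner_l2_def
    by (rule integral_cong_AE)
      (use AE_rep_abs_l2[OF assms(1)] AE_rep_abs_l2[OF assms(2)] in \<open>auto elim!: eventually_elim2\<close>)
qed

lemma inner_rep_abs_l2:
  assumes "sq_integrable g"
  shows "F \<bullet> abs_l2 g = (LINT x|lborel. rep_l2 F x \<bullet> g x)"
  using inner_abs_l2[OF sq_integrable_rep_l2 assms, of F] by simp

lemma norm_abs_l2_sq:
  assumes "sq_integrable f"
  shows "(norm (abs_l2 f))\<^sup>2 = (LINT x|lborel. (norm (f x))\<^sup>2)"
  by (simp add: power2_norm_eq_inner inner_abs_l2 assms)

lemma nn_integral_norm_l2_sq: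
  "(\<integral>\<^sup>+x. ennreal ((norm (rep_l2 F x))\<^sup>2) \<partial>lborel) = ennreal ((norm F)\<^sup>2)"
  unfolding norm_l2_sq
  by (rule nn_integral_eq_integral) (use sq_integrable_rep_l2 sq_integrableD in auto)

text \<open>Multiplication by a positive bounded integrable weight maps \<open>L2\<close> into
  \<open>L1\<close>, where Cauchy sequences have almost everywhere Cauchy subsequences. The
  inequality \<open>wb\<close> plays the part of Cauchy-Schwarz, and positivity of the weight
  transfers the pointwise statement back.\<close>

lemma l2_Cauchy_AE_subseq:
  fixes x :: "nat \<Rightarrow> ('a::euclidean_space, 'b::euclidean_space) l2"
  assumes "Cauchy x"
  obtains r where "strict_mono (r :: nat \<Rightarrow> nat)"
    and "AE t in lborel. Cauchy (\<lambda>n. rep_l2 (x (r n)) t)"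
proof -
  obtain w :: "'a \<Rightarrow> real" where w [measurable]: "w \<in> borel_measurable lborel"
    and w0: "\<And>x. w x > 0" and w1: "\<And>x. w x \<le> 1" and wint: "integrable lborel w"
    using sigma_finite_measure.obtain_positive_integrable_function[OF sigma_finite_lborel] by metis
  have w2: "integrable lborel (\<lambda>t. (w t)\<^sup>2)"
    by (rule Bochner_Integration.integrable_bound[OF wint])
      (use w0 w1 in \<open>auto simp: power2_eq_square abs_mult less_imp_le intro!: AE_I2 mult_left_le\<close>)
  have wb: "w t * norm y \<le> e * (w t)\<^sup>2 + (norm y)\<^sup>2 / e" if "e > 0" for e t and y :: 'b
  proof -
    have "e * (w t)\<^sup>2 + (norm y)\<^sup>2 / e - 2 * (w t * norm y) = (e * w t - norm y)\<^sup>2 / e"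
      using that by (simp add: power2_eq_square field_simps)
    moreover have "(e * w t - norm y)\<^sup>2 / e \<ge> 0"
      using that by simp
    ultimately have "2 * (w t * norm y) \<le> e * (w t)\<^sup>2 + (norm y)\<^sup>2 / e"
      by linarith
    moreover have "0 \<le> w t * norm y" using w0[of t] by simp
    ultimately show ?thesis by linarith
  qed
  define s where "s n t = w t *\<^sub>R rep_l2 (x n) t" for n t
  have sint: "integrable lborel (s n)" for n
  proof (rule Bochner_Integration.integrable_bound)
    show "integrable lborel (\<lambda>t. (w t)\<^sup>2 + (norm (rep_l2 (x n) t))\<^sup>2)"
      by (intro Bochner_Integration.integrable_add w2 sq_integrableD(3) sq_integrable_rep_l2)
    show "s n \<in> borel_measurable lborel"
      unfolding s_def by simp
    show "AE t in lborel. norm (s n t) \<le> norm ((w t)\<^sup>2 + (norm (rep_l2 (x n) t))\<^sup>2)"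
      using wb[of 1] w0 by (auto simp: s_def abs_mult less_imp_le)
  qed
  have bound: "(LINT t|lborel. norm (s i t - s j t)) \<le> e * (LINT t|lborel. (w t)\<^sup>2) + (norm (x i - x j))\<^sup>2 / e"
    if "e > 0" for e i j
  proof -
    have I: "integrable lborel (\<lambda>t. (norm (rep_l2 (x i - x j) t))\<^sup>2)"
      using sq_integrable_rep_l2 by (auto simp: sq_integrable_def)
    have "(LINT t|lborel. norm (s i t - s j t)) \<le> (LINT t|lborel. e * (w t)\<^sup>2 + (norm (rep_l2 (x i - x j) t))\<^sup>2 / e)"
    proof (rule integral_mono_AE)
      show "integrable lborel (\<lambda>t. norm (s i t - s j t))"
        using sint by auto
      show "integrable lborel (\<lambda>t. e * (w t)\<^sup>2 + (norm (rep_l2 (x i - x j) t))\<^sup>2 / e)"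
        using w2 I by auto
      show "AE t in lborel. norm (s i t - s j t) \<le> e * (w t)\<^sup>2 + (norm (rep_l2 (x i - x j) t))\<^sup>2 / e"
        using AE_rep_l2_minus[of "x i" "x j"]
      proof eventually_elim
        case (elim t)
        have "norm (s i t - s j t) = w t * norm (rep_l2 (x i - x j) t)"
          using w0[of t] by (simp add: s_def elim scaleR_diff_right[symmetric])
        then show ?case using wb[OF that] by simp
      qed
    qed
    also have "\<dots> = e * (LINT t|lborel. (w t)\<^sup>2) + (norm (x i - x j))\<^sup>2 / e"
      using w2 I by (simp add: norm_l2_sq)
    finally show ?thesis .
  qed
  define W where "W = (LINT t|lborel. (w t)\<^sup>2)"
  have W0: "W \<ge> 0" by (simp add: W_def)
  obtain r where r: "strict_mono r" "AE t in lborel. Cauchy (\<lambda>i. s (r i) t)"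
  proof (rule cauchy_L1_AE_cauchy_subseq[of lborel s])
    show "integrable lborel (s n)" for n by (rule sint)
    fix e :: real assume e: "0 < e"
    \<comment> \<open>This \<open>d\<close> makes the weight term of \<open>bound\<close> at most
      \<open>e / 2\<close>, and norm differences below \<open>sqrt (d * e / 2)\<close> make the
      other term smaller than \<open>e / 2\<close>.\<close>
    define d where "d = e / (2 * (W + 1))"
    have d: "d > 0" using e W0 by (simp add: d_def)
    have dW: "d * W \<le> e / 2"
      using e W0 by (simp add: d_def field_simps)
    have "sqrt (d * e / 2) > 0" using d e by simp
    then obtain N where N: "\<And>i j. i \<ge> N \<Longrightarrow> j \<ge> N \<Longrightarrow> norm (x i - x j) < sqrt (d * e / 2)"
      using CauchyD[OF assms] by blast
    show "\<exists>N. \<forall>i\<ge>N. \<forall>j\<ge>N. (LINT t|lborel. norm (s i t - s j t)) < e"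
    proof (intro exI[of _ N] allI impI)
      fix i j assume "i \<ge> N" "j \<ge> N"
      then have "(norm (x i - x j))\<^sup>2 < (sqrt (d * e / 2))\<^sup>2"
        using N by (intro power_strict_mono) auto
      then have "(norm (x i - x j))\<^sup>2 / d < e / 2"
        using d e by (simp add: field_simps)
      then show "(LINT t|lborel. norm (s i t - s j t)) < e"
        using bound[OF d, of i j] dW unfolding W_def by linarith
    qed
  qed (use that in blast)
  have "AE t in lborel. Cauchy (\<lambda>n. rep_l2 (x (r n)) t)"
    using r(2)
  proof eventually_elim
    case (elim t)
    have "Cauchy (\<lambda>n. (1 / w t) *\<^sub>R s (r n) t)"
      by (rule bounded_linear.Cauchy[OF bounded_linear_scaleR_right elim])
    then show ?case
      using w0[of t] by (simp add: s_def less_imp_neq[symmetric])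
  qed
  with r(1) show thesis by (rule that)
qed

instance l2 :: (euclidean_space, euclidean_space) complete_space
proof
  fix x :: "nat \<Rightarrow> ('a, 'b) l2" assume C: "Cauchy x"
  obtain r where r: "strict_mono (r :: nat \<Rightarrow> nat)"
    and AE: "AE t in lborel. Cauchy (\<lambda>n. rep_l2 (x (r n)) t)"
    using l2_Cauchy_AE_subseq[OF C] by metis
  define f where "f t = lim (\<lambda>n. rep_l2 (x (r n)) t)" for t
  have f [measurable]: "f \<in> borel_measurable borel"
    unfolding f_def by (rule borel_measurable_lim_metric) simp
  have lim: "AE t in lborel. (\<lambda>n. rep_l2 (x (r n)) t) \<longlonglongrightarrow> f t"
    using AE by eventually_elim (simp add: f_def Cauchy_convergent_iff convergent_LIMSEQ_iff)
  \<comment> \<open>Fatou's lemma along the almost everywhere convergent subsequence: an eventual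
    bound on the distances to \<open>x n\<close> passes to the distance between the pointwise limit
    and \<open>x n\<close>.\<close>
  have bound: "(\<integral>\<^sup>+t. ennreal ((norm (f t - rep_l2 (x n) t))\<^sup>2) \<partial>lborel) \<le> ennreal (e\<^sup>2)"
    if N: "\<And>i. i \<ge> N \<Longrightarrow> norm (x i - x n) \<le> e" and e: "e \<ge> 0" for n N e
  proof -
    have "(\<integral>\<^sup>+t. ennreal ((norm (f t - rep_l2 (x n) t))\<^sup>2) \<partial>lborel)
        = (\<integral>\<^sup>+t. liminf (\<lambda>m. ennreal ((norm (rep_l2 (x (r m)) t - rep_l2 (x n) t))\<^sup>2)) \<partial>lborel)"
    proof (rule nn_integral_cong_AE)
      show "AE t in lborel. ennreal ((norm (f t - rep_l2 (x n) t))\<^sup>2)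
          = liminf (\<lambda>m. ennreal ((norm (rep_l2 (x (r m)) t - rep_l2 (x n) t))\<^sup>2))"
        using lim
      proof eventually_elim
        case (elim t)
        have "(\<lambda>m. ennreal ((norm (rep_l2 (x (r m)) t - rep_l2 (x n) t))\<^sup>2))
            \<longlonglongrightarrow> ennreal ((norm (f t - rep_l2 (x n) t))\<^sup>2)"
          by (intro tendsto_ennrealI tendsto_power tendsto_norm tendsto_diff elim tendsto_const)
        then show ?case
          by (rule lim_imp_Liminf[OF sequentially_bot, symmetric])
      qed
    qed
    also have "\<dots> \<le> liminf (\<lambda>m. \<integral>\<^sup>+t. ennreal ((norm (rep_l2 (x (r m)) t - rep_l2 (x n) t))\<^sup>2) \<partial>lborel)"
      by (rule nn_integral_liminf) simp
    also have "\<dots> \<le> ennreal (e\<^sup>2)"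
    proof (rule Liminf_le)
      have "\<forall>\<^sub>F m in sequentially. m \<ge> N" by (rule eventually_ge_at_top)
      then show "\<forall>\<^sub>F m in sequentially. (\<integral>\<^sup>+t. ennreal ((norm (rep_l2 (x (r m)) t - rep_l2 (x n) t))\<^sup>2) \<partial>lborel) \<le> ennreal (e\<^sup>2)"
      proof eventually_elim
        case (elim m)
        then have "r m \<ge> N" using seq_suble[OF r, of m] by linarith
        then have le: "norm (x (r m) - x n) \<le> e" by (rule N)
        have "(\<integral>\<^sup>+t. ennreal ((norm (rep_l2 (x (r m)) t - rep_l2 (x n) t))\<^sup>2) \<partial>lborel)
            = (\<integral>\<^sup>+t. ennreal ((norm (rep_l2 (x (r m) - x n) t))\<^sup>2) \<partial>lborel)"
          by (rule nn_integral_cong_AE) (use AE_rep_l2_minus[of "x (r m)" "x n"] in \<open>auto elim!: eventually_mono\<close>)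
        also have "\<dots> = ennreal ((norm (x (r m) - x n))\<^sup>2)"
          by (rule nn_integral_norm_l2_sq)
        also have "\<dots> \<le> ennreal (e\<^sup>2)"
          using le by (intro ennreal_leI power_mono) auto
        finally show ?case .
      qed
    qed simp
    finally show ?thesis .
  qed
  have sqd: "sq_integrable (\<lambda>t. f t - rep_l2 (x n) t)"
    if N: "\<And>i. i \<ge> N \<Longrightarrow> norm (x i - x n) \<le> e" and e: "e \<ge> 0" for n N e
  proof -
    have "(\<integral>\<^sup>+t. ennreal ((norm (f t - rep_l2 (x n) t))\<^sup>2) \<partial>lborel) \<le> ennreal (e\<^sup>2)"
      by (rule bound[of N]) (use N e in auto)
    also have "\<dots> < \<infinity>" by simp
    finally show ?thesis
      unfolding sq_integrable_def by (auto intro!: integrableI_bounded)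
  qed
  obtain N1 where N1: "\<And>i j. i \<ge> N1 \<Longrightarrow> j \<ge> N1 \<Longrightarrow> norm (x i - x j) < 1"
    using CauchyD[OF C, of 1] by auto
  have "sq_integrable (\<lambda>t. f t - rep_l2 (x N1) t)"
    by (rule sqd[of N1 _ 1]) (use N1 in \<open>auto intro: less_imp_le\<close>)
  from sq_integrable_add[OF this sq_integrable_rep_l2[of "x N1"]]
  have sqf: "sq_integrable f" by simp
  have "x \<longlonglongrightarrow> abs_l2 f"
  proof (rule metric_LIMSEQ_I)
    fix e :: real assume e: "e > 0"
    obtain N where N: "\<And>i j. i \<ge> N \<Longrightarrow> j \<ge> N \<Longrightarrow> norm (x i - x j) < e / 2"
      using CauchyD[OF C, of "e / 2"] e by auto
    have "dist (x n) (abs_l2 f) < e" if n: "n \<ge> N" for n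
    proof -
      have le: "norm (x i - x n) \<le> e / 2" if "i \<ge> N" for i
        using N[OF that n] by simp
      have "ennreal ((norm (abs_l2 f - x n))\<^sup>2) = (\<integral>\<^sup>+t. ennreal ((norm (rep_l2 (abs_l2 f - x n) t))\<^sup>2) \<partial>lborel)"
        by (rule nn_integral_norm_l2_sq[symmetric])
      also have "\<dots> = (\<integral>\<^sup>+t. ennreal ((norm (f t - rep_l2 (x n) t))\<^sup>2) \<partial>lborel)"
        by (rule nn_integral_cong_AE)
          (use AE_rep_l2_minus[of "abs_l2 f" "x n"] AE_rep_abs_l2[OF sqf] in \<open>auto elim!: eventually_elim2\<close>)
      also have "\<dots> \<le> ennreal ((e / 2)\<^sup>2)"
        by (rule bound[OF le]) (use e in auto)
      finally have "(norm (abs_l2 f - x n))\<^sup>2 \<le> (e / 2)\<^sup>2"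
        using e by (simp add: ennreal_le_iff)
      then have "norm (abs_l2 f - x n) \<le> e / 2"
        by (rule power2_le_imp_le) (use e in simp)
      then show ?thesis
        using e by (simp add: dist_norm norm_minus_commute)
    qed
    then show "\<exists>N. \<forall>n\<ge>N. dist (x n) (abs_l2 f) < e" by blast
  qed
  then show "convergent x" by (rule convergentI)
qed

subsection \<open>Test functions\<close>

text \<open>Used in the product rule, which leaves undifferentiated factors that must be regular
  enough as well.\<close>

lemma Ck_Suc_D: "Ck (Suc k) f \<Longrightarrow> Ck k f"
proof (induction k arbitrary: f)
  case 0
  then show ?case
    by (auto intro!: differentiable_imp_continuous_on simp: differentiable_on_def
        intro: differentiable_at_withinI)
next
  case (Suc k)
  have "Ck (Suc k) (\<lambda>x. frechet_derivative f (at x) v)" for v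
    using Suc.prems unfolding Ck.simps(2)[of "Suc k"] by blast
  moreover have "\<forall>x. f differentiable (at x)"
    using Suc.prems unfolding Ck.simps(2)[of "Suc k"] by blast
  ultimately show ?case
    using Suc.IH unfolding Ck.simps(2)[of k] by blast
qed

lemma Ck_SucI:
  assumes "\<And>x. (f has_derivative f' x) (at x)" "\<And>v. Ck k (\<lambda>x. f' x v)"
  shows "Ck (Suc k) f"
proof -
  have "frechet_derivative f (at x) = f' x" for x
    using frechet_derivative_at[OF assms(1)] by simp
  then show ?thesis
    using assms by (auto simp: differentiable_def)
qed

lemma Ck_Suc_has_derivative:
  "Ck (Suc k) f \<Longrightarrow> (f has_derivative frechet_derivative f (at x)) (at x)"
  by (simp add: frechet_derivative_works[symmetric])

lemma Ck_Suc_frechet: "Ck (Suc k) f \<Longrightarrow> Ck k (\<lambda>x. frechet_derivative f (at x) v)"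
  by simp

lemma Ck_add: "Ck k f \<Longrightarrow> Ck k g \<Longrightarrow> Ck k (\<lambda>x. f x + g x)"
proof (induction k arbitrary: f g)
  case 0
  then show ?case by (auto intro: continuous_on_add)
next
  case (Suc k)
  show ?case
  proof (rule Ck_SucI)
    show "((\<lambda>x. f x + g x) has_derivative
        (\<lambda>v. frechet_derivative f (at x) v + frechet_derivative g (at x) v)) (at x)" for x
      using Suc.prems by (intro has_derivative_add Ck_Suc_has_derivative)
    show "Ck k (\<lambda>x. frechet_derivative f (at x) v + frechet_derivative g (at x) v)" for v
      using Suc.prems by (intro Suc.IH Ck_Suc_frechet)
  qed
qed

lemma Ck_mult: "Ck k f \<Longrightarrow> Ck k g \<Longrightarrow> Ck k (\<lambda>x. f x * g x)"
proof (induction k arbitrary: f g)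
  case 0
  then show ?case by (auto intro: continuous_on_mult)
next
  case (Suc k)
  show ?case
  proof (rule Ck_SucI)
    show "((\<lambda>x. f x * g x) has_derivative
        (\<lambda>v. f x * frechet_derivative g (at x) v + frechet_derivative f (at x) v * g x)) (at x)" for x
      using Suc.prems by (intro has_derivative_mult Ck_Suc_has_derivative)
    show "Ck k (\<lambda>x. f x * frechet_derivative g (at x) v + frechet_derivative f (at x) v * g x)" for v
      by (intro Ck_add Suc.IH Ck_Suc_frechet Ck_Suc_D[OF Suc.prems(1)] Ck_Suc_D[OF Suc.prems(2)] Suc.prems)
  qed
qed

lemma Ck_const: "Ck k (\<lambda>x. c)"
proof (induction k arbitrary: c)
  case (Suc k)
  show ?case
    by (rule Ck_SucI[where f' = "\<lambda>x v. 0"]) (auto intro: Suc)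
qed simp

lemma Ck_translate: "Ck k f \<Longrightarrow> Ck k (\<lambda>x. f (x + z))"
proof (induction k arbitrary: f)
  case 0
  then show ?case
    by (simp add: continuous_on_compose2[of UNIV f UNIV "\<lambda>x. x + z"] continuous_on_add)
next
  case (Suc k)
  show ?case
  proof (rule Ck_SucI)
    fix x
    have "(f has_derivative frechet_derivative f (at (x + z))) (at (x + z) within UNIV)"
      using Suc.prems Ck_Suc_has_derivative by blast
    moreover have "((\<lambda>x. x + z) has_derivative (\<lambda>v. v)) (at x)"
      by (auto intro!: derivative_eq_intros)
    ultimately show "((\<lambda>x. f (x + z)) has_derivative frechet_derivative f (at (x + z))) (at x)"
      using has_derivative_compose[of "\<lambda>x. x + z" "\<lambda>v. v" x UNIV] by simp
    show "Ck k (\<lambda>x. frechet_derivative f (at (x + z)) v)" for v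
      using Suc.IH[of "\<lambda>x. frechet_derivative f (at x) v"] Suc.prems Ck_Suc_frechet by blast
  qed
qed

text \<open>The family is closed under differentiation because
  \<open>(p(1/t) e\<^sup>-\<^sup>1\<^sup>/\<^sup>t)' = t\<^sup>-\<^sup>2 (p(1/t) - p'(1/t)) e\<^sup>-\<^sup>1\<^sup>/\<^sup>t\<close>.\<close>
definition flat_exp :: "real poly \<Rightarrow> real \<Rightarrow> real" where
  "flat_exp p t = (if t > 0 then poly p (1 / t) * exp (- (1 / t)) else 0)"

lemma poly_div_exp_tendsto_0:
  fixes p :: "real poly"
  shows "((\<lambda>y. poly p y * exp (- y)) \<longlongrightarrow> 0) at_top"
proof -
  have "((\<lambda>y. \<Sum>i\<le>degree p. coeff p i * (y ^ i / exp y)) \<longlongrightarrow> (\<Sum>i\<le>degree p. coeff p i * 0)) at_top"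
    by (intro tendsto_sum tendsto_mult tendsto_const tendsto_power_div_exp_0)
  then show ?thesis
    by (simp add: poly_altdef sum_distrib_right exp_minus divide_inverse mult.assoc)
qed

text \<open>The factor \<open>[:0, 0, 1:]\<close> is the \<open>1 / t\<^sup>2\<close> of the chain
  rule. At 0 the right-hand difference quotient becomes, with \<open>y = 1 / h\<close>, the
  polynomial \<open>pCons 0 p\<close> at \<open>y\<close> times \<open>exp (- y)\<close>, which
  tends to 0.\<close>

lemma flat_exp_has_derivative:
  "(flat_exp p has_real_derivative flat_exp ([:0, 0, 1:] * (p - pderiv p)) t) (at t)"
proof -
  consider "t > 0" | "t < 0" | "t = 0" by linarith
  then show ?thesis
  proof cases
    case 1
    have "((\<lambda>t. poly p (1 / t) * exp (- (1 / t))) has_real_derivative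
        flat_exp ([:0, 0, 1:] * (p - pderiv p)) t) (at t)"
      using 1 by (auto intro!: derivative_eq_intros simp: flat_exp_def field_simps power2_eq_square)
    then show ?thesis
      by (rule has_field_derivative_transform_within_open[of _ _ _ "{0<..}"])
        (use 1 in \<open>auto simp: flat_exp_def\<close>)
  next
    case 2
    have "((\<lambda>t. 0) has_real_derivative 0) (at t)" by simp
    then have "(flat_exp p has_real_derivative 0) (at t)"
      by (rule has_field_derivative_transform_within_open[of _ _ _ "{..<0}"])
        (use 2 in \<open>auto simp: flat_exp_def\<close>)
    then show ?thesis using 2 by (simp add: flat_exp_def)
  next
    case 3
    have "((\<lambda>y. poly (pCons 0 p) y * exp (- y)) \<longlongrightarrow> 0) at_top"
      by (rule poly_div_exp_tendsto_0)
    then have "((\<lambda>h. poly (pCons 0 p) (inverse h) * exp (- inverse h)) \<longlongrightarrow> 0) (at_right 0)"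
      by (rule filterlim_compose) (rule filterlim_inverse_at_top_right)
    then have R: "((\<lambda>h. flat_exp p h / h) \<longlongrightarrow> 0) (at_right 0)"
      by (rule Lim_transform_eventually)
        (auto simp: flat_exp_def eventually_at_filter field_simps)
    have L: "((\<lambda>h. flat_exp p h / h) \<longlongrightarrow> 0) (at_left 0)"
      by (rule Lim_transform_eventually[OF tendsto_const])
        (auto simp: flat_exp_def eventually_at_filter)
    have "((\<lambda>h. flat_exp p h / h) \<longlongrightarrow> 0) (at 0)"
      using L R by (simp add: filterlim_at_split)
    then show ?thesis
      using 3 by (simp add: DERIV_def flat_exp_def[of _ 0])
  qed
qed

text \<open>The induction is over all polynomials at once, because each derivative replaces
  \<open>p\<close> by another polynomial.\<close>

lemma Ck_flat_exp: "Ck k (\<lambda>x. flat_exp p (a * (x $ i) + b))"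
proof (induction k arbitrary: p)
  case 0
  have "continuous_on UNIV (flat_exp p)"
    using flat_exp_has_derivative by (intro continuous_at_imp_continuous_on ballI DERIV_isCont)
  then have "continuous_on UNIV (\<lambda>x :: real^2. flat_exp p (a * (x $ i) + b))"
    by (rule continuous_on_compose2[of UNIV "flat_exp p" UNIV "\<lambda>x. a * (x $ i) + b"])
      (auto intro!: continuous_on_add continuous_on_mult continuous_on_const continuous_on_component)
  then show ?case by simp
next
  case (Suc k)
  define q where "q = [:0, 0, 1:] * (p - pderiv p)"
  show ?case
  proof (rule Ck_SucI[where f' = "\<lambda>x v. (a * v $ i) * flat_exp q (a * (x $ i) + b)"])
    fix x :: "real^2"
    have 1: "(flat_exp p has_derivative (\<lambda>h. flat_exp q (a * (x $ i) + b) * h)) (at (a * (x $ i) + b))"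
      using flat_exp_has_derivative[of p "a * (x $ i) + b"]
      by (simp add: has_field_derivative_def q_def)
    have 2: "((\<lambda>x. a * (x $ i) + b) has_derivative (\<lambda>v. a * v $ i)) (at x)"
      by (intro has_derivative_add_const has_derivative_mult_right bounded_linear_imp_has_derivative
          bounded_linear_vec_nth)
    show "((\<lambda>x. flat_exp p (a * (x $ i) + b)) has_derivative
        (\<lambda>v. (a * v $ i) * flat_exp q (a * (x $ i) + b))) (at x)"
      using has_derivative_compose[OF 2 1] by (simp add: mult.commute)
    show "Ck k (\<lambda>x. (a * v $ i) * flat_exp q (a * (x $ i) + b))" for v
      by (intro Ck_mult Ck_const Suc)
  qed
qed

lemma compact_closure_subset:
  fixes A K :: "'a::heine_borel set"
  assumes "compact K" "A \<subseteq> K"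
  shows "compact (closure A)"
proof -
  have "bounded A"
    using compact_imp_bounded[OF assms(1)] assms(2) by (rule bounded_subset)
  then show ?thesis
    by (rule compact_closure[THEN iffD2])
qed

lemma test_functionD:
  assumes "test_function \<phi>"
  shows "Ck k \<phi>" "compact (closure {x. \<phi> x \<noteq> 0})" "continuous_on UNIV \<phi>"
    "(\<phi> has_derivative frechet_derivative \<phi> (at x)) (at x)"
  using assms Ck.simps(1)[of \<phi>] Ck_Suc_has_derivative[of 0 \<phi>]
  unfolding test_function_def by blast+

text \<open>Off the closed support the function vanishes on an open set, so the derivative vanishes
  there too.\<close>

lemma test_function_frechet:
  assumes "test_function \<phi>"
  shows "test_function (\<lambda>x. frechet_derivative \<phi> (at x) v)"
  unfolding test_function_def
proof
  show "\<forall>k. Ck k (\<lambda>x. frechet_derivative \<phi> (at x) v)"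
    using test_functionD(1)[OF assms] Ck_Suc_frechet by blast
  define K where "K = closure {x. \<phi> x \<noteq> 0}"
  have K: "compact K" using test_functionD(2)[OF assms] by (simp add: K_def)
  have "frechet_derivative \<phi> (at x) v = 0" if "x \<notin> K" for x
  proof -
    have "((\<lambda>x. 0) has_derivative (\<lambda>v. 0)) (at x)" by simp
    then have "(\<phi> has_derivative (\<lambda>v. 0)) (at x)"
      by (rule has_derivative_transform_within_open[of _ _ _ _ "- K"])
        (use that closure_subset[of "{x. \<phi> x \<noteq> 0}"] in \<open>auto simp: K_def\<close>)
    then show ?thesis
      using frechet_derivative_at by metis
  qed
  then show "compact (closure {x. frechet_derivative \<phi> (at x) v \<noteq> 0})"
    by (intro compact_closure_subset[OF K]) auto
qed

lemma test_function_translate: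
  assumes "test_function \<phi>"
  shows "test_function (\<lambda>x. \<phi> (x + z))"
    and "frechet_derivative (\<lambda>x. \<phi> (x + z)) (at x) = frechet_derivative \<phi> (at (x + z))"
proof -
  have "{x. \<phi> (x + z) \<noteq> 0} = (\<lambda>x. - z + x) ` {x. \<phi> x \<noteq> 0}"
    by (auto simp: image_iff) (metis add_diff_cancel)
  then have "closure {x. \<phi> (x + z) \<noteq> 0} = (\<lambda>x. - z + x) ` closure {x. \<phi> x \<noteq> 0}"
    by (simp only: closure_translation)
  then have "compact (closure {x. \<phi> (x + z) \<noteq> 0})"
    using test_functionD(2)[OF assms] by (simp only: compact_translation)
  then show "test_function (\<lambda>x. \<phi> (x + z))"
    using Ck_translate test_functionD(1)[OF assms] by (simp add: test_function_def)
  have "(\<phi> has_derivative frechet_derivative \<phi> (at (x + z))) (at (x + z) within UNIV)"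
    using test_functionD(4)[OF assms] by simp
  moreover have "((\<lambda>x. x + z) has_derivative (\<lambda>v. v)) (at x)"
    by (auto intro!: derivative_eq_intros)
  ultimately have "((\<lambda>x. \<phi> (x + z)) has_derivative frechet_derivative \<phi> (at (x + z))) (at x)"
    using has_derivative_compose[of "\<lambda>x. x + z" "\<lambda>v. v" x UNIV] by simp
  then show "frechet_derivative (\<lambda>x. \<phi> (x + z)) (at x) = frechet_derivative \<phi> (at (x + z))"
    by (rule frechet_derivative_at[symmetric])
qed

lemma test_function_bounded:
  assumes "test_function \<phi>"
  obtains C where "C \<ge> 0" "\<And>x. \<bar>\<phi> x\<bar> \<le> C * indicator (closure {x. \<phi> x \<noteq> 0}) x"
proof -
  have "compact (\<phi> ` closure {x. \<phi> x \<noteq> 0})"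
    by (intro compact_continuous_image continuous_on_subset[OF test_functionD(3)[OF assms] subset_UNIV]
        test_functionD(2)[OF assms])
  then have "bounded (\<phi> ` closure {x. \<phi> x \<noteq> 0})"
    by (rule compact_imp_bounded)
  then obtain C where C: "\<And>x. x \<in> closure {x. \<phi> x \<noteq> 0} \<Longrightarrow> \<bar>\<phi> x\<bar> \<le> C"
    unfolding bounded_iff by (metis imageI real_norm_def)
  have "\<bar>\<phi> x\<bar> \<le> max C 0 * indicator (closure {x. \<phi> x \<noteq> 0}) x" for x
    using C[of x] closure_subset[of "{x. \<phi> x \<noteq> 0}"] by (auto simp: indicator_def)
  then show thesis by (intro that[of "max C 0"]) auto
qed

lemma test_function_measurable [measurable_dest]:
  "test_function \<phi> \<Longrightarrow> \<phi> \<in> borel_measurable borel"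
  by (intro borel_measurable_continuous_onI test_functionD(3))

lemma integrable_indicator_compact:
  fixes K :: "(real^2) set"
  shows "compact K \<Longrightarrow> integrable lborel (\<lambda>x. indicator K x :: real)"
  using emeasure_compact_finite[of K] by (simp add: compact_imp_closed less_top borel_closed)

lemma test_function_sq_integrable:
  assumes "test_function \<phi>"
  shows "sq_integrable \<phi>"
proof -
  obtain C where C: "C \<ge> 0" "\<And>x. \<bar>\<phi> x\<bar> \<le> C * indicator (closure {x. \<phi> x \<noteq> 0}) x"
    using test_function_bounded[OF assms] by metis
  note [measurable] = test_function_measurable[OF assms]
  have "sq_integrable (indicator (closure {x. \<phi> x \<noteq> 0}) :: real^2 \<Rightarrow> real)"
  proof -
    have "(\<lambda>x. (norm (indicator K x :: real))\<^sup>2) = indicator K" for K :: "(real^2) set"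
      by (auto simp: indicator_def)
    then show ?thesis
      unfolding sq_integrable_def
      using integrable_indicator_compact[OF test_functionD(2)[OF assms]] by (simp add: borel_closed)
  qed
  then show ?thesis
    by (rule sq_integrable_bound[where C = C]) (use C in auto)
qed

subsection \<open>The fundamental lemma of the calculus of variations\<close>

text \<open>Each factor has the form \<open>exp (- 1 / (n * t))\<close> in the distance
  \<open>t\<close> to a face of the box, so large \<open>n\<close> sharpens the bump towards the
  indicator of the open box.\<close>

definition box_bump :: "nat \<Rightarrow> real^2 \<Rightarrow> real^2 \<Rightarrow> real^2 \<Rightarrow> real" where
  "box_bump n a b x = (\<Prod>i\<in>UNIV. flat_exp 1 (real n * x $ i + - (real n * a $ i))
     * flat_exp 1 (- real n * x $ i + real n * b $ i))"

lemma box_bump_eq: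
  "box_bump n a b x = (flat_exp 1 (real n * x $ 1 + - (real n * a $ 1)) * flat_exp 1 (- real n * x $ 1 + real n * b $ 1))
    * (flat_exp 1 (real n * x $ 2 + - (real n * a $ 2)) * flat_exp 1 (- real n * x $ 2 + real n * b $ 2))"
  by (simp add: box_bump_def UNIV_2)

lemma test_function_box_bump:
  assumes "n > 0"
  shows "test_function (box_bump n a b)"
proof -
  have C: "Ck k (box_bump n a b)" for k
    unfolding box_bump_eq[abs_def] by (intro Ck_mult Ck_flat_exp)
  have "{x. box_bump n a b x \<noteq> 0} \<subseteq> cbox a b"
  proof
    fix x assume "x \<in> {x. box_bump n a b x \<noteq> 0}"
    then have "real n * a $ 1 < real n * x $ 1" "real n * x $ 1 < real n * b $ 1"
      "real n * a $ 2 < real n * x $ 2" "real n * x $ 2 < real n * b $ 2"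
      by (auto simp: box_bump_eq flat_exp_def split: if_splits)
    then show "x \<in> cbox a b"
      using assms by (simp add: mem_box_cart forall_2 less_imp_le)
  qed
  then have "compact (closure {x. box_bump n a b x \<noteq> 0})"
    by (rule compact_closure_subset[OF compact_cbox])
  with C show ?thesis by (simp only: test_function_def) blast
qed

lemma flat_exp_1_bounds: "0 \<le> flat_exp 1 t" "flat_exp 1 t \<le> 1"
  by (auto simp: flat_exp_def)

lemma flat_exp_1_tendsto:
  "(\<lambda>n. flat_exp 1 (real n * t)) \<longlonglongrightarrow> (if t > 0 then 1 else 0)"
proof (cases "t > 0")
  case True
  have "(\<lambda>n. exp (- (1 / (real (Suc n)) / t))) \<longlonglongrightarrow> exp (- (0 / t))"
    by (intro tendsto_intros LIMSEQ_Suc lim_1_over_n) (use True in auto)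
  then have "(\<lambda>n. flat_exp 1 (real (Suc n) * t)) \<longlonglongrightarrow> 1"
    using True by (simp add: flat_exp_def)
  then show ?thesis
    using True by (simp only: filterlim_sequentially_Suc[of "\<lambda>n. flat_exp 1 (real n * t)"]) simp
next
  case False
  then have "flat_exp 1 (real n * t) = 0" for n
    using mult_nonneg_nonpos[of "real n" t] by (simp only: flat_exp_def) auto
  then show ?thesis
    using False by simp
qed

lemma box_bump_bounds: "0 \<le> box_bump n a b x" "box_bump n a b x \<le> indicator (cbox a b) x"
proof -
  show "0 \<le> box_bump n a b x"
    unfolding box_bump_def by (intro prod_nonneg mult_nonneg_nonneg flat_exp_1_bounds)
  have "box_bump n a b x \<le> 1"
    unfolding box_bump_def by (intro prod_le_1 conjI mult_le_one mult_nonneg_nonneg flat_exp_1_bounds)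
  moreover have "box_bump n a b x = 0" if "x \<notin> cbox a b"
  proof -
    have "\<exists>i. x $ i < a $ i \<or> b $ i < x $ i"
      using that by (auto simp: mem_box_cart not_le)
    then obtain i where "x $ i < a $ i \<or> b $ i < x $ i" ..
    then have "real n * x $ i \<le> real n * a $ i \<or> real n * b $ i \<le> real n * x $ i"
      by (auto intro: mult_left_mono)
    then have "flat_exp 1 (real n * x $ i + - (real n * a $ i))
        * flat_exp 1 (- real n * x $ i + real n * b $ i) = 0"
      by (auto simp: flat_exp_def)
    then show ?thesis
      unfolding box_bump_def by (intro prod_zero) auto
  qed
  ultimately show "box_bump n a b x \<le> indicator (cbox a b) x"
    by (auto simp: indicator_def)
qed

lemma box_bump_tendsto: "(\<lambda>n. box_bump n a b x) \<longlonglongrightarrow> indicator (box a b) x"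
proof -
  have "(\<lambda>n. \<Prod>i\<in>UNIV. flat_exp 1 (real n * (x $ i - a $ i)) * flat_exp 1 (real n * (b $ i - x $ i)))
      \<longlonglongrightarrow> (\<Prod>i\<in>UNIV. (if x $ i - a $ i > 0 then 1 else 0) * (if b $ i - x $ i > 0 then 1 else 0))"
    by (intro tendsto_prod tendsto_mult flat_exp_1_tendsto)
  also have "(\<lambda>n. \<Prod>i\<in>UNIV. flat_exp 1 (real n * (x $ i - a $ i)) * flat_exp 1 (real n * (b $ i - x $ i)))
      = (\<lambda>n. box_bump n a b x)"
    by (simp add: box_bump_def right_diff_distrib)
  also have "(\<Prod>i\<in>UNIV. (if x $ i - a $ i > 0 then 1 else 0) * (if b $ i - x $ i > 0 then 1 else 0))
      = (indicator (box a b) x :: real)"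
    by (auto simp: indicator_def mem_box_cart UNIV_2 forall_2)
  finally show ?thesis .
qed

text \<open>The positive and the negative part of \<open>h\<close>, taken as densities, define
  measures that agree and are finite on boxes. Boxes form an intersection-stable generator, so the
  measures agree, and then so do the densities.\<close>

lemma AE_eq_0_if_box_integrals_0:
  fixes h :: "'a::euclidean_space \<Rightarrow> real"
  assumes h [measurable]: "h \<in> borel_measurable borel"
    and int: "\<And>a b. integrable lborel (\<lambda>x. indicator (box a b) x * h x)"
    and zero: "\<And>a b. (LINT x|lborel. indicator (box a b) x * h x) = 0"
  shows "AE x in lborel. h x = 0"
proof -
  define p where "p = (\<lambda>x. ennreal (h x))"
  define m where "m = (\<lambda>x. ennreal (- h x))"
  have [measurable]: "p \<in> borel_measurable lborel" "m \<in> borel_measurable lborel"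
    by (auto simp: p_def m_def)
  have fin: "emeasure (density lborel p) (box a b) < \<infinity>" 
    and eq: "emeasure (density lborel p) (box a b) = emeasure (density lborel m) (box a b)" for a b :: 'a
  proof -
    have P: "emeasure (density lborel p) (box a b) = (\<integral>\<^sup>+x. ennreal (indicator (box a b) x * h x) \<partial>lborel)"
      by (subst emeasure_density) (auto intro!: nn_integral_cong simp: p_def indicator_def)
    have M: "emeasure (density lborel m) (box a b) = (\<integral>\<^sup>+x. ennreal (- (indicator (box a b) x * h x)) \<partial>lborel)"
      by (subst emeasure_density) (auto intro!: nn_integral_cong simp: m_def indicator_def)
    have F: "(\<integral>\<^sup>+x. ennreal (indicator (box a b) x * h x) \<partial>lborel) < \<infinity>"
      "(\<integral>\<^sup>+x. ennreal (- (indicator (box a b) x * h x)) \<partial>lborel) < \<infinity>"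
      using int[of a b] by (auto simp: real_integrable_def less_top)
    have "enn2real (\<integral>\<^sup>+x. ennreal (indicator (box a b) x * h x) \<partial>lborel)
        = enn2real (\<integral>\<^sup>+x. ennreal (- (indicator (box a b) x * h x)) \<partial>lborel)"
      using zero[of a b] int[of a b] by (simp add: real_lebesgue_integral_def)
    then show "emeasure (density lborel p) (box a b) < \<infinity>"
      "emeasure (density lborel p) (box a b) = emeasure (density lborel m) (box a b)"
      using F unfolding P M by (metis ennreal_enn2real infinity_ennreal_def)+
  qed
  have "density lborel p = density lborel m"
  proof (rule measure_eqI_generator_eq[of "range (\<lambda>(a, b). box a b)" UNIV _ _
        "\<lambda>n. box (- (real n *\<^sub>R One)) (real n *\<^sub>R One)"])
    show "Int_stable (range (\<lambda>(a, b). box a b :: 'a set))"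
      by (auto simp: Int_stable_def box_Int_box)
    show "sets (density lborel p) = sigma_sets UNIV (range (\<lambda>(a, b). box a b))"
      "sets (density lborel m) = sigma_sets UNIV (range (\<lambda>(a, b). box a b))"
      by (simp_all add: borel_eq_box)
    show "(\<Union>n. box (- (real n *\<^sub>R One)) (real n *\<^sub>R One)) = (UNIV :: 'a set)"
      by (rule UN_box_eq_UNIV)
    show "emeasure (density lborel p) (box (- (real i *\<^sub>R One)) (real i *\<^sub>R One)) \<noteq> \<infinity>" for i
      using fin by (auto simp: less_top)
    show "emeasure (density lborel p) X = emeasure (density lborel m) X"
      if "X \<in> range (\<lambda>(a, b). box a b)" for X
      using that eq by auto
  qed auto
  then have "AE x in lborel. p x = m x"
    by (intro sigma_finite_measure.density_unique[OF sigma_finite_lborel]) auto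
  then show ?thesis
  proof eventually_elim
    case (elim x)
    then show ?case
      by (cases "h x \<ge> 0") (auto simp: p_def m_def ennreal_neg dest: sym)
  qed
qed

text \<open>Dominated convergence along box bumps turns vanishing test integrals into vanishing
  integrals over open boxes; real and imaginary parts are then treated separately.\<close>

lemma fundamental_lemma:
  fixes h :: "real^2 \<Rightarrow> complex"
  assumes h [measurable]: "h \<in> borel_measurable borel"
    and int: "\<And>a b. integrable lborel (\<lambda>x. indicator (cbox a b) x *\<^sub>R h x)"
    and zero: "\<And>\<phi>. test_function \<phi> \<Longrightarrow> (LINT x|lborel. \<phi> x *\<^sub>R h x) = 0"
  shows "AE x in lborel. h x = 0"
proof -
  have iint: "integrable lborel (\<lambda>x. indicator (box a b) x *\<^sub>R h x)" for a b
    by (rule Bochner_Integration.integrable_bound[OF int[of a b]])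
      (use box_subset_cbox[of a b] in \<open>auto simp: indicator_def\<close>)
  have 0: "(LINT x|lborel. indicator (box a b) x *\<^sub>R h x) = 0" for a b
  proof -
    have "(\<lambda>n. LINT x|lborel. box_bump (Suc n) a b x *\<^sub>R h x) \<longlonglongrightarrow> (LINT x|lborel. indicator (box a b) x *\<^sub>R h x)"
    proof (rule integral_dominated_convergence[where w = "\<lambda>x. norm (indicator (cbox a b) x *\<^sub>R h x)"])
      show "integrable lborel (\<lambda>x. norm (indicator (cbox a b) x *\<^sub>R h x))"
        by (rule integrable_norm[OF int])
      show "AE x in lborel. (\<lambda>n. box_bump (Suc n) a b x *\<^sub>R h x) \<longlonglongrightarrow> indicator (box a b) x *\<^sub>R h x"
        by (intro AE_I2 tendsto_scaleR LIMSEQ_Suc[OF box_bump_tendsto] tendsto_const)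
      show "AE x in lborel. norm (box_bump (Suc n) a b x *\<^sub>R h x) \<le> norm (indicator (cbox a b) x *\<^sub>R h x)" for n
        using box_bump_bounds[of "Suc n" a b] by (auto intro!: AE_I2 mult_right_mono)
      show "(\<lambda>x. box_bump (Suc n) a b x *\<^sub>R h x) \<in> borel_measurable lborel" for n
        using test_function_measurable[OF test_function_box_bump, of "Suc n" a b] by simp
    qed simp
    moreover have "(LINT x|lborel. box_bump (Suc n) a b x *\<^sub>R h x) = 0" for n
      by (intro zero test_function_box_bump) simp
    ultimately show ?thesis by (simp add: LIMSEQ_const_iff)
  qed
  have "AE x in lborel. Re (h x) = 0"
  proof (rule AE_eq_0_if_box_integrals_0)
    show "integrable lborel (\<lambda>x. indicator (box a b) x * Re (h x))" for a b
      using integrable_Re[OF iint[of a b]] by simp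
    show "(LINT x|lborel. indicator (box a b) x * Re (h x)) = 0" for a b
      using integral_Re[OF iint[of a b]] 0[of a b] by simp
  qed simp
  moreover have "AE x in lborel. Im (h x) = 0"
  proof (rule AE_eq_0_if_box_integrals_0)
    show "integrable lborel (\<lambda>x. indicator (box a b) x * Im (h x))" for a b
      using integrable_Im[OF iint[of a b]] by simp
    show "(LINT x|lborel. indicator (box a b) x * Im (h x)) = 0" for a b
      using integral_Im[OF iint[of a b]] 0[of a b] by simp
  qed simp
  ultimately show ?thesis
    by eventually_elim (simp add: complex_eq_iff)
qed

subsection \<open>Weak derivatives and difference quotients\<close>

lemma nn_integral_lborel_translate:
  fixes f :: "'a::euclidean_space \<Rightarrow> ennreal"
  assumes [measurable]: "f \<in> borel_measurable borel"
  shows "(\<integral>\<^sup>+x. f (x + z) \<partial>lborel) = (\<integral>\<^sup>+x. f x \<partial>lborel)"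
proof -
  have "(\<integral>\<^sup>+x. f x \<partial>lborel) = (\<integral>\<^sup>+x. f x \<partial>distr lborel borel ((+) z))"
    by (simp add: lborel_distr_plus)
  also have "\<dots> = (\<integral>\<^sup>+x. f (z + x) \<partial>lborel)"
    by (rule nn_integral_distr) auto
  finally show ?thesis by (simp add: add.commute)
qed

lemma integral_lborel_translate:
  fixes f :: "'a::euclidean_space \<Rightarrow> 'b::euclidean_space"
  assumes [measurable]: "f \<in> borel_measurable borel"
  shows "(LINT x|lborel. f (x + z)) = (LINT x|lborel. f x)"
    and "integrable lborel (\<lambda>x. f (x + z)) \<longleftrightarrow> integrable lborel f"
proof -
  have "(LINT x|lborel. f x) = (LINT x|distr lborel borel ((+) z). f x)"
    by (simp add: lborel_distr_plus)
  also have "\<dots> = (LINT x|lborel. f (z + x))"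
    by (rule integral_distr) auto
  finally show "(LINT x|lborel. f (x + z)) = (LINT x|lborel. f x)"
    by (simp add: add.commute)
  have "integrable lborel f \<longleftrightarrow> integrable (distr lborel borel ((+) z)) f"
    by (simp add: lborel_distr_plus)
  also have "\<dots> \<longleftrightarrow> integrable lborel (\<lambda>x. f (z + x))"
    by (rule integrable_distr_eq) auto
  finally show "integrable lborel (\<lambda>x. f (x + z)) \<longleftrightarrow> integrable lborel f"
    by (simp add: add.commute)
qed

lemma sq_integrable_translate:
  assumes "sq_integrable f"
  shows "sq_integrable (\<lambda>x. f (x + z))"
proof -
  note [measurable] = sq_integrableD(1)[OF assms]
  show ?thesis
    using integral_lborel_translate(2)[of "\<lambda>x. (norm (f x))\<^sup>2" z] assms
    by (auto simp: sq_integrable_def)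
qed

lemma sq_integrable_nn:
  assumes "sq_integrable f"
  shows "(\<integral>\<^sup>+x. ennreal ((norm (f x))\<^sup>2) \<partial>lborel) = ennreal (LINT x|lborel. (norm (f x))\<^sup>2)"
  by (rule nn_integral_eq_integral) (use sq_integrableD[OF assms] in auto)

lemma norm_scaleR_le_sum_squares:
  "norm (r *\<^sub>R y) \<le> r\<^sup>2 + (norm y)\<^sup>2"
proof -
  have "2 * (\<bar>r\<bar> * norm y) \<le> \<bar>r\<bar>\<^sup>2 + (norm y)\<^sup>2"
    using sum_squares_bound[of "\<bar>r\<bar>" "norm y"] by simp
  moreover have "0 \<le> \<bar>r\<bar> * norm y" by simp
  ultimately show ?thesis by (simp del: mult_nonneg_nonneg)
qed

lemma sq_integrable_scaleR_integrable:
  fixes f :: "'a::euclidean_space \<Rightarrow> 'b::euclidean_space" and \<psi> :: "'a \<Rightarrow> real"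
  assumes "sq_integrable \<psi>" "sq_integrable f"
  shows "integrable lborel (\<lambda>x. \<psi> x *\<^sub>R f x)"
    and "(LINT x|lborel. norm (\<psi> x *\<^sub>R f x)) \<le> (LINT x|lborel. (norm (\<psi> x))\<^sup>2) + (LINT x|lborel. (norm (f x))\<^sup>2)"
proof -
  note [measurable] = sq_integrableD(1)[OF assms(1)] sq_integrableD(1)[OF assms(2)]
  have I: "integrable lborel (\<lambda>x. (norm (\<psi> x))\<^sup>2 + (norm (f x))\<^sup>2)"
    using assms by (intro Bochner_Integration.integrable_add sq_integrableD)
  show *: "integrable lborel (\<lambda>x. \<psi> x *\<^sub>R f x)"
    by (rule Bochner_Integration.integrable_bound[OF I])
      (use norm_scaleR_le_sum_squares[of "\<psi> _" "f _"] in \<open>auto simp del: norm_scaleR\<close>)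
  have "(LINT x|lborel. norm (\<psi> x *\<^sub>R f x)) \<le> (LINT x|lborel. (norm (\<psi> x))\<^sup>2 + (norm (f x))\<^sup>2)"
    using norm_scaleR_le_sum_squares[of "\<psi> _" "f _"]
    by (intro integral_mono integrable_norm * I) (auto simp del: norm_scaleR)
  also have "\<dots> = (LINT x|lborel. (norm (\<psi> x))\<^sup>2) + (LINT x|lborel. (norm (f x))\<^sup>2)"
    using assms by (intro Bochner_Integration.integral_add sq_integrableD)
  finally show "(LINT x|lborel. norm (\<psi> x *\<^sub>R f x)) \<le> (LINT x|lborel. (norm (\<psi> x))\<^sup>2) + (LINT x|lborel. (norm (f x))\<^sup>2)" .
qed

text \<open>Justifies Fubini for shifts that move with \<open>t\<close>; the bound is uniform in
  \<open>t\<close> because translations preserve the \<open>L2\<close> norms. The case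
  \<open>a = 0\<close> moves the weak derivative, the case \<open>b = 0\<close> moves the test
  function.\<close>

lemma integrable_moving_product:
  fixes f :: "'a::euclidean_space \<Rightarrow> 'b::euclidean_space" and \<psi> :: "'a \<Rightarrow> real" and a b :: 'a
  assumes "sq_integrable \<psi>" "sq_integrable f"
  shows "integrable (lborel \<Otimes>\<^sub>M lborel)
    (\<lambda>(t, x). indicator {0..1::real} t *\<^sub>R (\<psi> (x + t *\<^sub>R a) *\<^sub>R f (x + t *\<^sub>R b)))" (is "integrable _ ?F")
proof (rule lborel_pair.Fubini_integrable)
  note [measurable] = sq_integrableD(1)[OF assms(1)] sq_integrableD(1)[OF assms(2)]
  show F [measurable]: "?F \<in> borel_measurable (lborel \<Otimes>\<^sub>M lborel)"
    by measurable
  define C where "C = (LINT x|lborel. (norm (\<psi> x))\<^sup>2) + (LINT x|lborel. (norm (f x))\<^sup>2)"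
  have "C \<ge> 0" by (simp add: C_def)
  have le: "(LINT x|lborel. norm (\<psi> (x + t *\<^sub>R a) *\<^sub>R f (x + t *\<^sub>R b))) \<le> C" for t
    using sq_integrable_scaleR_integrable(2)[OF sq_integrable_translate[OF assms(1), of "t *\<^sub>R a"]
        sq_integrable_translate[OF assms(2), of "t *\<^sub>R b"]]
      integral_lborel_translate(1)[of "\<lambda>x. (norm (\<psi> x))\<^sup>2" "t *\<^sub>R a"]
      integral_lborel_translate(1)[of "\<lambda>x. (norm (f x))\<^sup>2" "t *\<^sub>R b"]
    by (simp add: C_def)
  show "integrable lborel (\<lambda>t. LINT x|lborel. norm (?F (t, x)))"
  proof (rule Bochner_Integration.integrable_bound)
    show "integrable lborel (\<lambda>t. C * indicator {0..1::real} t)" by simp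
    show "(\<lambda>t. LINT x|lborel. norm (?F (t, x))) \<in> borel_measurable lborel"
      by measurable
    show "AE t in lborel. norm (LINT x|lborel. norm (?F (t, x))) \<le> norm (C * indicator {0..1::real} t)"
      using le \<open>C \<ge> 0\<close> by (auto simp: indicator_def integral_nonneg_AE)
  qed
  show "AE t in lborel. integrable lborel (\<lambda>x. ?F (t, x))"
    using sq_integrable_scaleR_integrable(1)[OF sq_integrable_translate[OF assms(1)]
        sq_integrable_translate[OF assms(2)]]
    by (auto simp del: scaleR_scaleR)
qed

text \<open>\<open>has_weak_partial\<close> with square integrability in place of local
  integrability; by \<open>has_weak_partial_iff\<close> the two agree on square integrable
  functions.\<close>

definition weak_deriv :: "2 \<Rightarrow> (real^2 \<Rightarrow> complex) \<Rightarrow> (real^2 \<Rightarrow> complex) \<Rightarrow> bool" where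
  "weak_deriv i f g \<longleftrightarrow> sq_integrable f \<and> sq_integrable g \<and>
     (\<forall>\<phi>. test_function \<phi> \<longrightarrow>
        (LINT x|lborel. frechet_derivative \<phi> (at x) (axis i 1) *\<^sub>R f x)
          = - (LINT x|lborel. \<phi> x *\<^sub>R g x))"

lemma sq_integrable_indicator:
  assumes "K \<in> sets borel" "emeasure lborel K < \<infinity>"
  shows "sq_integrable (indicator K :: 'a::euclidean_space \<Rightarrow> real)"
proof -
  have "(\<lambda>x. (norm (indicator K x :: real))\<^sup>2) = indicator K"
    by (auto simp: indicator_def)
  then show ?thesis
    unfolding sq_integrable_def using assms by auto
qed

lemma sq_integrable_indicator_cbox: "sq_integrable (indicator (cbox a b) :: 'a::euclidean_space \<Rightarrow> real)"
  using emeasure_bounded_finite[OF bounded_cbox, of a b] by (intro sq_integrable_indicator) auto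

text \<open>The fundamental theorem of calculus for weak derivatives. Against a test function the
  shift is moved from \<open>g\<close> to the test function, the weak derivative is used there,
  Fubini exchanges the integrals, and the classical theorem for the smooth function evaluates the
  inner one. The fundamental lemma then removes the test function.\<close>

lemma AE_difference_formula:
  fixes f g :: "real^2 \<Rightarrow> complex" and s :: real
  assumes w: "weak_deriv i f g"
  defines "e \<equiv> axis i 1 :: real^2"
  shows "AE x in lborel. f (x + s *\<^sub>R e) - f x
    = s *\<^sub>R (LINT t|lborel. indicator {0..1} t *\<^sub>R g (x + t *\<^sub>R (s *\<^sub>R e)))"
proof -
  have f: "sq_integrable f" and g: "sq_integrable g"
    and wd: "\<And>\<phi>. test_function \<phi> \<Longrightarrow> (LINT x|lborel. frechet_derivative \<phi> (at x) e *\<^sub>R f x)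
          = - (LINT x|lborel. \<phi> x *\<^sub>R g x)"
    using w by (auto simp: weak_deriv_def e_def)
  note [measurable] = sq_integrableD(1)[OF f] sq_integrableD(1)[OF g]
  define \<Gamma> where "\<Gamma> x = (LINT t|lborel. indicator {0..1::real} t *\<^sub>R g (x + t *\<^sub>R (s *\<^sub>R e)))" for x
  have [measurable]: "\<Gamma> \<in> borel_measurable borel"
  proof -
    have "(\<lambda>x. LINT t|lborel. indicator {0..1::real} t *\<^sub>R g (x + t *\<^sub>R (s *\<^sub>R e))) \<in> borel_measurable lborel"
      by measurable
    then show ?thesis by (simp add: \<Gamma>_def[abs_def])
  qed
  have ip: "integrable (lborel \<Otimes>\<^sub>M lborel)
      (\<lambda>(t, x). indicator {0..1::real} t *\<^sub>R (\<psi> x *\<^sub>R g (x + t *\<^sub>R (s *\<^sub>R e))))"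
    if "sq_integrable \<psi>" for \<psi> :: "real^2 \<Rightarrow> real"
    using integrable_moving_product[OF that g, of 0 "s *\<^sub>R e"] by simp
  have \<psi>\<Gamma>: "integrable lborel (\<lambda>x. \<psi> x *\<^sub>R \<Gamma> x)"
    "(LINT x|lborel. \<psi> x *\<^sub>R \<Gamma> x)
      = (LINT t|lborel. indicator {0..1} t *\<^sub>R (LINT x|lborel. \<psi> x *\<^sub>R g (x + t *\<^sub>R (s *\<^sub>R e))))"
    if \<psi>: "sq_integrable \<psi>" for \<psi> :: "real^2 \<Rightarrow> real"
  proof -
    have eq: "(LINT t|lborel. indicator {0..1::real} t *\<^sub>R (\<psi> x *\<^sub>R g (x + t *\<^sub>R (s *\<^sub>R e)))) = \<psi> x *\<^sub>R \<Gamma> x" for x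
      unfolding \<Gamma>_def by (simp add: mult.commute flip: integral_scaleR_right)
    from lborel_pair.integrable_snd[OF ip[OF \<psi>]] eq
    show "integrable lborel (\<lambda>x. \<psi> x *\<^sub>R \<Gamma> x)" by simp
    from lborel_pair.Fubini_integral[OF ip[OF \<psi>]] eq
    show "(LINT x|lborel. \<psi> x *\<^sub>R \<Gamma> x)
      = (LINT t|lborel. indicator {0..1} t *\<^sub>R (LINT x|lborel. \<psi> x *\<^sub>R g (x + t *\<^sub>R (s *\<^sub>R e))))"
      by (simp del: scaleR_scaleR)
  qed
  define h where "h x = f (x + s *\<^sub>R e) - f x - s *\<^sub>R \<Gamma> x" for x
  have hint: "integrable lborel (\<lambda>x. \<psi> x *\<^sub>R h x)"
    and hval: "(LINT x|lborel. \<psi> x *\<^sub>R h x) = (LINT x|lborel. \<psi> x *\<^sub>R f (x + s *\<^sub>R e))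
      - (LINT x|lborel. \<psi> x *\<^sub>R f x) - s *\<^sub>R (LINT x|lborel. \<psi> x *\<^sub>R \<Gamma> x)"
    if \<psi>: "sq_integrable \<psi>" for \<psi> :: "real^2 \<Rightarrow> real"
  proof -
    have I: "integrable lborel (\<lambda>x. \<psi> x *\<^sub>R f (x + s *\<^sub>R e))" "integrable lborel (\<lambda>x. \<psi> x *\<^sub>R f x)"
      "integrable lborel (\<lambda>x. s *\<^sub>R (\<psi> x *\<^sub>R \<Gamma> x))"
      using \<psi> f \<psi>\<Gamma>(1)[OF \<psi>] by (auto intro!: sq_integrable_scaleR_integrable sq_integrable_translate
          simp del: scaleR_scaleR)
    have eq: "(\<lambda>x. \<psi> x *\<^sub>R h x) = (\<lambda>x. \<psi> x *\<^sub>R f (x + s *\<^sub>R e) - \<psi> x *\<^sub>R f x - s *\<^sub>R (\<psi> x *\<^sub>R \<Gamma> x))"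
      by (simp add: h_def scaleR_diff_right mult.commute)
    show "integrable lborel (\<lambda>x. \<psi> x *\<^sub>R h x)"
      unfolding eq using I by (intro Bochner_Integration.integrable_diff)
    show "(LINT x|lborel. \<psi> x *\<^sub>R h x) = (LINT x|lborel. \<psi> x *\<^sub>R f (x + s *\<^sub>R e))
      - (LINT x|lborel. \<psi> x *\<^sub>R f x) - s *\<^sub>R (LINT x|lborel. \<psi> x *\<^sub>R \<Gamma> x)"
      unfolding eq using I
      by (simp only: Bochner_Integration.integral_diff Bochner_Integration.integrable_diff integral_scaleR_right)
  qed
  have "AE x in lborel. h x = 0"
  proof (rule fundamental_lemma)
    show "h \<in> borel_measurable borel"
      unfolding h_def[abs_def] by measurable
    show "integrable lborel (\<lambda>x. indicator (cbox a b) x *\<^sub>R h x)" for a b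
      by (rule hint[OF sq_integrable_indicator_cbox])
    fix \<phi> :: "real^2 \<Rightarrow> real" assume \<phi>: "test_function \<phi>"
    define d where "d x = frechet_derivative \<phi> (at x) e" for x
    have d: "test_function d"
      unfolding d_def[abs_def] by (rule test_function_frechet[OF \<phi>])
    note [measurable] = test_function_measurable[OF \<phi>] test_function_measurable[OF d]
    have 1: "(LINT x|lborel. \<phi> x *\<^sub>R g (x + t *\<^sub>R (s *\<^sub>R e)))
        = - (LINT x|lborel. d (x + t *\<^sub>R (- s *\<^sub>R e)) *\<^sub>R f x)" for t
    proof -
      have "(LINT x|lborel. \<phi> x *\<^sub>R g (x + t *\<^sub>R (s *\<^sub>R e)))
          = (LINT x|lborel. \<phi> ((x + t *\<^sub>R (s *\<^sub>R e)) + t *\<^sub>R (- s *\<^sub>R e)) *\<^sub>R g (x + t *\<^sub>R (s *\<^sub>R e)))"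
        by simp
      also have "\<dots> = (LINT x|lborel. \<phi> (x + t *\<^sub>R (- s *\<^sub>R e)) *\<^sub>R g x)"
        by (rule integral_lborel_translate(1)) measurable
      also have "\<dots> = - (LINT x|lborel. d (x + t *\<^sub>R (- s *\<^sub>R e)) *\<^sub>R f x)"
        using wd[OF test_function_translate(1)[OF \<phi>, of "t *\<^sub>R (- s *\<^sub>R e)"]]
        by (simp only: test_function_translate(2)[OF \<phi>] d_def minus_minus)
      finally show ?thesis .
    qed
    have dc: "continuous_on UNIV (\<lambda>t. d (x + t *\<^sub>R (- s *\<^sub>R e)))" for x
      by (rule continuous_on_compose2[OF test_functionD(3)[OF d], of _ "\<lambda>t. x + t *\<^sub>R (- s *\<^sub>R e)"])
        (auto intro!: continuous_intros)
    \<comment> \<open>The classical fundamental theorem along the segment from \<open>x\<close> to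
      \<open>x - s *\<^sub>R e\<close>.\<close>
    have 2: "s * (LINT t|lborel. indicator {0..1} t *\<^sub>R d (x + t *\<^sub>R (- s *\<^sub>R e))) = \<phi> x - \<phi> (x - s *\<^sub>R e)" for x
    proof -
      have D: "((\<lambda>t. \<phi> (x + t *\<^sub>R (- s *\<^sub>R e))) has_real_derivative - s * d (x + t *\<^sub>R (- s *\<^sub>R e))) (at t)" for t
      proof -
        define y where "y = x + t *\<^sub>R (- s *\<^sub>R e)"
        have lin: "linear (frechet_derivative \<phi> (at y))"
          using test_functionD(4)[OF \<phi>] has_derivative_linear by blast
        have a: "((\<lambda>t. x + t *\<^sub>R (- s *\<^sub>R e)) has_derivative (\<lambda>h. h *\<^sub>R (- s *\<^sub>R e))) (at t)"
          by (auto intro!: derivative_eq_intros)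
        have b: "(\<phi> has_derivative frechet_derivative \<phi> (at y)) (at (x + t *\<^sub>R (- s *\<^sub>R e)))"
          using test_functionD(4)[OF \<phi>] by (simp add: y_def)
        have "((\<lambda>t. \<phi> (x + t *\<^sub>R (- s *\<^sub>R e))) has_derivative
            (\<lambda>h. frechet_derivative \<phi> (at y) (h *\<^sub>R (- s *\<^sub>R e)))) (at t)"
          using has_derivative_compose[OF a b] .
        moreover have "(\<lambda>h. frechet_derivative \<phi> (at y) (h *\<^sub>R (- s *\<^sub>R e))) = (*) (- s * d y)"
          using lin by (auto simp: fun_eq_iff linear_scale linear_neg d_def)
        ultimately show ?thesis
          by (simp add: has_field_derivative_def y_def)
      qed
      have "(LINT t|lborel. (- s * d (x + t *\<^sub>R (- s *\<^sub>R e))) * indicator {0..1} t)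
          = \<phi> (x + 1 *\<^sub>R (- s *\<^sub>R e)) - \<phi> (x + 0 *\<^sub>R (- s *\<^sub>R e))"
      proof (rule integral_FTC_Icc_real)
        show "((\<lambda>t. \<phi> (x + t *\<^sub>R (- s *\<^sub>R e))) has_real_derivative - s * d (x + t *\<^sub>R (- s *\<^sub>R e))) (at t)" for t
          by (rule D)
        show "isCont (\<lambda>t. - s * d (x + t *\<^sub>R (- s *\<^sub>R e))) t" for t
          using dc by (intro continuous_mult continuous_const) (simp add: continuous_on_eq_continuous_at)
      qed simp
      moreover have "(LINT t|lborel. (- s * d (x + t *\<^sub>R (- s *\<^sub>R e))) * indicator {0..1} t)
          = - s * (LINT t|lborel. indicator {0..1} t *\<^sub>R d (x + t *\<^sub>R (- s *\<^sub>R e)))"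
        by (simp add: mult_ac flip: integral_mult_right_zero)
      ultimately show ?thesis by simp
    qed
    have ip2: "integrable (lborel \<Otimes>\<^sub>M lborel)
        (\<lambda>(t, x). indicator {0..1::real} t *\<^sub>R (d (x + t *\<^sub>R (- s *\<^sub>R e)) *\<^sub>R f x))"
      using integrable_moving_product[OF test_function_sq_integrable[OF d] f, of "- s *\<^sub>R e" 0] by simp
    have "s *\<^sub>R (LINT x|lborel. \<phi> x *\<^sub>R \<Gamma> x)
        = - (s *\<^sub>R (LINT t|lborel. LINT x|lborel. indicator {0..1} t *\<^sub>R (d (x + t *\<^sub>R (- s *\<^sub>R e)) *\<^sub>R f x)))"
      unfolding \<psi>\<Gamma>(2)[OF test_function_sq_integrable[OF \<phi>]] 1 by (simp del: scaleR_scaleR)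
    also have "\<dots> = - (s *\<^sub>R (LINT x|lborel. LINT t|lborel. indicator {0..1} t *\<^sub>R (d (x + t *\<^sub>R (- s *\<^sub>R e)) *\<^sub>R f x)))"
      using lborel_pair.Fubini_integral[OF ip2] by simp
    also have "\<dots> = - (LINT x|lborel. s *\<^sub>R (LINT t|lborel. (indicator {0..1} t *\<^sub>R d (x + t *\<^sub>R (- s *\<^sub>R e))) *\<^sub>R f x))"
      by simp
    also have "\<dots> = - (LINT x|lborel. (s * (LINT t|lborel. indicator {0..1} t *\<^sub>R d (x + t *\<^sub>R (- s *\<^sub>R e)))) *\<^sub>R f x)"
    proof -
      have "integrable lborel (\<lambda>t. indicator {0..1::real} t *\<^sub>R d (x + t *\<^sub>R (- s *\<^sub>R e)))" for x
        unfolding set_integrable_def[symmetric]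
        by (intro borel_integrable_atLeastAtMost' continuous_on_subset[OF dc]) auto
      then show ?thesis
        by (simp only: integral_scaleR_left scaleR_scaleR)
    qed
    also have "\<dots> = - (LINT x|lborel. \<phi> x *\<^sub>R f x - \<phi> (x - s *\<^sub>R e) *\<^sub>R f x)"
      unfolding 2 by (simp add: scaleR_diff_left)
    also have "\<dots> = (LINT x|lborel. \<phi> (x - s *\<^sub>R e) *\<^sub>R f x) - (LINT x|lborel. \<phi> x *\<^sub>R f x)"
      using sq_integrable_scaleR_integrable(1)[OF test_function_sq_integrable[OF \<phi>] f]
        sq_integrable_scaleR_integrable(1)[OF sq_integrable_translate[OF test_function_sq_integrable[OF \<phi>], of "- (s *\<^sub>R e)"] f]
      by simp
    also have "(LINT x|lborel. \<phi> (x - s *\<^sub>R e) *\<^sub>R f x) = (LINT x|lborel. \<phi> x *\<^sub>R f (x + s *\<^sub>R e))"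
      using integral_lborel_translate(1)[of "\<lambda>x. \<phi> (x - s *\<^sub>R e) *\<^sub>R f x" "s *\<^sub>R e"] by simp
    finally show "(LINT x|lborel. \<phi> x *\<^sub>R h x) = 0"
      using hval[OF test_function_sq_integrable[OF \<phi>]] by simp
  qed
  then show ?thesis
    by (auto simp: h_def \<Gamma>_def)
qed

text \<open>Cauchy-Schwarz on each segment, then Fubini and translation invariance. The sets
  localize the estimate: \<open>B\<close> contains all segments that start in \<open>A\<close>. The
  Sobolev estimates take the whole plane, while the analysis of the Green function takes small
  squares near its singularity.\<close>

lemma nn_integral_difference_le:
  fixes f g :: "real^2 \<Rightarrow> complex" and s :: real
  assumes w: "weak_deriv i f g"
  defines "e \<equiv> axis i 1 :: real^2"
  assumes [measurable]: "A \<in> sets borel" "B \<in> sets borel"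
    and AB: "\<And>x t. x \<in> A \<Longrightarrow> 0 \<le> t \<Longrightarrow> t \<le> 1 \<Longrightarrow> x + t *\<^sub>R (s *\<^sub>R e) \<in> B"
  shows "(\<integral>\<^sup>+x. indicator A x * ennreal ((norm (f (x + s *\<^sub>R e) - f x))\<^sup>2) \<partial>lborel)
    \<le> ennreal (s\<^sup>2) * (\<integral>\<^sup>+x. indicator B x * ennreal ((norm (g x))\<^sup>2) \<partial>lborel)"
proof -
  have [measurable]: "f \<in> borel_measurable borel" "g \<in> borel_measurable borel"
    using w by (auto simp: weak_deriv_def dest: sq_integrableD)
  define G where "G t x = indicator {0..1} t * ennreal ((norm (g (x + t *\<^sub>R (s *\<^sub>R e))))\<^sup>2)" for t :: real and x
  have [measurable]: "(\<lambda>(t, x). G t x) \<in> borel_measurable (lborel \<Otimes>\<^sub>M lborel)"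
    unfolding G_def by measurable
  have [measurable]: "(\<lambda>(x, t). G t x) \<in> borel_measurable (lborel \<Otimes>\<^sub>M lborel)"
    unfolding G_def by measurable
  have pw: "ennreal ((norm (LINT t|lborel. indicator {0..1} t *\<^sub>R g (x + t *\<^sub>R (s *\<^sub>R e))))\<^sup>2) \<le> (\<integral>\<^sup>+t. G t x \<partial>lborel)" for x
  proof -
    let ?u = "\<lambda>t. indicator {0..1} t *\<^sub>R g (x + t *\<^sub>R (s *\<^sub>R e))"
    have "ennreal (norm (LINT t|lborel. ?u t)) \<le> (\<integral>\<^sup>+t. ennreal (norm (?u t)) \<partial>lborel)"
    proof (cases "integrable lborel ?u")
      case True
      then show ?thesis by (rule integral_norm_bound_ennreal)
    qed (simp add: not_integrable_integral_eq)
    \<comment> \<open>The indicator is idempotent; a second copy is inserted as the partner factor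
      for Cauchy-Schwarz, whose square integral is 1.\<close>
    also have "\<dots> = (\<integral>\<^sup>+t. indicator {0..1} t * ennreal (norm (?u t)) \<partial>lborel)"
      by (intro nn_integral_cong) (auto simp: indicator_def)
    finally have "(ennreal (norm (LINT t|lborel. ?u t)))\<^sup>2 \<le> (\<integral>\<^sup>+t. indicator {0..1} t * ennreal (norm (?u t)) \<partial>lborel)\<^sup>2"
      by (rule power_mono) simp
    also have "\<dots> \<le> (\<integral>\<^sup>+t. (indicator {0..1::real} t)\<^sup>2 \<partial>lborel) * (\<integral>\<^sup>+t. (ennreal (norm (?u t)))\<^sup>2 \<partial>lborel)"
      by (rule Cauchy_Schwarz_nn_integral) measurable
    also have "(\<integral>\<^sup>+t. (indicator {0..1::real} t)\<^sup>2 \<partial>lborel) = (\<integral>\<^sup>+t. indicator {0..1::real} t \<partial>lborel)"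
      by (intro nn_integral_cong) (auto simp: indicator_def)
    also have "\<dots> = 1" by simp
    also have "(\<integral>\<^sup>+t. (ennreal (norm (?u t)))\<^sup>2 \<partial>lborel) = (\<integral>\<^sup>+t. G t x \<partial>lborel)"
      by (intro nn_integral_cong) (auto simp: indicator_def G_def ennreal_power)
    finally show ?thesis by (simp add: ennreal_power)
  qed
  have "(\<integral>\<^sup>+x. indicator A x * ennreal ((norm (f (x + s *\<^sub>R e) - f x))\<^sup>2) \<partial>lborel)
      \<le> (\<integral>\<^sup>+x. ennreal (s\<^sup>2) * (\<integral>\<^sup>+t. indicator A x * G t x \<partial>lborel) \<partial>lborel)"
  proof (rule nn_integral_mono_AE)
    show "AE x in lborel. indicator A x * ennreal ((norm (f (x + s *\<^sub>R e) - f x))\<^sup>2)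
        \<le> ennreal (s\<^sup>2) * (\<integral>\<^sup>+t. indicator A x * G t x \<partial>lborel)"
      using AE_difference_formula[OF w, of s]
    proof eventually_elim
      case (elim x)
      have "ennreal ((norm (f (x + s *\<^sub>R e) - f x))\<^sup>2)
          = ennreal (s\<^sup>2) * ennreal ((norm (LINT t|lborel. indicator {0..1} t *\<^sub>R g (x + t *\<^sub>R (s *\<^sub>R e))))\<^sup>2)"
        using elim by (simp add: e_def power_mult_distrib flip: ennreal_mult)
      also have "\<dots> \<le> ennreal (s\<^sup>2) * (\<integral>\<^sup>+t. G t x \<partial>lborel)"
        by (intro mult_left_mono pw) simp
      finally show ?case
        by (auto simp: indicator_def)
    qed
  qed
  also have "\<dots> = ennreal (s\<^sup>2) * (\<integral>\<^sup>+x. (\<integral>\<^sup>+t. indicator A x * G t x \<partial>lborel) \<partial>lborel)"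
    by (rule nn_integral_cmult) measurable
  also have "(\<integral>\<^sup>+x. (\<integral>\<^sup>+t. indicator A x * G t x \<partial>lborel) \<partial>lborel)
      = (\<integral>\<^sup>+t. (\<integral>\<^sup>+x. indicator A x * G t x \<partial>lborel) \<partial>lborel)"
    by (rule lborel_pair.Fubini') measurable
  also have "\<dots> \<le> (\<integral>\<^sup>+t. indicator {0..1::real} t * (\<integral>\<^sup>+x. indicator B x * ennreal ((norm (g x))\<^sup>2) \<partial>lborel) \<partial>lborel)"
  proof (rule nn_integral_mono)
    fix t :: real
    have "(\<integral>\<^sup>+x. indicator A x * G t x \<partial>lborel)
        \<le> (\<integral>\<^sup>+x. indicator {0..1} t * (indicator B (x + t *\<^sub>R (s *\<^sub>R e)) * ennreal ((norm (g (x + t *\<^sub>R (s *\<^sub>R e))))\<^sup>2)) \<partial>lborel)"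
      using AB by (intro nn_integral_mono) (auto simp: G_def indicator_def)
    also have "\<dots> = indicator {0..1} t * (\<integral>\<^sup>+x. indicator B (x + t *\<^sub>R (s *\<^sub>R e)) * ennreal ((norm (g (x + t *\<^sub>R (s *\<^sub>R e))))\<^sup>2) \<partial>lborel)"
      by (rule nn_integral_cmult) measurable
    also have "(\<integral>\<^sup>+x. indicator B (x + t *\<^sub>R (s *\<^sub>R e)) * ennreal ((norm (g (x + t *\<^sub>R (s *\<^sub>R e))))\<^sup>2) \<partial>lborel)
        = (\<integral>\<^sup>+x. indicator B x * ennreal ((norm (g x))\<^sup>2) \<partial>lborel)"
      by (rule nn_integral_lborel_translate) measurable
    finally show "(\<integral>\<^sup>+x. indicator A x * G t x \<partial>lborel)
        \<le> indicator {0..1} t * (\<integral>\<^sup>+x. indicator B x * ennreal ((norm (g x))\<^sup>2) \<partial>lborel)" .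
  qed
  also have "\<dots> = (\<integral>\<^sup>+x. indicator B x * ennreal ((norm (g x))\<^sup>2) \<partial>lborel)"
    by (subst nn_integral_multc) auto
  finally show ?thesis by (simp add: mult_left_mono)
qed

subsection \<open>Averages over small squares\<close>

definition nsq :: "'a::real_normed_vector \<Rightarrow> ennreal" where
  "nsq y = ennreal ((norm y)\<^sup>2)"

lemma nsq_measurable [measurable]: "nsq \<in> borel_measurable borel"
  unfolding nsq_def[abs_def] by measurable

lemma nsq_add_le: "nsq (a + b :: 'a::real_inner) \<le> 2 * nsq a + 2 * nsq b"
proof -
  have "(norm (a + b))\<^sup>2 + (norm (a - b))\<^sup>2 = 2 * (norm a)\<^sup>2 + 2 * (norm b)\<^sup>2"
    by (simp add: power2_norm_eq_inner inner_add inner_diff inner_commute)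
  then have "(norm (a + b))\<^sup>2 \<le> 2 * (norm a)\<^sup>2 + 2 * (norm b)\<^sup>2"
    by (smt (verit) zero_le_power2)
  then have "nsq (a + b) \<le> ennreal (2 * (norm a)\<^sup>2 + 2 * (norm b)\<^sup>2)"
    unfolding nsq_def by (rule ennreal_leI)
  also have "\<dots> = 2 * nsq a + 2 * nsq b"
    by (simp add: nsq_def ennreal_plus ennreal_mult)
  finally show ?thesis .
qed

definition square :: "real \<Rightarrow> (real^2) set" where
  "square h = cbox 0 (\<chi> i. h)"

lemma square_measurable [measurable]: "square h \<in> sets borel"
  by (simp add: square_def)

lemma emeasure_square:
  assumes "h \<ge> 0"
  shows "emeasure lborel (square h) = ennreal (h\<^sup>2)"
proof -
  have "measure lborel (square h) = h\<^sup>2"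
    using assms content_cbox_cart[of "0 :: real^2" "\<chi> i. h"]
    by (auto simp: square_def interval_eq_empty_cart not_less UNIV_2 power2_eq_square)
  moreover have "emeasure lborel (square h) \<noteq> top"
    using emeasure_bounded_finite[OF bounded_cbox, of "0 :: real^2" "\<chi> i. h"] by (auto simp: square_def)
  ultimately show ?thesis
    using emeasure_eq_ennreal_measure[of lborel "square h"] by simp
qed

definition avg :: "real \<Rightarrow> (real^2 \<Rightarrow> complex) \<Rightarrow> real^2 \<Rightarrow> ennreal" where
  "avg h f x = ennreal (1 / h\<^sup>2) * (\<integral>\<^sup>+z. indicator (square h) z * nsq (f (x + z)) \<partial>lborel)"

text \<open>The deviation is measured from the value \<open>f x\<close> itself rather than from a
  mean, so that integrating over \<open>x\<close> leaves an average of \<open>L2\<close> norms of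
  translation differences.\<close>

definition osc :: "real \<Rightarrow> (real^2 \<Rightarrow> complex) \<Rightarrow> real^2 \<Rightarrow> ennreal" where
  "osc h f x = ennreal (1 / h\<^sup>2) * (\<integral>\<^sup>+z. indicator (square h) z * nsq (f (x + z) - f x) \<partial>lborel)"

lemma osc_measurable [measurable]:
  assumes [measurable]: "f \<in> borel_measurable borel"
  shows "osc h f \<in> borel_measurable borel"
proof -
  have "(\<lambda>x. ennreal (1 / h\<^sup>2) * (\<integral>\<^sup>+z. indicator (square h) z * nsq (f (x + z) - f x) \<partial>lborel)) \<in> borel_measurable lborel"
    by measurable
  then show ?thesis by (simp add: osc_def[abs_def])
qed

text \<open>The inequality \<open>nsq_add_le\<close> for
  \<open>f x = (f x - f (x + z)) + f (x + z)\<close>, averaged over \<open>z\<close> in the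
  square.\<close>

lemma nsq_le_osc_avg:
  assumes h: "h > 0" and [measurable]: "f \<in> borel_measurable borel"
  shows "nsq (f x) \<le> 2 * osc h f x + 2 * avg h f x"
proof -
  have h2: "ennreal (1 / h\<^sup>2) * ennreal (h\<^sup>2) = 1"
    using h by (simp flip: ennreal_mult)
  have pw: "nsq (f x) \<le> 2 * nsq (f (x + z) - f x) + 2 * nsq (f (x + z))" for z
    using nsq_add_le[of "f x - f (x + z)" "f (x + z)"] by (simp add: nsq_def norm_minus_commute)
  have "nsq (f x) = ennreal (1 / h\<^sup>2) * (ennreal (h\<^sup>2) * nsq (f x))"
    by (simp add: h2 flip: mult.assoc)
  also have "ennreal (h\<^sup>2) * nsq (f x) = (\<integral>\<^sup>+z. nsq (f x) * indicator (square h) z \<partial>lborel)"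
    using h by (simp add: nn_integral_cmult_indicator emeasure_square mult.commute)
  also have "\<dots> \<le> (\<integral>\<^sup>+z. 2 * (indicator (square h) z * nsq (f (x + z) - f x))
      + 2 * (indicator (square h) z * nsq (f (x + z))) \<partial>lborel)"
    using pw by (intro nn_integral_mono) (auto simp: indicator_def)
  also have "\<dots> = 2 * (\<integral>\<^sup>+z. indicator (square h) z * nsq (f (x + z) - f x) \<partial>lborel)
      + 2 * (\<integral>\<^sup>+z. indicator (square h) z * nsq (f (x + z)) \<partial>lborel)"
    by (simp add: nn_integral_add nn_integral_cmult)
  also have "ennreal (1 / h\<^sup>2) * \<dots> = 2 * osc h f x + 2 * avg h f x"
    by (simp add: osc_def avg_def distrib_left mult_ac)
  finally show ?thesis
    by (simp add: mult_left_mono)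
qed

text \<open>The translation is split into one step along each axis, at the price of the factor 2
  from \<open>nsq_add_le\<close>.\<close>

lemma nn_integral_translate_diff_le:
  assumes w: "weak_deriv 1 f g1" "weak_deriv 2 f g2"
    and z: "\<bar>z $ 1\<bar> \<le> h" "\<bar>z $ 2\<bar> \<le> h"
  shows "(\<integral>\<^sup>+x. nsq (f (x + z) - f x) \<partial>lborel)
    \<le> ennreal (2 * h\<^sup>2) * ((\<integral>\<^sup>+x. nsq (g1 x) \<partial>lborel) + (\<integral>\<^sup>+x. nsq (g2 x) \<partial>lborel))"
proof -
  have [measurable]: "f \<in> borel_measurable borel"
    using w by (auto simp: weak_deriv_def dest: sq_integrableD)
  define z1 z2 where "z1 = (z $ 1) *\<^sub>R (axis 1 1 :: real^2)" and "z2 = (z $ 2) *\<^sub>R (axis 2 1 :: real^2)"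
  have z12: "z = z1 + z2"
    by (simp add: z1_def z2_def vec_eq_iff forall_2 axis_def)
  have b1: "(\<integral>\<^sup>+x. nsq (f (x + z1) - f x) \<partial>lborel) \<le> ennreal (h\<^sup>2) * (\<integral>\<^sup>+x. nsq (g1 x) \<partial>lborel)"
  proof -
    have "(\<integral>\<^sup>+x. nsq (f (x + z1) - f x) \<partial>lborel) \<le> ennreal ((z $ 1)\<^sup>2) * (\<integral>\<^sup>+x. nsq (g1 x) \<partial>lborel)"
      using nn_integral_difference_le[OF w(1), of UNIV UNIV "z $ 1"] by (simp add: nsq_def z1_def)
    also have "\<dots> \<le> ennreal (h\<^sup>2) * (\<integral>\<^sup>+x. nsq (g1 x) \<partial>lborel)"
      using z(1) by (intro mult_right_mono ennreal_leI) (auto simp: abs_le_square_iff[symmetric])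
    finally show ?thesis .
  qed
  have b2: "(\<integral>\<^sup>+x. nsq (f (x + z2) - f x) \<partial>lborel) \<le> ennreal (h\<^sup>2) * (\<integral>\<^sup>+x. nsq (g2 x) \<partial>lborel)"
  proof -
    have "(\<integral>\<^sup>+x. nsq (f (x + z2) - f x) \<partial>lborel) \<le> ennreal ((z $ 2)\<^sup>2) * (\<integral>\<^sup>+x. nsq (g2 x) \<partial>lborel)"
      using nn_integral_difference_le[OF w(2), of UNIV UNIV "z $ 2"] by (simp add: nsq_def z2_def)
    also have "\<dots> \<le> ennreal (h\<^sup>2) * (\<integral>\<^sup>+x. nsq (g2 x) \<partial>lborel)"
      using z(2) by (intro mult_right_mono ennreal_leI) (auto simp: abs_le_square_iff[symmetric])
    finally show ?thesis .
  qed
  have "(\<integral>\<^sup>+x. nsq (f (x + z) - f x) \<partial>lborel)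
      \<le> (\<integral>\<^sup>+x. 2 * nsq (f (x + z1 + z2) - f (x + z1)) + 2 * nsq (f (x + z1) - f x) \<partial>lborel)"
  proof (rule nn_integral_mono)
    fix x
    show "nsq (f (x + z) - f x) \<le> 2 * nsq (f (x + z1 + z2) - f (x + z1)) + 2 * nsq (f (x + z1) - f x)"
      using nsq_add_le[of "f (x + z1 + z2) - f (x + z1)" "f (x + z1) - f x"] by (simp add: z12 add.assoc)
  qed
  also have "\<dots> = 2 * (\<integral>\<^sup>+x. nsq (f (x + z1 + z2) - f (x + z1)) \<partial>lborel) + 2 * (\<integral>\<^sup>+x. nsq (f (x + z1) - f x) \<partial>lborel)"
    by (simp add: nn_integral_add nn_integral_cmult)
  also have "(\<integral>\<^sup>+x. nsq (f (x + z1 + z2) - f (x + z1)) \<partial>lborel) = (\<integral>\<^sup>+x. nsq (f (x + z2) - f x) \<partial>lborel)"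
    by (rule nn_integral_lborel_translate) measurable
  also have "2 * (\<integral>\<^sup>+x. nsq (f (x + z2) - f x) \<partial>lborel) + 2 * (\<integral>\<^sup>+x. nsq (f (x + z1) - f x) \<partial>lborel)
      \<le> 2 * (ennreal (h\<^sup>2) * (\<integral>\<^sup>+x. nsq (g2 x) \<partial>lborel)) + 2 * (ennreal (h\<^sup>2) * (\<integral>\<^sup>+x. nsq (g1 x) \<partial>lborel))"
    by (intro add_mono mult_left_mono b1 b2) auto
  also have "\<dots> = ennreal (2 * h\<^sup>2) * ((\<integral>\<^sup>+x. nsq (g1 x) \<partial>lborel) + (\<integral>\<^sup>+x. nsq (g2 x) \<partial>lborel))"
    by (simp add: ennreal_mult distrib_left mult_ac add_ac)
  finally show ?thesis .
qed

text \<open>The closed unit ball of the standard Sobolev norm. Working in the ball makes the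
  constants of the following inhomogeneous estimates uniform.\<close>

definition unit_sobolev :: "(real^2 \<Rightarrow> complex) \<Rightarrow> bool" where
  "unit_sobolev f \<longleftrightarrow> (\<exists>g1 g2. weak_deriv 1 f g1 \<and> weak_deriv 2 f g2 \<and>
     (\<integral>\<^sup>+x. nsq (f x) \<partial>lborel) + (\<integral>\<^sup>+x. nsq (g1 x) \<partial>lborel) + (\<integral>\<^sup>+x. nsq (g2 x) \<partial>lborel) \<le> 1)"

lemma unit_sobolevD:
  assumes "unit_sobolev f"
  shows "sq_integrable f" "f \<in> borel_measurable borel" "(\<integral>\<^sup>+x. nsq (f x) \<partial>lborel) \<le> 1"
  using assms add_increasing2[of "_ :: ennreal"]
  by (auto simp: unit_sobolev_def weak_deriv_def add.assoc dest: sq_integrableD intro: order_trans[OF add_increasing2, OF zero_le order_refl])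

text \<open>After exchanging the integrals every \<open>z\<close> in the square contributes at most
  \<open>2 * h\<^sup>2\<close>, and the area cancels the normalization of the average.\<close>

lemma nn_integral_osc_le:
  assumes f: "unit_sobolev f" and h: "h > 0"
  shows "(\<integral>\<^sup>+x. osc h f x \<partial>lborel) \<le> ennreal (2 * h\<^sup>2)"
proof -
  have [measurable]: "f \<in> borel_measurable borel"
    using f by (rule unit_sobolevD)
  obtain g1 g2 where g: "weak_deriv 1 f g1" "weak_deriv 2 f g2"
    and le: "(\<integral>\<^sup>+x. nsq (f x) \<partial>lborel) + (\<integral>\<^sup>+x. nsq (g1 x) \<partial>lborel) + (\<integral>\<^sup>+x. nsq (g2 x) \<partial>lborel) \<le> 1"
    using f by (auto simp: unit_sobolev_def)
  have D: "(\<integral>\<^sup>+x. nsq (g1 x) \<partial>lborel) + (\<integral>\<^sup>+x. nsq (g2 x) \<partial>lborel) \<le> 1"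
    using le by (rule order_trans[rotated]) (simp add: add.assoc add_increasing)
  have "(\<integral>\<^sup>+x. osc h f x \<partial>lborel)
      = ennreal (1 / h\<^sup>2) * (\<integral>\<^sup>+x. \<integral>\<^sup>+z. indicator (square h) z * nsq (f (x + z) - f x) \<partial>lborel \<partial>lborel)"
    unfolding osc_def by (rule nn_integral_cmult) measurable
  also have "(\<integral>\<^sup>+x. \<integral>\<^sup>+z. indicator (square h) z * nsq (f (x + z) - f x) \<partial>lborel \<partial>lborel)
      = (\<integral>\<^sup>+z. \<integral>\<^sup>+x. indicator (square h) z * nsq (f (x + z) - f x) \<partial>lborel \<partial>lborel)"
    by (rule lborel_pair.Fubini') measurable
  also have "\<dots> \<le> (\<integral>\<^sup>+z. ennreal (2 * h\<^sup>2) * indicator (square h) z \<partial>lborel)"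
  proof (rule nn_integral_mono)
    fix z :: "real^2"
    show "(\<integral>\<^sup>+x. indicator (square h) z * nsq (f (x + z) - f x) \<partial>lborel) \<le> ennreal (2 * h\<^sup>2) * indicator (square h) z"
    proof (cases "z \<in> square h")
      case True
      then have "\<bar>z $ 1\<bar> \<le> h" "\<bar>z $ 2\<bar> \<le> h"
        by (auto simp: square_def mem_box_cart forall_2)
      from nn_integral_translate_diff_le[OF g this]
      have "(\<integral>\<^sup>+x. nsq (f (x + z) - f x) \<partial>lborel) \<le> ennreal (2 * h\<^sup>2) * 1"
        by (rule order_trans) (intro mult_left_mono D zero_le)
      then show ?thesis using True by simp
    qed simp
  qed
  also have "\<dots> = ennreal (2 * h\<^sup>2) * ennreal (h\<^sup>2)"
    using h by (simp add: nn_integral_cmult_indicator emeasure_square)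
  also have "ennreal (1 / h\<^sup>2) * (ennreal (2 * h\<^sup>2) * ennreal (h\<^sup>2)) = ennreal (2 * h\<^sup>2)"
    using h by (simp flip: ennreal_mult)
  finally show ?thesis by (simp add: mult_left_mono)
qed

subsection \<open>Sobolev embedding\<close>

text \<open>Where \<open>f\<close> is large compared with its quadratic mean over a small square,
  it is controlled by its oscillation over that square, whose integral is of order \<open>h\<^sup>2\<close>.\<close>
lemma nsq_le_4_osc:
  assumes h: "h > 0" and f: "f \<in> borel_measurable borel"
    and a: "avg h f x \<le> ennreal b" "b \<ge> 0" and large: "4 * b < (norm (f x))\<^sup>2"
  shows "nsq (f x) \<le> 4 * osc h f x"
proof (cases "osc h f x")
  case (real v)
  have "nsq (f x) \<le> 2 * osc h f x + 2 * avg h f x"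
    by (rule nsq_le_osc_avg[OF h f])
  also have "\<dots> \<le> 2 * ennreal v + 2 * ennreal b"
    unfolding real(2) by (intro add_left_mono mult_left_mono a) auto
  also have "\<dots> = ennreal (2 * v + 2 * b)"
    using real(1) a(2) by (simp add: ennreal_plus ennreal_mult)
  finally have "(norm (f x))\<^sup>2 \<le> 2 * v + 2 * b"
    unfolding nsq_def by (subst (asm) ennreal_le_iff) (use real(1) a(2) in auto)
  then have "(norm (f x))\<^sup>2 \<le> 4 * v"
    using large by linarith
  then have "nsq (f x) \<le> ennreal (4 * v)"
    unfolding nsq_def by (rule ennreal_leI)
  then show ?thesis
    using real by (simp add: ennreal_mult)
qed (simp add: ennreal_mult_top)

text \<open>The side \<open>2\<^sup>-\<^sup>r\<^sup>k\<close> belongs to the level \<open>4\<^sup>k\<close> of \<open>f\<close>; with this choice the series over the levels in the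
  bootstrap from exponent \<open>r\<close> to \<open>r + 1\<close> is geometric.\<close>
lemma sobolev_avg_bound:
  fixes r k :: nat and C :: real
  assumes [measurable]: "f \<in> borel_measurable borel" and r: "r \<ge> 2"
    and C: "(\<integral>\<^sup>+x. ennreal (norm (f x) ^ r) \<partial>lborel) \<le> ennreal C" "C \<ge> 1"
  shows "avg (1 / 2 ^ (r * k)) f x \<le> ennreal ((1 + C) * 16 ^ k)"
proof -
  define s :: real where "s = 4 ^ k"
  define h :: real where "h = 1 / 2 ^ (r * k)"
  have s: "s > 0" and h: "h > 0" by (auto simp: s_def h_def)
  have hs: "1 / h\<^sup>2 = s ^ r"
  proof -
    have "1 / h\<^sup>2 = ((2::real) ^ (r * k)) ^ 2"
      by (simp add: h_def power_divide)
    also have "\<dots> = (2 ^ 2) ^ (k * r)"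
      by (simp only: power_mult[symmetric] mult.commute mult.left_commute)
    also have "\<dots> = s ^ r"
      by (simp add: s_def power_mult)
    finally show ?thesis .
  qed
  have sr: "s ^ r = s ^ (r - 2) * s\<^sup>2"
    using r by (metis power_add le_add_diff_inverse2)
  \<comment> \<open>Values below the level \<open>s\<close> contribute at most
    \<open>s\<^sup>2\<close>; larger ones are paid for by the \<open>r\<close>-th power. With
    \<open>1 / h\<^sup>2 = s ^ r\<close> both contributions to the average are of order
    \<open>s\<^sup>2 = 16 ^ k\<close>.\<close>
  have pw: "a\<^sup>2 \<le> s\<^sup>2 + a ^ r / s ^ (r - 2)" if "a \<ge> 0" for a
  proof (cases "a \<le> s")
    case True
    then have "a\<^sup>2 \<le> s\<^sup>2" using that by (intro power_mono)
    moreover have "0 \<le> a ^ r / s ^ (r - 2)" using that s by simp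
    ultimately show ?thesis by linarith
  next
    case False
    have "a\<^sup>2 * s ^ (r - 2) \<le> a\<^sup>2 * a ^ (r - 2)"
      using False s by (intro mult_left_mono power_mono) auto
    also have "\<dots> = a ^ r" using r by (metis power_add le_add_diff_inverse)
    finally have "a\<^sup>2 \<le> a ^ r / s ^ (r - 2)" using s by (simp add: field_simps)
    then show ?thesis by (smt (verit) zero_le_power2)
  qed
  have "(\<integral>\<^sup>+z. indicator (square h) z * nsq (f (x + z)) \<partial>lborel)
      \<le> (\<integral>\<^sup>+z. ennreal (s\<^sup>2) * indicator (square h) z + ennreal (1 / s ^ (r - 2)) * ennreal (norm (f (x + z)) ^ r) \<partial>lborel)"
  proof (rule nn_integral_mono)
    fix z
    have "nsq (f (x + z)) \<le> ennreal (s\<^sup>2 + (1 / s ^ (r - 2)) * norm (f (x + z)) ^ r)"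
      unfolding nsq_def using pw[of "norm (f (x + z))"] by (intro ennreal_leI) simp
    also have "\<dots> = ennreal (s\<^sup>2) + ennreal (1 / s ^ (r - 2)) * ennreal (norm (f (x + z)) ^ r)"
      using s by (simp add: ennreal_plus flip: ennreal_mult)
    finally show "indicator (square h) z * nsq (f (x + z))
        \<le> ennreal (s\<^sup>2) * indicator (square h) z + ennreal (1 / s ^ (r - 2)) * ennreal (norm (f (x + z)) ^ r)"
      by (auto simp: indicator_def)
  qed
  also have "\<dots> = ennreal (s\<^sup>2) * ennreal (h\<^sup>2) + ennreal (1 / s ^ (r - 2)) * (\<integral>\<^sup>+z. ennreal (norm (f (x + z)) ^ r) \<partial>lborel)"
    using h by (simp add: nn_integral_add nn_integral_cmult nn_integral_cmult_indicator emeasure_square)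
  also have "(\<integral>\<^sup>+z. ennreal (norm (f (x + z)) ^ r) \<partial>lborel) = (\<integral>\<^sup>+z. ennreal (norm (f z) ^ r) \<partial>lborel)"
    using nn_integral_lborel_translate[of "\<lambda>z. ennreal (norm (f z) ^ r)" x] by (simp add: add.commute)
  also have "ennreal (s\<^sup>2) * ennreal (h\<^sup>2) + ennreal (1 / s ^ (r - 2)) * (\<integral>\<^sup>+z. ennreal (norm (f z) ^ r) \<partial>lborel)
      \<le> ennreal (s\<^sup>2) * ennreal (h\<^sup>2) + ennreal (1 / s ^ (r - 2)) * ennreal C"
    by (intro add_left_mono mult_left_mono C) auto
  also have "\<dots> = ennreal (s\<^sup>2 * h\<^sup>2 + C / s ^ (r - 2))"
    using s h C(2) by (simp add: ennreal_plus flip: ennreal_mult)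
  finally have "avg h f x \<le> ennreal (1 / h\<^sup>2) * ennreal (s\<^sup>2 * h\<^sup>2 + C / s ^ (r - 2))"
    unfolding avg_def by (rule mult_left_mono) simp
  also have "\<dots> = ennreal ((1 / h\<^sup>2) * (s\<^sup>2 * h\<^sup>2 + C / s ^ (r - 2)))"
    using s h C(2) by (intro ennreal_mult[symmetric]) auto
  also have "(1 / h\<^sup>2) * (s\<^sup>2 * h\<^sup>2 + C / s ^ (r - 2)) = s\<^sup>2 + (1 / h\<^sup>2) * (C / s ^ (r - 2))"
    using h by (simp add: field_simps)
  also have "\<dots> = (1 + C) * s\<^sup>2"
    unfolding hs sr using s by (simp add: field_simps)
  also have "s\<^sup>2 = 16 ^ k"
    by (simp add: s_def power2_eq_square flip: power_mult_distrib)
  finally show ?thesis by (simp add: h_def)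
qed

text \<open>Where \<open>(norm (f x))\<^sup>2\<close> is at most \<open>4 * (1 + C)\<close>, the
  additional power is bounded by a constant. Elsewhere let \<open>k\<close> be the last exceeded
  level \<open>4 * (1 + C) * 16 ^ k\<close>: the average over the square of side \<open>h k\<close>
  is small compared with \<open>nsq (f x)\<close>, so two of the \<open>r + 1\<close> powers are
  absorbed by the oscillation and the other \<open>r - 1\<close> are bounded by the next level,
  which gives \<open>c k\<close>. After integration the \<open>k\<close>-th term is a constant times
  \<open>4 ^ ((r - 1) * k) / 4 ^ (r * k)\<close>, that is \<open>(1 / 4) ^ k\<close>.\<close>

lemma sobolev_step:
  fixes r :: nat and C :: real
  assumes f: "unit_sobolev f" and r: "r \<ge> 2"
    and C: "(\<integral>\<^sup>+x. ennreal (norm (f x) ^ r) \<partial>lborel) \<le> ennreal C" "C \<ge> 1"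
  shows "(\<integral>\<^sup>+x. ennreal (norm (f x) ^ Suc r) \<partial>lborel)
    \<le> ennreal ((1 + 4 * (1 + C)) * C + 8 * (8 * (1 + C)) ^ (r - 1) * (4 / 3))"
proof -
  have fm [measurable]: "f \<in> borel_measurable borel"
    using f by (rule unit_sobolevD)
  \<comment> \<open>The next level \<open>4 * (1 + C) * 16 ^ Suc k\<close> equals
    \<open>64 * (1 + C) * 16 ^ k\<close>, and \<open>1 + C \<ge> 1\<close> bounds this by the square
    of \<open>K * 4 ^ k\<close>.\<close>
  define K where "K = 8 * (1 + C)"
  have K: "K > 0" using C(2) by (simp add: K_def)
  define h :: "nat \<Rightarrow> real" where "h k = 1 / 2 ^ (r * k)" for k
  have h: "h k > 0" for k by (simp add: h_def)
  define c where "c k = 4 * (K * 4 ^ k) ^ (r - 1)" for k :: nat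
  have c: "c k \<ge> 0" for k using K by (simp add: c_def)
  have pw: "ennreal (norm (f x) ^ Suc r)
      \<le> ennreal (1 + 4 * (1 + C)) * ennreal (norm (f x) ^ r) + (\<Sum>k. ennreal (c k) * osc (h k) f x)" for x
  proof (cases "(norm (f x))\<^sup>2 \<le> 4 * (1 + C)")
    case True
    have "2 * norm (f x) \<le> 1 + (norm (f x))\<^sup>2"
      using sum_squares_bound[of 1 "norm (f x)"] by simp
    then have "norm (f x) \<le> 1 + 4 * (1 + C)"
      using True norm_ge_zero[of "f x"] by linarith
    then have "norm (f x) ^ Suc r \<le> (1 + 4 * (1 + C)) * norm (f x) ^ r"
      by (auto intro: mult_right_mono)
    then have "ennreal (norm (f x) ^ Suc r) \<le> ennreal ((1 + 4 * (1 + C)) * norm (f x) ^ r)"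
      by (rule ennreal_leI)
    also have "\<dots> = ennreal (1 + 4 * (1 + C)) * ennreal (norm (f x) ^ r)"
      by (rule ennreal_mult) (use C(2) in auto)
    finally have "ennreal (norm (f x) ^ Suc r) \<le> ennreal (1 + 4 * (1 + C)) * ennreal (norm (f x) ^ r)" .
    then show ?thesis by (rule order_trans) simp
  next
    case False
    \<comment> \<open>The least \<open>n\<close> with \<open>P n\<close> is a successor
      \<open>Suc k\<close>, which squeezes the value between two consecutive levels.\<close>
    define P where "P n \<longleftrightarrow> (norm (f x))\<^sup>2 \<le> 4 * (1 + C) * 16 ^ n" for n :: nat
    have "\<exists>n. P n"
    proof -
      obtain n where "(norm (f x))\<^sup>2 < 16 ^ n"
        using real_arch_pow[of 16] by auto
      moreover have "(16::real) ^ n \<le> 4 * (1 + C) * 16 ^ n" using C(2) by simp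
      ultimately show ?thesis unfolding P_def by (intro exI[of _ n]) linarith
    qed
    then have "P (LEAST n. P n)" by (rule LeastI_ex)
    moreover have "\<not> P 0" using False by (simp add: P_def)
    ultimately obtain k where k: "(LEAST n. P n) = Suc k"
      by (cases "LEAST n. P n") auto
    have up: "P (Suc k)" using \<open>P (LEAST n. P n)\<close> k by simp
    have lo: "\<not> P k" using not_less_Least[of k P] k by simp
    have osc: "nsq (f x) \<le> 4 * osc (h k) f x"
    proof (rule nsq_le_4_osc[OF h fm])
      show "avg (h k) f x \<le> ennreal ((1 + C) * 16 ^ k)"
        unfolding h_def by (rule sobolev_avg_bound[OF fm r C])
      show "4 * ((1 + C) * 16 ^ k) < (norm (f x))\<^sup>2"
        using lo by (simp only: P_def not_le mult.assoc)
      show "0 \<le> (1 + C) * 16 ^ k" using C(2) by simp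
    qed
    have "(norm (f x))\<^sup>2 \<le> (K * 4 ^ k)\<^sup>2"
    proof -
      have "(norm (f x))\<^sup>2 \<le> 64 * (1 + C) * 16 ^ k"
        using up by (simp add: P_def algebra_simps)
      also have "\<dots> \<le> 64 * (1 + C)\<^sup>2 * 16 ^ k"
        using C(2) self_le_power[of "1 + C" 2] by (intro mult_right_mono mult_left_mono) auto
      also have "\<dots> = (K * 4 ^ k)\<^sup>2"
      proof -
        have "((4::real) ^ k)\<^sup>2 = 16 ^ k" by (simp add: power2_eq_square flip: power_mult_distrib)
        then show ?thesis by (simp add: K_def power_mult_distrib) (simp add: power2_eq_square algebra_simps)
      qed
      finally show ?thesis .
    qed
    then have "norm (f x) \<le> K * 4 ^ k"
      by (rule power2_le_imp_le) (use K in simp)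
    then have "norm (f x) ^ (r - 1) \<le> (K * 4 ^ k) ^ (r - 1)"
      by (intro power_mono) auto
    then have "norm (f x) ^ (r - 1) * (norm (f x))\<^sup>2 \<le> (K * 4 ^ k) ^ (r - 1) * (norm (f x))\<^sup>2"
      by (rule mult_right_mono) simp
    moreover have "norm (f x) ^ (r - 1) * (norm (f x))\<^sup>2 = norm (f x) ^ Suc r"
      using r by (simp flip: power_add)
    ultimately have "ennreal (norm (f x) ^ Suc r) \<le> ennreal ((K * 4 ^ k) ^ (r - 1)) * nsq (f x)"
      using K by (simp add: nsq_def ennreal_leI flip: ennreal_mult)
    also have "\<dots> \<le> ennreal ((K * 4 ^ k) ^ (r - 1)) * (4 * osc (h k) f x)"
      by (rule mult_left_mono[OF osc]) simp
    also have "\<dots> = ennreal (c k) * osc (h k) f x"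
      using K by (simp add: c_def ennreal_mult mult_ac)
    also have "\<dots> \<le> (\<Sum>k. ennreal (c k) * osc (h k) f x)"
      using sum_le_suminf[of "\<lambda>k. ennreal (c k) * osc (h k) f x" "{k}"] by simp
    finally show ?thesis
      by (rule order_trans) simp
  qed
  have "(\<integral>\<^sup>+x. ennreal (norm (f x) ^ Suc r) \<partial>lborel)
      \<le> (\<integral>\<^sup>+x. ennreal (1 + 4 * (1 + C)) * ennreal (norm (f x) ^ r) + (\<Sum>k. ennreal (c k) * osc (h k) f x) \<partial>lborel)"
    by (rule nn_integral_mono) (rule pw)
  also have "\<dots> = ennreal (1 + 4 * (1 + C)) * (\<integral>\<^sup>+x. ennreal (norm (f x) ^ r) \<partial>lborel)
      + (\<Sum>k. ennreal (c k) * (\<integral>\<^sup>+x. osc (h k) f x \<partial>lborel))"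
    by (simp add: nn_integral_add nn_integral_cmult nn_integral_suminf)
  also have "\<dots> \<le> ennreal (1 + 4 * (1 + C)) * ennreal C + (\<Sum>k. ennreal (8 * K ^ (r - 1) * (1 / 4) ^ k))"
  proof (intro add_mono mult_left_mono C suminf_le)
    fix k
    have "ennreal (c k) * (\<integral>\<^sup>+x. osc (h k) f x \<partial>lborel) \<le> ennreal (c k) * ennreal (2 * (h k)\<^sup>2)"
      by (intro mult_left_mono nn_integral_osc_le f h) simp
    also have "\<dots> = ennreal (c k * (2 * (h k)\<^sup>2))"
      using c by (simp add: ennreal_mult)
    also have "c k * (2 * (h k)\<^sup>2) = 8 * K ^ (r - 1) * (1 / 4) ^ k"
    proof -
      have "(h k)\<^sup>2 = 1 / 4 ^ (r * k)"
        by (simp add: h_def power_divide power2_eq_square flip: power_mult_distrib)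
      also have "r * k = (r - 1) * k + k"
        using r by (cases r) auto
      finally have "(h k)\<^sup>2 = 1 / (4 ^ ((r - 1) * k) * 4 ^ k)"
        by (simp add: power_add)
      moreover have "((4::real) ^ k) ^ (r - 1) = 4 ^ ((r - 1) * k)"
        by (simp add: mult.commute flip: power_mult)
      ultimately show ?thesis
        by (simp add: c_def power_mult_distrib field_simps)
    qed
    finally show "ennreal (c k) * (\<integral>\<^sup>+x. osc (h k) f x \<partial>lborel) \<le> ennreal (8 * K ^ (r - 1) * (1 / 4) ^ k)" .
  qed auto
  also have "(\<Sum>k. ennreal (8 * K ^ (r - 1) * (1 / 4) ^ k)) = ennreal (8 * K ^ (r - 1) * (4 / 3))"
  proof (rule suminf_ennreal_eq)
    show "0 \<le> 8 * K ^ (r - 1) * (1 / 4) ^ k" for k using K by simp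
    have "(\<lambda>k. (1 / 4 :: real) ^ k) sums (4 / 3)"
      using geometric_sums[of "1 / 4 :: real"] by simp
    then show "(\<lambda>k. 8 * K ^ (r - 1) * (1 / 4) ^ k) sums (8 * K ^ (r - 1) * (4 / 3))"
      by (rule sums_mult)
  qed
  also have "ennreal (1 + 4 * (1 + C)) * ennreal C + ennreal (8 * K ^ (r - 1) * (4 / 3))
      = ennreal ((1 + 4 * (1 + C)) * C + 8 * K ^ (r - 1) * (4 / 3))"
    using C(2) K by (simp add: ennreal_plus ennreal_mult)
  finally show ?thesis by (simp add: K_def)
qed

lemma sobolev_power:
  fixes r :: nat
  assumes "r \<ge> 2"
  shows "\<exists>C\<ge>1. \<forall>f. unit_sobolev f \<longrightarrow> (\<integral>\<^sup>+x. ennreal (norm (f x) ^ r) \<partial>lborel) \<le> ennreal C"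
  using assms
proof (induction r rule: dec_induct)
  case base
  show ?case
    by (rule exI[of _ 1]) (use unit_sobolevD(3) in \<open>auto simp: nsq_def\<close>)
next
  case (step r)
  then obtain C where C: "C \<ge> 1"
    "\<And>f. unit_sobolev f \<Longrightarrow> (\<integral>\<^sup>+x. ennreal (norm (f x) ^ r) \<partial>lborel) \<le> ennreal C"
    by blast
  define C' where "C' = (1 + 4 * (1 + C)) * C + 8 * (8 * (1 + C)) ^ (r - 1) * (4 / 3)"
  have "1 * 1 \<le> (1 + 4 * (1 + C)) * C" using C(1) by (intro mult_mono) auto
  moreover have "0 \<le> 8 * (8 * (1 + C)) ^ (r - 1) * (4 / 3)" using C(1) by simp
  ultimately have "C' \<ge> 1" unfolding C'_def by linarith
  then show ?case
    using sobolev_step[OF _ step.hyps(1) C(2) C(1)] unfolding C'_def by blast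
qed

text \<open>A real exponent lies between 2 and an integer \<open>n\<close>, so
  \<open>a powr q \<le> a\<^sup>2 + a ^ n\<close> reduces the claim to integer powers.\<close>

theorem sobolev_embedding:
  fixes q :: real
  assumes q: "q \<ge> 2"
  obtains C where "C \<ge> 1"
    "\<And>f. unit_sobolev f \<Longrightarrow> (\<integral>\<^sup>+x. ennreal (norm (f x) powr q) \<partial>lborel) \<le> ennreal C"
proof -
  define n where "n = nat \<lceil>q\<rceil>"
  have n: "real n \<ge> q" "n \<ge> 2" using q by (auto simp: n_def le_nat_iff)
  obtain C where C: "C \<ge> 1"
    "\<And>f. unit_sobolev f \<Longrightarrow> (\<integral>\<^sup>+x. ennreal (norm (f x) ^ n) \<partial>lborel) \<le> ennreal C"
    using sobolev_power[OF n(2)] by blast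
  have pw: "a powr q \<le> a\<^sup>2 + a ^ n" if "a \<ge> 0" for a :: real
  proof (cases "a = 0")
    case False
    then have a: "a > 0" using that by simp
    show ?thesis
    proof (cases "a \<le> 1")
      case True
      have "a powr q \<le> a powr 2" using a True q by (intro powr_mono') auto
      then show ?thesis using a by (simp add: powr_numeral add_increasing2)
    next
      case False
      have "a powr q \<le> a powr real n" using False n by (intro powr_mono) auto
      then show ?thesis using a by (simp add: powr_realpow add_increasing)
    qed
  qed simp
  show thesis
  proof (rule that[of "1 + C"])
    show "1 \<le> 1 + C" using C(1) by simp
    fix f assume f: "unit_sobolev f"
    have [measurable]: "f \<in> borel_measurable borel" using f by (rule unit_sobolevD)
    have "(\<integral>\<^sup>+x. ennreal (norm (f x) powr q) \<partial>lborel) \<le> (\<integral>\<^sup>+x. nsq (f x) + ennreal (norm (f x) ^ n) \<partial>lborel)"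
      using pw[of "norm (f _)"] by (intro nn_integral_mono) (simp add: nsq_def ennreal_leI flip: ennreal_plus)
    also have "\<dots> = (\<integral>\<^sup>+x. nsq (f x) \<partial>lborel) + (\<integral>\<^sup>+x. ennreal (norm (f x) ^ n) \<partial>lborel)"
      by (rule nn_integral_add) measurable
    also have "\<dots> \<le> ennreal 1 + ennreal C"
      by (intro add_mono C(2) f) (use unit_sobolevD(3)[OF f] in simp)
    also have "\<dots> = ennreal (1 + C)" using C(1) by (simp add: ennreal_plus)
    finally show "(\<integral>\<^sup>+x. ennreal (norm (f x) powr q) \<partial>lborel) \<le> ennreal (1 + C)" .
  qed
qed

subsection \<open>Vanishing and local compactness\<close>

lemma avg_le_unit_avg:
  assumes "0 < h" "h \<le> 1"
  shows "avg h f x \<le> ennreal (1 / h\<^sup>2) * avg 1 f x"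
proof -
  have "square h \<subseteq> square 1"
    using assms by (auto simp: square_def mem_box_cart) (metis order_trans)
  then show ?thesis
    unfolding avg_def by (auto intro!: mult_left_mono nn_integral_mono mult_right_mono simp: indicator_def)
qed

text \<open>If no unit square carries much of the \<open>L\<^sup>2\<close> mass then \<open>f\<close> is, up to a small \<open>L\<^sup>2\<close> error,
  uniformly small, hence small in \<open>L\<^sup>q\<close>.\<close>
theorem vanishing:
  fixes q \<delta> :: real
  assumes q: "q > 2" and \<delta>: "\<delta> > 0"
  obtains \<mu> where "\<mu> > 0"
    "\<And>f. unit_sobolev f \<Longrightarrow> (\<And>x. avg 1 f x \<le> ennreal \<mu>) \<Longrightarrow>
      (\<integral>\<^sup>+x. ennreal (norm (f x) powr q) \<partial>lborel) \<le> ennreal \<delta>"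
proof -
  obtain C where C: "C \<ge> 1"
    "\<And>f. unit_sobolev f \<Longrightarrow> (\<integral>\<^sup>+x. ennreal (norm (f x) powr (2 * q - 2)) \<partial>lborel) \<le> ennreal C"
    using sobolev_embedding[of "2 * q - 2"] q by auto
  \<comment> \<open>The constants are chosen backwards from the final three-term estimate:
    \<open>\<tau>\<close>, \<open>\<eta>\<close> and \<open>h\<close> each bring one term to at most
    \<open>\<delta> / 3\<close>, and \<open>\<mu>\<close> forces averages over squares of side
    \<open>h\<close> below \<open>\<tau> / 4\<close>, the level at which \<open>nsq_le_4_osc\<close>
    starts to apply where \<open>(norm (f x))\<^sup>2 > \<tau>\<close>.\<close>
  define \<eta> where "\<eta> = \<delta> / (3 * C)"
  have \<eta>: "\<eta> > 0" using C(1) \<delta> by (simp add: \<eta>_def)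
  define h where "h = min 1 (sqrt (\<delta> * \<eta> / 24))"
  have h: "0 < h" "h \<le> 1" using \<delta> \<eta> by (auto simp: h_def)
  have "h\<^sup>2 \<le> (sqrt (\<delta> * \<eta> / 24))\<^sup>2" using h by (intro power_mono) (auto simp: h_def)
  then have h2: "8 * h\<^sup>2 / \<eta> \<le> \<delta> / 3" using \<delta> \<eta> by (simp add: field_simps)
  define \<tau> where "\<tau> = (\<delta> / 3) powr (2 / (q - 2))"
  have \<tau>: "\<tau> > 0" using \<delta> by (simp add: \<tau>_def)
  have \<tau>q: "\<tau> powr ((q - 2) / 2) = \<delta> / 3" 
  proof -
    have "2 / (q - 2) * ((q - 2) / 2) = 1" using q by simp
    then show ?thesis using \<delta> by (simp only: \<tau>_def powr_powr) simp
  qed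
  define \<mu> where "\<mu> = \<tau> * h\<^sup>2 / 4"
  have \<mu>: "\<mu> > 0" using \<tau> h by (simp add: \<mu>_def)
  show thesis
  proof (rule that[OF \<mu>])
    fix f assume f: "unit_sobolev f" and a: "\<And>x. avg 1 f x \<le> ennreal \<mu>"
    have fm [measurable]: "f \<in> borel_measurable borel" using f by (rule unit_sobolevD)
    have ah: "avg h f x \<le> ennreal (\<tau> / 4)" for x
    proof -
      have "avg h f x \<le> ennreal (1 / h\<^sup>2) * avg 1 f x"
        by (rule avg_le_unit_avg[OF h])
      also have "\<dots> \<le> ennreal (1 / h\<^sup>2) * ennreal \<mu>"
        by (intro mult_left_mono a) simp
      also have "\<dots> = ennreal (\<tau> / 4)"
        using h \<mu> by (simp add: \<mu>_def flip: ennreal_mult)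
      finally show ?thesis .
    qed
    have pw: "ennreal (norm (f x) powr q) \<le> ennreal (\<delta> / 3) * nsq (f x)
        + (ennreal \<eta> * ennreal (norm (f x) powr (2 * q - 2)) + ennreal (4 / \<eta>) * osc h f x)" for x
    proof (cases "(norm (f x))\<^sup>2 \<le> \<tau>")
      case True
      have "norm (f x) powr q \<le> (\<delta> / 3) * (norm (f x))\<^sup>2"
      proof (cases "f x = 0")
        case False
        have "norm (f x) powr q = ((norm (f x))\<^sup>2) powr ((q - 2) / 2) * (norm (f x))\<^sup>2"
        proof -
          have "((norm (f x))\<^sup>2) powr ((q - 2) / 2) = norm (f x) powr (q - 2)"
          proof -
            have "(norm (f x))\<^sup>2 = norm (f x) powr 2" using False by (simp add: powr_numeral)
            moreover have "2 * ((q - 2) / 2) = q - 2" by simp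
            ultimately show ?thesis by (simp only: powr_powr)
          qed
          moreover have "norm (f x) powr (q - 2) * (norm (f x))\<^sup>2 = norm (f x) powr q"
            using False by (simp flip: powr_numeral powr_add)
          ultimately show ?thesis by simp
        qed
        also have "\<dots> \<le> \<tau> powr ((q - 2) / 2) * (norm (f x))\<^sup>2"
          using True q by (intro mult_right_mono powr_mono2) auto
        finally show ?thesis by (simp add: \<tau>q)
      qed simp
      then have "ennreal (norm (f x) powr q) \<le> ennreal (\<delta> / 3 * (norm (f x))\<^sup>2)"
        by (rule ennreal_leI)
      also have "\<dots> = ennreal (\<delta> / 3) * nsq (f x)"
        unfolding nsq_def by (rule ennreal_mult) (use \<delta> in auto)
      finally show ?thesis by (rule order_trans) simp
    next
      case False
      have "nsq (f x) \<le> 4 * osc h f x"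
        by (rule nsq_le_4_osc[OF h(1) fm ah]) (use False \<tau> in auto)
      \<comment> \<open>Young's inequality for \<open>norm (f x) powr (q - 1)\<close> times
        \<open>norm (f x)\<close>. The square of the first factor is the reason for the exponent
        \<open>2 * q - 2\<close> in the Sobolev bound.\<close>
      have "norm (f x) powr q \<le> \<eta> * norm (f x) powr (2 * q - 2) + (1 / \<eta>) * (norm (f x))\<^sup>2"
      proof (cases "f x = 0")
        case False
        define y z where "y = norm (f x) powr (q - 1)" and "z = norm (f x)"
        have "y * z = norm (f x) powr q"
          using False powr_mult_base[of "norm (f x)" "q - 1"] by (simp add: y_def z_def mult.commute)
        moreover have "y\<^sup>2 = norm (f x) powr (2 * q - 2)"
          using False by (simp add: y_def power2_eq_square flip: powr_add)
        moreover have "2 * (y * z) \<le> \<eta> * y\<^sup>2 + (1 / \<eta>) * z\<^sup>2"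
        proof -
          have "\<eta> * y\<^sup>2 + (1 / \<eta>) * z\<^sup>2 - 2 * (y * z) = (\<eta> * y - z)\<^sup>2 / \<eta>"
            using \<eta> by (simp add: power2_eq_square field_simps)
          moreover have "(\<eta> * y - z)\<^sup>2 / \<eta> \<ge> 0" using \<eta> by simp
          ultimately show ?thesis by linarith
        qed
        moreover have "0 \<le> y * z" by (simp add: y_def z_def)
        ultimately have "2 * norm (f x) powr q \<le> \<eta> * norm (f x) powr (2 * q - 2) + (1 / \<eta>) * z\<^sup>2"
          by simp
        moreover have "0 \<le> norm (f x) powr q" by simp
        ultimately have "norm (f x) powr q \<le> \<eta> * norm (f x) powr (2 * q - 2) + (1 / \<eta>) * z\<^sup>2"
          by linarith
        then show ?thesis by (simp only: z_def)
      qed (use \<eta> in simp)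
      then have "ennreal (norm (f x) powr q) \<le> ennreal (\<eta> * norm (f x) powr (2 * q - 2) + (1 / \<eta>) * (norm (f x))\<^sup>2)"
        by (rule ennreal_leI)
      also have "\<dots> = ennreal \<eta> * ennreal (norm (f x) powr (2 * q - 2)) + ennreal (1 / \<eta>) * nsq (f x)"
        using \<eta> by (simp add: nsq_def ennreal_plus ennreal_mult flip: ennreal_mult)
      also have "\<dots> \<le> ennreal \<eta> * ennreal (norm (f x) powr (2 * q - 2)) + ennreal (1 / \<eta>) * (4 * osc h f x)"
        using \<open>nsq (f x) \<le> 4 * osc h f x\<close> by (intro add_left_mono mult_left_mono) auto
      also have "ennreal (1 / \<eta>) * (4 * osc h f x) = ennreal (4 / \<eta>) * osc h f x"
      proof -
        have "ennreal (4 / \<eta>) = ennreal (1 / \<eta>) * 4"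
          using \<eta> ennreal_mult[of "1 / \<eta>" 4] by simp
        then show ?thesis by (simp add: mult.assoc)
      qed
      finally show ?thesis by (rule order_trans) simp
    qed
    have "(\<integral>\<^sup>+x. ennreal (norm (f x) powr q) \<partial>lborel) \<le> (\<integral>\<^sup>+x. ennreal (\<delta> / 3) * nsq (f x)
        + (ennreal \<eta> * ennreal (norm (f x) powr (2 * q - 2)) + ennreal (4 / \<eta>) * osc h f x) \<partial>lborel)"
      by (rule nn_integral_mono) (rule pw)
    also have "\<dots> = ennreal (\<delta> / 3) * (\<integral>\<^sup>+x. nsq (f x) \<partial>lborel)
        + (ennreal \<eta> * (\<integral>\<^sup>+x. ennreal (norm (f x) powr (2 * q - 2)) \<partial>lborel)
          + ennreal (4 / \<eta>) * (\<integral>\<^sup>+x. osc h f x \<partial>lborel))"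
      by (simp add: nn_integral_add nn_integral_cmult)
    also have "\<dots> \<le> ennreal (\<delta> / 3) * 1 + (ennreal \<eta> * ennreal C + ennreal (4 / \<eta>) * ennreal (2 * h\<^sup>2))"
      by (intro add_mono mult_left_mono unit_sobolevD f C(2) nn_integral_osc_le h) auto
    also have "\<dots> = ennreal (\<delta> / 3 + (\<eta> * C + (4 / \<eta>) * (2 * h\<^sup>2)))"
      using \<delta> \<eta> C(1) by (simp add: ennreal_plus flip: ennreal_mult)
    also have "\<dots> \<le> ennreal \<delta>"
    proof (rule ennreal_leI)
      have "\<eta> * C = \<delta> / 3" using C(1) by (simp add: \<eta>_def)
      then show "\<delta> / 3 + (\<eta> * C + (4 / \<eta>) * (2 * h\<^sup>2)) \<le> \<delta>" using h2 by simp
    qed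
    finally show "(\<integral>\<^sup>+x. ennreal (norm (f x) powr q) \<partial>lborel) \<le> ennreal \<delta>" .
  qed
qed

text \<open>The integral is left undivided by the area; the factor \<open>2 / h ^ 4\<close> in
  \<open>nsq_le_osc_mean\<close> compensates for this.\<close>

definition mean :: "real \<Rightarrow> (real^2 \<Rightarrow> complex) \<Rightarrow> real^2 \<Rightarrow> complex" where
  "mean h f x = (LINT z|lborel. indicator (square h) z *\<^sub>R f (x + z))"

lemma integrable_square:
  fixes f :: "real^2 \<Rightarrow> complex"
  assumes "sq_integrable f"
  shows "integrable lborel (\<lambda>z. indicator (square h) z *\<^sub>R f (x + z))"
  using sq_integrable_scaleR_integrable(1)[OF sq_integrable_indicator_cbox sq_integrable_translate[OF assms, of x],
      of 0 "\<chi> i. h"]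
  by (simp add: square_def add.commute)

lemma nsq_integral_square_le:
  fixes f :: "real^2 \<Rightarrow> complex"
  assumes h: "h > 0" and [measurable]: "f \<in> borel_measurable borel"
  shows "nsq (LINT z|lborel. indicator (square h) z *\<^sub>R f z)
    \<le> ennreal (h\<^sup>2) * (\<integral>\<^sup>+z. indicator (square h) z * nsq (f z) \<partial>lborel)"
proof -
  let ?u = "\<lambda>z. indicator (square h) z *\<^sub>R f z"
  have "ennreal (norm (LINT z|lborel. ?u z)) \<le> (\<integral>\<^sup>+z. ennreal (norm (?u z)) \<partial>lborel)"
  proof (cases "integrable lborel ?u")
    case True
    then show ?thesis by (rule integral_norm_bound_ennreal)
  qed (simp add: not_integrable_integral_eq)
  also have "\<dots> = (\<integral>\<^sup>+z. indicator (square h) z * ennreal (norm (?u z)) \<partial>lborel)"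
    by (intro nn_integral_cong) (auto simp: indicator_def)
  finally have "(ennreal (norm (LINT z|lborel. ?u z)))\<^sup>2 \<le> (\<integral>\<^sup>+z. indicator (square h) z * ennreal (norm (?u z)) \<partial>lborel)\<^sup>2"
    by (rule power_mono) simp
  also have "\<dots> \<le> (\<integral>\<^sup>+z. (indicator (square h) z)\<^sup>2 \<partial>lborel) * (\<integral>\<^sup>+z. (ennreal (norm (?u z)))\<^sup>2 \<partial>lborel)"
    by (rule Cauchy_Schwarz_nn_integral) measurable
  also have "(\<integral>\<^sup>+z. (indicator (square h) z)\<^sup>2 \<partial>lborel) = (\<integral>\<^sup>+z. indicator (square h) z \<partial>lborel)"
    by (intro nn_integral_cong) (auto simp: indicator_def)
  also have "\<dots> = ennreal (h\<^sup>2)"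
    using h by (simp add: emeasure_square)
  also have "(\<integral>\<^sup>+z. (ennreal (norm (?u z)))\<^sup>2 \<partial>lborel) = (\<integral>\<^sup>+z. indicator (square h) z * nsq (f z) \<partial>lborel)"
    by (intro nn_integral_cong) (auto simp: indicator_def nsq_def ennreal_power)
  finally show ?thesis by (simp add: nsq_def ennreal_power)
qed

text \<open>In contrast to \<open>nsq_le_osc_avg\<close>, the second term is built from a linear
  functional of \<open>f\<close>, so it vanishes in the limit under weak convergence to 0.\<close>

lemma nsq_le_osc_mean:
  assumes h: "h > 0" and f: "sq_integrable f"
  shows "nsq (f x) \<le> 2 * osc h f x + ennreal (2 / h ^ 4) * nsq (mean h f x)"
proof -
  have [measurable]: "f \<in> borel_measurable borel" using f by (rule sq_integrableD)
  have i1: "integrable lborel (\<lambda>z. indicator (square h) z *\<^sub>R f x)"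
    using emeasure_square[of h] h by (intro integrable_scaleR_left) auto
  have m: "measure lborel (square h) = h\<^sup>2"
    using emeasure_square[of h] h by (simp add: measure_def)
  have "(LINT z|lborel. indicator (square h) z *\<^sub>R (f (x + z) - f x)) = mean h f x - h\<^sup>2 *\<^sub>R f x"
  proof -
    have "(LINT z|lborel. indicator (square h) z *\<^sub>R f x) = h\<^sup>2 *\<^sub>R f x"
      using emeasure_square[of h] h by (subst integral_scaleR_left) (auto simp: m)
    then show ?thesis
      using integrable_square[OF f, of h x] i1 by (simp add: mean_def scaleR_diff_right)
  qed
  then have eq: "(h\<^sup>2) *\<^sub>R f x = - (LINT z|lborel. indicator (square h) z *\<^sub>R (f (x + z) - f x)) + mean h f x"
    by simp
  have "ennreal (h ^ 4) * nsq (f x) = nsq ((h\<^sup>2) *\<^sub>R f x)"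
    by (simp add: nsq_def power_mult_distrib flip: ennreal_mult power_mult)
  also have "\<dots> \<le> 2 * nsq (- (LINT z|lborel. indicator (square h) z *\<^sub>R (f (x + z) - f x))) + 2 * nsq (mean h f x)"
    unfolding eq by (rule nsq_add_le)
  also have "\<dots> \<le> 2 * (ennreal (h\<^sup>2) * (\<integral>\<^sup>+z. indicator (square h) z * nsq (f (x + z) - f x) \<partial>lborel)) + 2 * nsq (mean h f x)"
    using nsq_integral_square_le[OF h, of "\<lambda>z. f (x + z) - f x"]
    by (intro add_right_mono mult_left_mono) (auto simp: nsq_def)
  finally have "ennreal (1 / h ^ 4) * (ennreal (h ^ 4) * nsq (f x))
      \<le> ennreal (1 / h ^ 4) * (2 * (ennreal (h\<^sup>2) * (\<integral>\<^sup>+z. indicator (square h) z * nsq (f (x + z) - f x) \<partial>lborel)) + 2 * nsq (mean h f x))"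
    by (rule mult_left_mono) simp
  also have "ennreal (1 / h ^ 4) * (ennreal (h ^ 4) * nsq (f x)) = nsq (f x)"
    using h by (simp flip: mult.assoc ennreal_mult)
  also have "ennreal (1 / h ^ 4) * (2 * (ennreal (h\<^sup>2) * (\<integral>\<^sup>+z. indicator (square h) z * nsq (f (x + z) - f x) \<partial>lborel)) + 2 * nsq (mean h f x))
      = 2 * ((ennreal (1 / h ^ 4) * ennreal (h\<^sup>2)) * (\<integral>\<^sup>+z. indicator (square h) z * nsq (f (x + z) - f x) \<partial>lborel))
        + (ennreal (1 / h ^ 4) * 2) * nsq (mean h f x)"
    by (simp only: distrib_left mult_ac)
  also have "ennreal (1 / h ^ 4) * ennreal (h\<^sup>2) = ennreal (1 / h\<^sup>2)"
    using h by (simp add: power2_eq_square power4_eq_xxxx flip: ennreal_mult)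
  also have "ennreal (1 / h ^ 4) * 2 = ennreal (2 / h ^ 4)"
    using ennreal_mult[of "1 / h ^ 4" 2] by simp
  finally show ?thesis by (simp add: osc_def)
qed

lemma mean_measurable [measurable]:
  assumes [measurable]: "f \<in> borel_measurable borel"
  shows "mean h f \<in> borel_measurable borel"
proof -
  have "(\<lambda>x. LINT z|lborel. indicator (square h) z *\<^sub>R f (x + z)) \<in> borel_measurable lborel"
    by measurable
  then show ?thesis by (simp add: mean_def[abs_def])
qed

text \<open>A Rellich theorem. The oscillation is small uniformly in \<open>n\<close> once
  \<open>h\<close> is small; for this fixed \<open>h\<close> the means are uniformly bounded and
  tend to 0 pointwise, so dominated convergence applies with the integrable weight. Two weights
  occur later: the indicator of a unit square, and a weight that is positive everywhere.\<close>

lemma local_compactness: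
  fixes f :: "nat \<Rightarrow> real^2 \<Rightarrow> complex" and w :: "real^2 \<Rightarrow> ennreal"
  assumes f: "\<And>n. unit_sobolev (f n)"
    and mean0: "\<And>h x. h > 0 \<Longrightarrow> (\<lambda>n. mean h (f n) x) \<longlonglongrightarrow> 0"
    and w [measurable]: "w \<in> borel_measurable borel" and w1: "\<And>x. w x \<le> 1"
    and wint: "(\<integral>\<^sup>+x. w x \<partial>lborel) < \<infinity>"
  shows "(\<lambda>n. \<integral>\<^sup>+x. w x * nsq (f n x) \<partial>lborel) \<longlonglongrightarrow> 0"
proof (rule order_tendstoI)
  fix c :: ennreal assume "0 < c"
  then obtain d where d: "0 < d" "d < c" using dense by blast
  obtain e where e: "d = ennreal e" "e > 0"
    using d by (cases d) (auto simp: top_unique)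
  \<comment> \<open>With this \<open>h\<close> the oscillation contributes at most
    \<open>2 * (2 * h\<^sup>2) = e / 2\<close>.\<close>
  define h where "h = sqrt (e / 8)"
  have h: "h > 0" and h2: "h\<^sup>2 = e / 8" using e(2) by (auto simp: h_def)
  have fm [measurable]: "f n \<in> borel_measurable borel" for n
    by (rule unit_sobolevD(2)[OF f])
  define J where "J n = (\<integral>\<^sup>+x. w x * (ennreal (2 / h ^ 4) * nsq (mean h (f n) x)) \<partial>lborel)" for n
  have "J \<longlonglongrightarrow> (\<integral>\<^sup>+x. 0 \<partial>(lborel :: (real^2) measure))"
    unfolding J_def
  proof (rule nn_integral_dominated_convergence[where w = "\<lambda>x. ennreal (2 / h ^ 4) * ennreal (h\<^sup>2) * w x"])
    show "(\<integral>\<^sup>+x. ennreal (2 / h ^ 4) * ennreal (h\<^sup>2) * w x \<partial>lborel) < \<infinity>"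
      using wint by (subst nn_integral_cmult) (auto simp: ennreal_mult_less_top)
    have mb: "nsq (mean h (f n) x) \<le> ennreal (h\<^sup>2)" for n x
    proof -
      have "nsq (mean h (f n) x) \<le> ennreal (h\<^sup>2) * (\<integral>\<^sup>+z. indicator (square h) z * nsq (f n (x + z)) \<partial>lborel)"
        unfolding mean_def by (rule nsq_integral_square_le[OF h]) measurable
      also have "(\<integral>\<^sup>+z. indicator (square h) z * nsq (f n (x + z)) \<partial>lborel) \<le> (\<integral>\<^sup>+z. nsq (f n (x + z)) \<partial>lborel)"
        by (intro nn_integral_mono) (auto simp: indicator_def)
      also have "\<dots> = (\<integral>\<^sup>+z. nsq (f n z) \<partial>lborel)"
        using nn_integral_lborel_translate[of "\<lambda>z. nsq (f n z)" x] by (simp add: add.commute)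
      also have "\<dots> \<le> 1" by (rule unit_sobolevD(3)[OF f])
      finally show ?thesis by (simp add: mult_left_mono)
    qed
    show "AE x in lborel. w x * (ennreal (2 / h ^ 4) * nsq (mean h (f n) x)) \<le> ennreal (2 / h ^ 4) * ennreal (h\<^sup>2) * w x" for n
    proof (rule AE_I2)
      fix x
      have "w x * (ennreal (2 / h ^ 4) * nsq (mean h (f n) x)) \<le> w x * (ennreal (2 / h ^ 4) * ennreal (h\<^sup>2))"
        by (intro mult_left_mono mb) auto
      then show "w x * (ennreal (2 / h ^ 4) * nsq (mean h (f n) x)) \<le> ennreal (2 / h ^ 4) * ennreal (h\<^sup>2) * w x"
        by (simp only: mult.commute)
    qed
    show "AE x in lborel. (\<lambda>n. w x * (ennreal (2 / h ^ 4) * nsq (mean h (f n) x))) \<longlonglongrightarrow> 0"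
    proof (rule AE_I2)
      fix x
      have wt: "w x < top" using w1[of x] by (simp add: le_less_trans[of _ 1])
      have "(\<lambda>n. (norm (mean h (f n) x))\<^sup>2) \<longlonglongrightarrow> (norm (0::complex))\<^sup>2"
        by (intro tendsto_power tendsto_norm mean0 h)
      then have "(\<lambda>n. nsq (mean h (f n) x)) \<longlonglongrightarrow> ennreal 0"
        unfolding nsq_def by (intro tendsto_ennrealI) simp
      then have "(\<lambda>n. w x * (ennreal (2 / h ^ 4) * nsq (mean h (f n) x))) \<longlonglongrightarrow> w x * (ennreal (2 / h ^ 4) * ennreal 0)"
        using wt by (intro ennreal_tendsto_cmult) auto
      then show "(\<lambda>n. w x * (ennreal (2 / h ^ 4) * nsq (mean h (f n) x))) \<longlonglongrightarrow> 0" by simp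
    qed
  qed measurable
  then have "J \<longlonglongrightarrow> 0" by simp
  then have "\<forall>\<^sub>F n in sequentially. J n < ennreal (e / 2)"
    using e(2) by (intro order_tendstoD) auto
  then show "\<forall>\<^sub>F n in sequentially. (\<integral>\<^sup>+x. w x * nsq (f n x) \<partial>lborel) < c"
  proof eventually_elim
    case (elim n)
    have "(\<integral>\<^sup>+x. w x * nsq (f n x) \<partial>lborel)
        \<le> (\<integral>\<^sup>+x. 2 * osc h (f n) x + w x * (ennreal (2 / h ^ 4) * nsq (mean h (f n) x)) \<partial>lborel)"
    proof (rule nn_integral_mono)
      fix x
      have "w x * nsq (f n x) \<le> w x * (2 * osc h (f n) x + ennreal (2 / h ^ 4) * nsq (mean h (f n) x))"
        by (intro mult_left_mono nsq_le_osc_mean h unit_sobolevD(1)[OF f]) simp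
      \<comment> \<open>The bound on \<open>w\<close> drops the weight from the oscillation term,
        whose integral over the whole plane is under control.\<close>
      also have "\<dots> \<le> 2 * osc h (f n) x + w x * (ennreal (2 / h ^ 4) * nsq (mean h (f n) x))"
        unfolding distrib_left using mult_right_mono[OF w1[of x], of "2 * osc h (f n) x"]
        by (intro add_right_mono) simp
      finally show "w x * nsq (f n x) \<le> 2 * osc h (f n) x + w x * (ennreal (2 / h ^ 4) * nsq (mean h (f n) x))" .
    qed
    also have "\<dots> = 2 * (\<integral>\<^sup>+x. osc h (f n) x \<partial>lborel) + J n"
      unfolding J_def by (simp add: nn_integral_add nn_integral_cmult)
    also have "\<dots> \<le> 2 * ennreal (2 * h\<^sup>2) + ennreal (e / 2)"
      using elim by (intro add_mono mult_left_mono nn_integral_osc_le f h) auto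
    also have "\<dots> = ennreal e"
    proof -
      have "2 * ennreal (2 * h\<^sup>2) = ennreal (e / 2)"
        using ennreal_mult[of 2 "2 * h\<^sup>2"] e(2) by (simp add: h2)
      moreover have "ennreal (e / 2) + ennreal (e / 2) = ennreal e"
        using e(2) ennreal_plus[of "e / 2" "e / 2"] by simp
      ultimately show ?thesis by simp
    qed
    also have "\<dots> < c" using d e by simp
    finally show ?case .
  qed
qed simp

subsection \<open>The Green function\<close>

lemma exp_le_powr:
  fixes y s :: real
  assumes "y > 0" "0 < s" "s \<le> 1"
  shows "exp (- y) \<le> y powr (- s)"
proof -
  have "y powr s \<le> exp y"
  proof (cases "y \<le> 1")
    case True
    then have "y powr s \<le> 1" using assms by (intro powr_le1) auto
    also have "1 \<le> exp y" using assms by simp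
    finally show ?thesis .
  next
    case False
    then have "y powr s \<le> y powr 1" using assms by (intro powr_mono) auto
    also have "\<dots> \<le> exp y" using assms exp_ge_add_one_self[of y] by (simp del: exp_ge_add_one_self)
    finally show ?thesis .
  qed
  then show ?thesis using assms by (simp add: powr_minus exp_minus le_imp_inverse_le)
qed

text \<open>One half of the exponent keeps exponential decay in \<open>r\<close>. The other half is
  weakened to a power of \<open>r * cosh t\<close>, which yields both the singularity
  \<open>r powr (- s)\<close> and integrability in \<open>t\<close>. Arbitrarily small
  \<open>s\<close> stands in for the logarithmic singularity.\<close>

lemma bessel_integrand_le:
  fixes r s t :: real
  assumes "r > 0" "0 < s" "s \<le> 1" "t \<ge> 0"
  shows "exp (- r * cosh t) \<le> exp (- r / 2) * (r / 4) powr (- s) * exp (- s * t)"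
proof -
  have c1: "cosh t \<ge> 1" by (rule cosh_real_ge_1)
  have c2: "exp t / 2 \<le> cosh t" by (simp add: cosh_def)
  have "exp (- r * cosh t) = exp (- (r / 2) * cosh t) * exp (- ((r / 2) * cosh t))"
    by (simp flip: exp_add)
  also have "\<dots> \<le> exp (- r / 2) * ((r / 2) * cosh t) powr (- s)"
    using assms c1 mult_left_mono[OF c1, of "r / 2"] by (intro mult_mono exp_le_powr) auto
  also have "((r / 2) * cosh t) powr (- s) \<le> ((r / 4) * exp t) powr (- s)"
    using assms c2 by (intro powr_mono2') auto
  also have "((r / 4) * exp t) powr (- s) = (r / 4) powr (- s) * exp (- s * t)"
  proof -
    have "((r / 4) * exp t) powr (- s) = (r / 4) powr (- s) * (exp t) powr (- s)"
      by (rule powr_mult)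
    also have "(exp t) powr (- s) = exp (- s * t)" by (simp add: powr_def)
    finally show ?thesis .
  qed
  finally show ?thesis by (simp add: mult_left_mono mult.assoc)
qed

lemma nn_integral_exp_decay:
  assumes "s > 0"
  shows "(\<integral>\<^sup>+t. ennreal (exp (- s * t)) * indicator {0..} t \<partial>lborel) = ennreal (1 / s)"
proof -
  have "((\<lambda>t. - (1 / s) * exp (- s * t)) \<longlongrightarrow> - (1 / s) * 0) at_top"
  proof (intro tendsto_mult tendsto_const)
    have "filterlim (\<lambda>t. s * t) at_top at_top"
      using assms by (intro filterlim_tendsto_pos_mult_at_top[OF tendsto_const]) (auto simp: filterlim_ident)
    then have "filterlim (\<lambda>t. - s * t) at_bot at_top"
      by (simp add: filterlim_uminus_at_bot)
    then show "((\<lambda>t. exp (- s * t)) \<longlongrightarrow> 0) at_top"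
      by (rule filterlim_compose[OF exp_at_bot])
  qed
  then have "(\<integral>\<^sup>+t. ennreal (exp (- s * t)) * indicator {0..} t \<partial>lborel) = ennreal (- (1 / s) * 0 - (- (1 / s) * exp (- s * 0)))"
    using assms by (intro nn_integral_FTC_atLeast) (auto intro!: derivative_eq_intros)
  then show ?thesis by simp
qed

lemma bessel_integrable:
  assumes "r > 0"
  shows "integrable lborel (\<lambda>t. indicator {0..} t * exp (- r * cosh t))"
    and "0 < s \<Longrightarrow> s \<le> 1 \<Longrightarrow> bessel_K0 r \<le> exp (- r / 2) * (r / 4) powr (- s) / s"
    and "0 \<le> bessel_K0 r"
proof -
  have nn: "(\<integral>\<^sup>+t. ennreal (indicator {0..} t * exp (- r * cosh t)) \<partial>lborel)
      \<le> ennreal (exp (- r / 2) * (r / 4) powr (- s) / s)" if s: "0 < s" "s \<le> 1" for s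
  proof -
    define c where "c = exp (- r / 2) * (r / 4) powr (- s)"
    have c: "c \<ge> 0" by (simp add: c_def)
    have "(\<integral>\<^sup>+t. ennreal (indicator {0..} t * exp (- r * cosh t)) \<partial>lborel)
        \<le> (\<integral>\<^sup>+t. ennreal c * (ennreal (exp (- s * t)) * indicator {0..} t) \<partial>lborel)"
    proof (rule nn_integral_mono)
      fix t :: real
      show "ennreal (indicator {0..} t * exp (- r * cosh t)) \<le> ennreal c * (ennreal (exp (- s * t)) * indicator {0..} t)"
        using bessel_integrand_le[OF assms s, of t] c
        by (auto simp: indicator_def c_def ennreal_leI simp flip: ennreal_mult)
    qed
    also have "\<dots> = ennreal c * ennreal (1 / s)"
      unfolding nn_integral_exp_decay[OF s(1), symmetric] by (rule nn_integral_cmult) measurable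
    also have "\<dots> = ennreal (c / s)"
      using c s by (simp flip: ennreal_mult)
    finally show ?thesis by (simp add: c_def)
  qed
  show int: "integrable lborel (\<lambda>t. indicator {0..} t * exp (- r * cosh t))"
    by (rule integrableI_nonneg) (use le_less_trans[OF nn[of 1]] in \<open>auto simp: cosh_def\<close>)
  have K: "bessel_K0 r = (LINT t|lborel. indicator {0..} t * exp (- r * cosh t))"
    by (simp add: bessel_K0_def set_lebesgue_integral_def)
  show "0 \<le> bessel_K0 r"
    unfolding K by (rule integral_nonneg_AE) auto
  show "bessel_K0 r \<le> exp (- r / 2) * (r / 4) powr (- s) / s" if s: "0 < s" "s \<le> 1"
  proof -
    have "ennreal (bessel_K0 r) = (\<integral>\<^sup>+t. ennreal (indicator {0..} t * exp (- r * cosh t)) \<partial>lborel)"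
      unfolding K by (rule nn_integral_eq_integral[symmetric]) (use int in auto)
    also note nn[OF s]
    finally show ?thesis using s by (simp add: ennreal_le_iff)
  qed
qed

lemma borel_measurable_bessel_K0 [measurable]: "bessel_K0 \<in> borel_measurable borel"
proof -
  have "(\<lambda>r::real. LINT t|lborel. indicator {0..} t * exp (- r * cosh (t::real))) \<in> borel_measurable lborel"
    unfolding cosh_def by measurable
  then show ?thesis
    by (simp add: bessel_K0_def[abs_def] set_lebesgue_integral_def)
qed

lemma borel_measurable_green [measurable]: "green \<kappa> \<in> borel_measurable borel"
  unfolding green_def[abs_def] by measurable

text \<open>The integrand of the Gamma integral at \<open>1 / 2\<close>, reflected to the whole
  line. The value \<open>top\<close> at 0 lets a product of two such weights dominate on the
  coordinate axes too.\<close>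

definition gamma_weight :: "real \<Rightarrow> ennreal" where
  "gamma_weight t = (if t = 0 then top else ennreal (\<bar>t\<bar> powr (- 1 / 2) / exp \<bar>t\<bar>))"

lemma gamma_weight_measurable [measurable]: "gamma_weight \<in> borel_measurable borel"
  unfolding gamma_weight_def[abs_def] by measurable

lemma nn_integral_gamma_weight:
  assumes "\<beta> > 0"
  shows "(\<integral>\<^sup>+t. gamma_weight (\<beta> * t) \<partial>lborel) < \<infinity>"
proof -
  define p :: "real \<Rightarrow> ennreal" where "p t = ennreal (t powr (1 / 2 - 1) / exp t) * indicator {0..} t" for t
  have [measurable]: "p \<in> borel_measurable borel" unfolding p_def[abs_def] by measurable
  have P: "(\<integral>\<^sup>+t. p t \<partial>lborel) = ennreal (Gamma (1 / 2))"
    unfolding p_def by (rule nn_integral_has_integral_lebesgue') (use Gamma_integral_real[of "1 / 2"] in auto)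
  have P': "(\<integral>\<^sup>+t. p (- t) \<partial>lborel) = ennreal (Gamma (1 / 2))"
    using nn_integral_real_affine[of p "-1" 0] P by simp
  have "(\<integral>\<^sup>+t. gamma_weight t \<partial>lborel) = (\<integral>\<^sup>+t. p t + p (- t) \<partial>lborel)"
  proof (rule nn_integral_cong_AE)
    show "AE t in lborel. gamma_weight t = p t + p (- t)"
      using AE_lborel_singleton[of 0] by eventually_elim (auto simp: gamma_weight_def p_def indicator_def)
  qed
  also have "\<dots> = ennreal (Gamma (1 / 2)) + ennreal (Gamma (1 / 2))"
    by (subst nn_integral_add) (auto simp: P P')
  also have "\<dots> < \<infinity>" by simp
  finally have "(\<integral>\<^sup>+t. gamma_weight t \<partial>lborel) < \<infinity>" .
  moreover have "(\<integral>\<^sup>+t. gamma_weight t \<partial>lborel) = \<bar>\<beta>\<bar> * (\<integral>\<^sup>+t. gamma_weight (\<beta> * t) \<partial>lborel)"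
    using nn_integral_real_affine[of gamma_weight \<beta> 0] assms by simp
  ultimately show ?thesis
    using assms by (auto simp: ennreal_mult_less_top)
qed

lemma Basis_real_2: "(Basis :: (real^2) set) = {axis 1 1, axis 2 1}"
  by (auto simp: Basis_vec_def UNIV_2)

lemma prod_Basis_real_2: "(\<Prod>b\<in>Basis. f (x \<bullet> b)) = f (x $ 1) * f ((x :: real^2) $ 2)" for f :: "real \<Rightarrow> ennreal"
proof -
  have "axis 1 1 \<noteq> (axis 2 1 :: real^2)" by (simp add: axis_eq_axis)
  then show ?thesis by (simp add: Basis_real_2 inner_axis)
qed

lemma norm_real_2:
  fixes x :: "real^2"
  shows "norm x = sqrt ((x $ 1)\<^sup>2 + (x $ 2)\<^sup>2)" "\<bar>x $ 1\<bar> + \<bar>x $ 2\<bar> \<le> 2 * norm x"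
    "\<bar>x $ 1\<bar> * \<bar>x $ 2\<bar> \<le> (norm x)\<^sup>2"
proof -
  show eq: "norm x = sqrt ((x $ 1)\<^sup>2 + (x $ 2)\<^sup>2)"
    by (simp add: norm_vec_def L2_set_def UNIV_2)
  show "\<bar>x $ 1\<bar> + \<bar>x $ 2\<bar> \<le> 2 * norm x"
    using component_le_norm_cart[of x 1] component_le_norm_cart[of x 2] by linarith
  have "2 * (\<bar>x $ 1\<bar> * \<bar>x $ 2\<bar>) \<le> (norm x)\<^sup>2"
    using sum_squares_bound[of "\<bar>x $ 1\<bar>" "\<bar>x $ 2\<bar>"] by (simp add: eq)
  moreover have "0 \<le> \<bar>x $ 1\<bar> * \<bar>x $ 2\<bar>" by simp
  ultimately show "\<bar>x $ 1\<bar> * \<bar>x $ 2\<bar> \<le> (norm x)\<^sup>2" by linarith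
qed

text \<open>With \<open>s = 1 / q\<close> in the Bessel bound the \<open>q\<close>-th power is at
  most exponential decay times a multiple of \<open>1 / norm x\<close>. By
  \<open>norm_real_2\<close> both factors are dominated by products of functions of the single
  coordinates, and the plane integral splits into two Gamma integrals.\<close>

lemma nn_integral_green_powr:
  assumes "\<kappa> > 0" "q \<ge> 1"
  shows "(\<integral>\<^sup>+x. ennreal (norm (green \<kappa> x) powr q) \<partial>lborel) < \<infinity>"
proof -
  define a where "a = sqrt \<kappa>"
  have a: "a > 0" using assms by (simp add: a_def)
  define C where "C = (1 / (2 * pi)) powr q * q powr q"
  have C: "C \<ge> 0" by (simp add: C_def)
  \<comment> \<open>For \<open>r = a * norm x\<close> this gives
    \<open>r / 4 = \<beta> * norm x\<close>, matching the singular factor, and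
    \<open>r / 2 = \<beta> * (2 * norm x)\<close>, which dominates
    \<open>\<beta> * (\<bar>x $ 1\<bar> + \<bar>x $ 2\<bar>)\<close>.\<close>
  define \<beta> where "\<beta> = a / 4"
  have \<beta>: "\<beta> > 0" using a by (simp add: \<beta>_def)
  \<comment> \<open>On the axes the right-hand side is \<open>ennreal C * top\<close>, so
    \<open>C\<close> must not vanish there.\<close>
  have pw: "ennreal (norm (green \<kappa> x) powr q) \<le> ennreal C * (gamma_weight (\<beta> * x $ 1) * gamma_weight (\<beta> * x $ 2))"
    if "ennreal C \<noteq> 0" for x :: "real^2"
  proof (cases "x $ 1 = 0 \<or> x $ 2 = 0")
    case True
    have "gamma_weight t \<noteq> 0" for t by (simp add: gamma_weight_def)
    then have "gamma_weight (\<beta> * x $ 1) * gamma_weight (\<beta> * x $ 2) = top"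
      using True by (auto simp: gamma_weight_def ennreal_mult_eq_top_iff)
    then show ?thesis using that by (simp only:) (simp add: ennreal_mult_top)
  next
    case False
    define r where "r = a * norm x"
    have x: "norm x > 0" using False by auto
    then have r: "r > 0" using a by (simp add: r_def)
    have K: "0 \<le> bessel_K0 r" "bessel_K0 r \<le> exp (- r / 2) * (r / 4) powr (- (1 / q)) / (1 / q)"
      using bessel_integrable(2)[OF r, of "1 / q"] bessel_integrable(3)[OF r] assms by auto
    have gq: "norm (green \<kappa> x) powr q = (1 / (2 * pi)) powr q * bessel_K0 r powr q"
    proof -
      have "norm (green \<kappa> x) = 1 / (2 * pi) * bessel_K0 r"
        unfolding green_def norm_of_real using K(1) by (simp add: r_def a_def)
      then show ?thesis by (simp only: powr_mult)
    qed
    have e1: "((r / 4) powr (- (1 / q))) powr q = 1 / (\<beta> * norm x)"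
    proof -
      have "((r / 4) powr (- (1 / q))) powr q = (r / 4) powr (- (1 / q) * q)"
        by (rule powr_powr)
      also have "- (1 / q) * q = - 1" using assms by simp
      also have "(r / 4) powr (- 1) = 1 / (r / 4)"
        using r by (subst powr_minus_divide) (simp add: powr_one)
      finally have "((r / 4) powr (- (1 / q))) powr q = 1 / (r / 4)" .
      moreover have "r / 4 = \<beta> * norm x" by (simp add: r_def \<beta>_def)
      ultimately show ?thesis by metis
    qed
    have e2: "exp (- r / 2) powr q = exp (- (q * r / 2))"
      by (simp add: powr_def)
    have "bessel_K0 r powr q \<le> (exp (- r / 2) * (r / 4) powr (- (1 / q)) * q) powr q"
      using K assms by (intro powr_mono2) auto
    then have kq: "bessel_K0 r powr q \<le> exp (- (q * r / 2)) * (1 / (\<beta> * norm x)) * q powr q"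
      by (simp only: powr_mult e1 e2)
    have EW: "exp (- (q * r / 2)) * (1 / (\<beta> * norm x)) \<le> exp (- (\<beta> * \<bar>x $ 1\<bar>) - \<beta> * \<bar>x $ 2\<bar>) * ((\<beta> * \<bar>x $ 1\<bar>) powr (- 1 / 2) * (\<beta> * \<bar>x $ 2\<bar>) powr (- 1 / 2))"
    proof (intro mult_mono)
      have "\<beta> * (\<bar>x $ 1\<bar> + \<bar>x $ 2\<bar>) \<le> \<beta> * (2 * norm x)"
        using norm_real_2(2)[of x] \<beta> by (intro mult_left_mono) auto
      also have "\<dots> = r / 2" by (simp add: \<beta>_def r_def)
      also have "\<dots> \<le> q * r / 2" using assms r by simp
      finally show "exp (- (q * r / 2)) \<le> exp (- (\<beta> * \<bar>x $ 1\<bar>) - \<beta> * \<bar>x $ 2\<bar>)"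
        by (simp add: distrib_left)
      have "(\<beta> * \<bar>x $ 1\<bar>) powr (1 / 2) * (\<beta> * \<bar>x $ 2\<bar>) powr (1 / 2) = sqrt (\<beta>\<^sup>2 * (\<bar>x $ 1\<bar> * \<bar>x $ 2\<bar>))"
        using \<beta> False by (simp add: powr_half_sqrt real_sqrt_mult[symmetric] power2_eq_square mult_ac)
      also have "\<dots> \<le> sqrt (\<beta>\<^sup>2 * (norm x)\<^sup>2)"
        using norm_real_2(3)[of x] by (intro real_sqrt_le_mono mult_left_mono) auto
      also have "\<dots> = \<beta> * norm x" using \<beta> by (simp add: real_sqrt_mult)
      finally have le: "(\<beta> * \<bar>x $ 1\<bar>) powr (1 / 2) * (\<beta> * \<bar>x $ 2\<bar>) powr (1 / 2) \<le> \<beta> * norm x" .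
      have "(\<beta> * \<bar>x $ 1\<bar>) powr (- 1 / 2) * (\<beta> * \<bar>x $ 2\<bar>) powr (- 1 / 2)
          = 1 / ((\<beta> * \<bar>x $ 1\<bar>) powr (1 / 2) * (\<beta> * \<bar>x $ 2\<bar>) powr (1 / 2))"
        by (simp add: powr_minus_divide flip: minus_divide_left)
      moreover have "0 < (\<beta> * \<bar>x $ 1\<bar>) powr (1 / 2) * (\<beta> * \<bar>x $ 2\<bar>) powr (1 / 2)"
        using \<beta> False by simp
      ultimately show "1 / (\<beta> * norm x) \<le> (\<beta> * \<bar>x $ 1\<bar>) powr (- 1 / 2) * (\<beta> * \<bar>x $ 2\<bar>) powr (- 1 / 2)"
        using le by (simp add: frac_le)
    qed (use \<beta> x in auto)
    have "norm (green \<kappa> x) powr q \<le> (1 / (2 * pi)) powr q * ((exp (- (\<beta> * \<bar>x $ 1\<bar>) - \<beta> * \<bar>x $ 2\<bar>) * ((\<beta> * \<bar>x $ 1\<bar>) powr (- 1 / 2) * (\<beta> * \<bar>x $ 2\<bar>) powr (- 1 / 2))) * q powr q)"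
      unfolding gq by (intro mult_left_mono order_trans[OF kq] mult_right_mono EW) auto
    also have "\<dots> = C * (exp (- (\<beta> * \<bar>x $ 1\<bar>) - \<beta> * \<bar>x $ 2\<bar>) * ((\<beta> * \<bar>x $ 1\<bar>) powr (- 1 / 2) * (\<beta> * \<bar>x $ 2\<bar>) powr (- 1 / 2)))"
      unfolding C_def by (simp only: mult_ac)
    also have "exp (- (\<beta> * \<bar>x $ 1\<bar>) - \<beta> * \<bar>x $ 2\<bar>) * ((\<beta> * \<bar>x $ 1\<bar>) powr (- 1 / 2) * (\<beta> * \<bar>x $ 2\<bar>) powr (- 1 / 2))
        = ((\<beta> * \<bar>x $ 1\<bar>) powr (- 1 / 2) / exp (\<beta> * \<bar>x $ 1\<bar>)) * ((\<beta> * \<bar>x $ 2\<bar>) powr (- 1 / 2) / exp (\<beta> * \<bar>x $ 2\<bar>))"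
    proof -
      have "exp (- A - B) * (P * Q) = (P / exp A) * (Q / exp B)" for A B P Q :: real
      proof -
        have e: "exp (- A - B) = inverse (exp A * exp B)"
          using exp_minus[of "A + B"] by (simp only: exp_add minus_add_distrib diff_conv_add_uminus)
        show ?thesis by (simp only: e divide_inverse inverse_mult_distrib mult_ac)
      qed
      then show ?thesis .
    qed
    finally have "ennreal (norm (green \<kappa> x) powr q) \<le> ennreal (C * (((\<beta> * \<bar>x $ 1\<bar>) powr (- 1 / 2) / exp (\<beta> * \<bar>x $ 1\<bar>)) * ((\<beta> * \<bar>x $ 2\<bar>) powr (- 1 / 2) / exp (\<beta> * \<bar>x $ 2\<bar>))))"
      by (rule ennreal_leI)
    also have "\<dots> = ennreal C * (gamma_weight (\<beta> * x $ 1) * gamma_weight (\<beta> * x $ 2))"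
      using False \<beta> C by (simp add: gamma_weight_def abs_mult flip: ennreal_mult)
    finally show ?thesis .
  qed
  have "C \<noteq> 0" using assms by (simp add: C_def)
  then have C0: "ennreal C \<noteq> 0" using C by simp
  have "(\<integral>\<^sup>+x. ennreal (norm (green \<kappa> x) powr q) \<partial>lborel)
      \<le> (\<integral>\<^sup>+x. ennreal C * (\<Prod>b\<in>Basis. gamma_weight (\<beta> * (x \<bullet> b))) \<partial>(lborel :: (real^2) measure))"
    using pw[OF C0] prod_Basis_real_2[of "\<lambda>t. gamma_weight (\<beta> * t)"] by (intro nn_integral_mono) simp
  also have "\<dots> = ennreal C * (\<integral>\<^sup>+x. (\<Prod>b\<in>Basis. gamma_weight (\<beta> * (x \<bullet> b))) \<partial>(lborel :: (real^2) measure))"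
    by (rule nn_integral_cmult) measurable
  also have "(\<integral>\<^sup>+x. (\<Prod>b\<in>Basis. gamma_weight (\<beta> * (x \<bullet> b))) \<partial>(lborel :: (real^2) measure))
      = (\<Prod>b\<in>(Basis :: (real^2) set). \<integral>\<^sup>+t. gamma_weight (\<beta> * t) \<partial>lborel)"
    by (rule nn_integral_lborel_prod) auto
  also have "ennreal C * \<dots> < \<infinity>"
    using nn_integral_gamma_weight[OF \<beta>] by (auto simp: ennreal_mult_less_top Basis_real_2 axis_eq_axis)
  finally show ?thesis .
qed

lemma sq_integrable_green: "\<kappa> > 0 \<Longrightarrow> sq_integrable (green \<kappa>)"
proof -
  assume k: "\<kappa> > 0"
  have "(\<integral>\<^sup>+x. ennreal ((norm (green \<kappa> x))\<^sup>2) \<partial>lborel) = (\<integral>\<^sup>+x. ennreal (norm (green \<kappa> x) powr 2) \<partial>lborel)"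
    by (simp add: powr_numeral)
  also have "\<dots> < \<infinity>" by (rule nn_integral_green_powr) (use k in auto)
  finally show ?thesis
    unfolding sq_integrable_def by (auto intro: integrableI_nonneg)
qed

text \<open>A trace of the logarithmic singularity that does not depend on the scale. For
  \<open>t\<close> in an interval of length 1 starting at \<open>ln (2 / r)\<close> the quantity
  \<open>y = r * cosh t\<close> lies between 1 and \<open>2 * exp 1\<close>, whatever
  \<open>r\<close> is. There \<open>(4 / 3) * y \<ge> y + 1 / 3\<close>, so the integrands differ by
  at least a fixed amount.\<close>

lemma bessel_K0_diff_ge:
  obtains c where "c > 0" "\<And>r r'. 0 < r \<Longrightarrow> r \<le> 1 \<Longrightarrow> (4 / 3) * r \<le> r' \<Longrightarrow> c \<le> bessel_K0 r - bessel_K0 r'"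
proof
  define c :: real where "c = exp (- (2 * exp 1)) * (1 - exp (- (1 / 3)))"
  show "c > 0" by (simp add: c_def)
  fix r r' :: real assume r: "0 < r" "r \<le> 1" "(4 / 3) * r \<le> r'"
  define l where "l = ln (2 / r)"
  have l0: "l \<ge> 0" using r by (simp add: l_def)
  have r': "r' > 0" using r by linarith
  have "c = (LINT t|lborel. c * indicator {l..l + 1} t)"
    by simp
  also have "\<dots> \<le> (LINT t|lborel. indicator {0..} t * exp (- r * cosh t) - indicator {0..} t * exp (- r' * cosh t))"
  proof (rule integral_mono)
    show "integrable lborel (\<lambda>t. c * indicator {l..l + 1} t)" by simp
    show "integrable lborel (\<lambda>t. indicator {0..} t * exp (- r * cosh t) - indicator {0..} t * exp (- r' * cosh t))"
      by (intro Bochner_Integration.integrable_diff bessel_integrable r r')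
    fix t :: real
    show "c * indicator {l..l + 1} t \<le> indicator {0..} t * exp (- r * cosh t) - indicator {0..} t * exp (- r' * cosh t)"
    proof (cases "t \<in> {l..l + 1}")
      case True
      define y where "y = r * cosh t"
      have e: "exp t \<ge> 2 / r" "exp t \<le> 2 / r * exp 1"
      proof -
        have "exp l \<le> exp t" "exp t \<le> exp (l + 1)" using True by auto
        moreover have "exp l = 2 / r" using r by (simp add: l_def)
        ultimately show "exp t \<ge> 2 / r" "exp t \<le> 2 / r * exp 1" by (simp_all add: exp_add)
      qed
      have ch: "exp t / 2 \<le> cosh t" "cosh t \<le> exp t"
        using True l0 by (auto simp: cosh_def)
      have "r * (1 / r) \<le> r * cosh t" using e(1) ch(1) r by (intro mult_left_mono) auto
      then have y1: "1 \<le> y" using r by (simp add: y_def)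
      have "r * cosh t \<le> r * (2 / r * exp 1)" using e(2) ch(2) r by (intro mult_left_mono) auto
      then have y2: "y \<le> 2 * exp 1" using r by (simp add: y_def)
      have "(4 / 3) * y \<le> r' * cosh t"
        using mult_right_mono[OF r(3), of "cosh t"] by (simp add: y_def mult.assoc)
      then have "exp (- (r' * cosh t)) \<le> exp (- (4 / 3 * y))" by simp
      also have "\<dots> \<le> exp (- y) * exp (- (1 / 3))"
        using y1 by (simp flip: exp_add)
      finally have "exp (- y) * (1 - exp (- (1 / 3))) \<le> exp (- r * cosh t) - exp (- r' * cosh t)"
        by (simp add: y_def algebra_simps)
      moreover have "c \<le> exp (- y) * (1 - exp (- (1 / 3)))"
        using y2 unfolding c_def by (intro mult_right_mono) auto
      ultimately show ?thesis using True l0 by (auto simp: indicator_def)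
    next
      case False
      have "r * cosh t \<le> r' * cosh t"
        using r cosh_real_ge_1[of t] by (intro mult_right_mono) auto
      then show ?thesis using False by (auto simp: indicator_def)
    qed
  qed
  also have "\<dots> = bessel_K0 r - bessel_K0 r'"
    using bessel_integrable(1)[OF r(1)] bessel_integrable(1)[OF r']
    by (simp add: bessel_K0_def set_lebesgue_integral_def)
  finally show "c \<le> bessel_K0 r - bessel_K0 r'" .
qed

text \<open>On the square \<open>[h, 2h] \<times> [0, h]\<close> the horizontal increments of length \<open>h\<close> of the Green function
  are bounded below, so a weak derivative would carry a fixed \<open>L\<^sup>2\<close> mass in arbitrarily small squares.\<close>
lemma green_no_weak_deriv:
  assumes \<kappa>: "\<kappa> > 0"
  shows "\<not> weak_deriv 1 (green \<kappa>) g"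
proof
  assume w: "weak_deriv 1 (green \<kappa>) g"
  then have g: "sq_integrable g" by (simp add: weak_deriv_def)
  note [measurable] = sq_integrableD(1)[OF g]
  obtain c where c: "c > 0"
    "\<And>r r'. 0 < r \<Longrightarrow> r \<le> 1 \<Longrightarrow> (4 / 3) * r \<le> r' \<Longrightarrow> c \<le> bessel_K0 r - bessel_K0 r'"
    using bessel_K0_diff_ge by blast
  define d where "d = (c / (2 * pi))\<^sup>2"
  have d: "d > 0" using c(1) by (simp add: d_def)
  have low: "ennreal d \<le> (\<integral>\<^sup>+x. indicator (square (3 * h)) x * ennreal ((norm (g x))\<^sup>2) \<partial>lborel)"
    if h: "h > 0" "3 * sqrt \<kappa> * h \<le> 1" for h
  proof -
    define v :: "real^2" where "v = h *\<^sub>R axis 1 1"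
    define A where "A = cbox v (v + (\<chi> i. h))"
    have v: "v $ 1 = h" "v $ 2 = 0" by (simp_all add: v_def axis_def)
    have Ax: "h \<le> x $ 1" "x $ 1 \<le> 2 * h" "0 \<le> x $ 2" "x $ 2 \<le> h" if "x \<in> A" for x
      using that v by (auto simp: A_def mem_box_cart forall_2)
    have emA: "emeasure lborel A = ennreal (h\<^sup>2)"
    proof -
      have "emeasure lborel A = (\<integral>\<^sup>+x. indicator A (x + v) \<partial>lborel)"
        by (subst nn_integral_lborel_translate) (auto simp: A_def)
      also have "\<dots> = (\<integral>\<^sup>+x. indicator (square h) x \<partial>lborel)"
        by (intro nn_integral_cong) (auto simp: A_def square_def mem_box_cart indicator_def add.commute)
      finally show ?thesis using h by (simp add: emeasure_square)
    qed
    have diff: "ennreal d \<le> ennreal ((norm (green \<kappa> (x + h *\<^sub>R axis 1 1) - green \<kappa> x))\<^sup>2)" if "x \<in> A" for x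
    proof -
      note x = Ax[OF that]
      define y where "y = x + h *\<^sub>R axis 1 1"
      have y: "y $ 1 = x $ 1 + h" "y $ 2 = x $ 2" by (simp_all add: y_def axis_def)
      \<comment> \<open>On \<open>A\<close> one has
        \<open>(x $ 1)\<^sup>2 \<le> 2 * h * x $ 1\<close> and
        \<open>(x $ 2)\<^sup>2 \<le> h\<^sup>2\<close>, so the step even doubles the squared norm;
        \<open>4 / 3\<close> is a convenient rational below \<open>sqrt 2\<close>.\<close>
      have sq: "((4 / 3) * norm x)\<^sup>2 \<le> (norm y)\<^sup>2"
      proof -
        have "(x $ 1)\<^sup>2 \<le> 2 * (h * x $ 1)"
          using mult_right_mono[of "x $ 1" "2 * h" "x $ 1"] x h by (simp add: power2_eq_square mult.assoc)
        moreover have "(x $ 2)\<^sup>2 \<le> h\<^sup>2" using x by (intro power_mono) auto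
        moreover have "0 \<le> h * x $ 1" using x h by simp
        ultimately have "(16 / 9) * ((x $ 1)\<^sup>2 + (x $ 2)\<^sup>2) \<le> (x $ 1)\<^sup>2 + 2 * (h * x $ 1) + h\<^sup>2 + (x $ 2)\<^sup>2"
          using zero_le_power2[of h] by (simp only: distrib_left)
        also have "\<dots> = (x $ 1 + h)\<^sup>2 + (x $ 2)\<^sup>2" by (simp add: power2_eq_square algebra_simps)
        finally show ?thesis by (simp add: norm_real_2 y power_mult_distrib power_divide)
      qed
      then have ny: "(4 / 3) * norm x \<le> norm y"
        by (rule power2_le_imp_le) simp
      have nx: "norm x > 0"
        using x h by auto
      have "norm x \<le> \<bar>x $ 1\<bar> + \<bar>x $ 2\<bar>"
        using norm_le_l1_cart[of x] by (simp add: UNIV_2)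
      then have "norm x \<le> 3 * h" using x h by simp
      then have "sqrt \<kappa> * norm x \<le> sqrt \<kappa> * (3 * h)" using \<kappa> by (intro mult_left_mono) auto
      then have r1: "sqrt \<kappa> * norm x \<le> 1" using h by (simp add: mult_ac)
      have "c \<le> bessel_K0 (sqrt \<kappa> * norm x) - bessel_K0 (sqrt \<kappa> * norm y)"
        using nx ny r1 \<kappa> mult_left_mono[OF ny, of "sqrt \<kappa>"] by (intro c(2)) (auto simp: mult_ac)
      then have "c / (2 * pi) \<le> 1 / (2 * pi) * (bessel_K0 (sqrt \<kappa> * norm x) - bessel_K0 (sqrt \<kappa> * norm y))"
        by (simp add: divide_right_mono)
      also have "\<dots> \<le> norm (green \<kappa> y - green \<kappa> x)"
      proof -
        define b where "b = 1 / (2 * pi) * (bessel_K0 (sqrt \<kappa> * norm y) - bessel_K0 (sqrt \<kappa> * norm x))"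
        have "green \<kappa> y - green \<kappa> x = complex_of_real b"
          by (simp add: green_def b_def right_diff_distrib diff_divide_distrib)
        then have "norm (green \<kappa> y - green \<kappa> x) = \<bar>b\<bar>"
          by (simp only: norm_of_real)
        moreover have "1 / (2 * pi) * (bessel_K0 (sqrt \<kappa> * norm x) - bessel_K0 (sqrt \<kappa> * norm y)) = - b"
          by (simp add: b_def diff_divide_distrib)
        ultimately show ?thesis using abs_ge_minus_self[of b] by simp
      qed
      finally have "(c / (2 * pi))\<^sup>2 \<le> (norm (green \<kappa> y - green \<kappa> x))\<^sup>2"
        using c(1) by (intro power_mono) auto
      then show ?thesis unfolding d_def y_def by (rule ennreal_leI)
    qed
    \<comment> \<open>The area of \<open>A\<close> on the left and the squared step length on the
      right are both \<open>h\<^sup>2\<close> and cancel. This scale invariance of the Dirichlet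
      integral in dimension two keeps \<open>d\<close> fixed as \<open>h\<close> tends to 0.\<close>
    have "ennreal d * ennreal (h\<^sup>2) = (\<integral>\<^sup>+x. ennreal d * indicator A x \<partial>lborel)"
      using emA by (simp add: nn_integral_cmult_indicator A_def)
    also have "\<dots> \<le> (\<integral>\<^sup>+x. indicator A x * ennreal ((norm (green \<kappa> (x + h *\<^sub>R axis 1 1) - green \<kappa> x))\<^sup>2) \<partial>lborel)"
      using diff by (intro nn_integral_mono) (auto simp: indicator_def)
    also have "\<dots> \<le> ennreal (h\<^sup>2) * (\<integral>\<^sup>+x. indicator (square (3 * h)) x * ennreal ((norm (g x))\<^sup>2) \<partial>lborel)"
    proof (rule nn_integral_difference_le[OF w])
      show "A \<in> sets borel" by (simp add: A_def)
      fix x and t :: real assume x: "x \<in> A" and t: "0 \<le> t" "t \<le> 1"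
      have "0 \<le> t * h" "t * h \<le> h" using t h by (auto simp: mult_left_le_one_le)
      then have "0 \<le> x $ 1 + t * h" "x $ 1 + t * h \<le> 3 * h" "x $ 2 \<le> 3 * h"
        using Ax[OF x] h by linarith+
      then show "x + t *\<^sub>R (h *\<^sub>R axis 1 1) \<in> square (3 * h)"
        using Ax[OF x] by (auto simp: square_def mem_box_cart forall_2 axis_def)
    qed measurable
    finally have le: "ennreal d * ennreal (h\<^sup>2)
        \<le> ennreal (h\<^sup>2) * (\<integral>\<^sup>+x. indicator (square (3 * h)) x * ennreal ((norm (g x))\<^sup>2) \<partial>lborel)" (is "_ \<le> _ * ?I") .
    have one: "ennreal (1 / h\<^sup>2) * ennreal (h\<^sup>2) = 1"
      using h by (simp flip: ennreal_mult)
    have "ennreal d = ennreal (1 / h\<^sup>2) * (ennreal d * ennreal (h\<^sup>2))"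
      by (simp only: mult.left_commute[of _ "ennreal d"] one mult_1_right)
    also have "\<dots> \<le> ennreal (1 / h\<^sup>2) * (ennreal (h\<^sup>2) * ?I)"
      by (rule mult_left_mono[OF le]) simp
    also have "\<dots> = ?I"
      by (simp only: mult.assoc[symmetric] one mult_1)
    finally show ?thesis .
  qed
  define h where "h n = 1 / ((3 * sqrt \<kappa> + 1) * real (Suc n))" for n
  have pos: "0 < (3 * sqrt \<kappa> + 1) * real (Suc n)" for n
  proof (rule mult_pos_pos)
    show "0 < 3 * sqrt \<kappa> + 1" using real_sqrt_ge_zero[of \<kappa>] \<kappa> by linarith
  qed simp
  have h0: "h n > 0" for n
    unfolding h_def by (rule divide_pos_pos[OF zero_less_one pos])
  have h1: "3 * sqrt \<kappa> * h n \<le> 1" for n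
  proof -
    have "3 * sqrt \<kappa> \<le> (3 * sqrt \<kappa> + 1) * 1" by simp
    also have "\<dots> \<le> (3 * sqrt \<kappa> + 1) * real (Suc n)"
      using \<kappa> by (intro mult_left_mono) auto
    finally have "3 * sqrt \<kappa> \<le> (3 * sqrt \<kappa> + 1) * real (Suc n)" .
    then show ?thesis
      using pos[of n] by (simp only: h_def times_divide_eq_right mult_1_right divide_le_eq_1_pos)
  qed
  have hlim: "h \<longlonglongrightarrow> 0"
  proof -
    have "(\<lambda>n. 1 / (3 * sqrt \<kappa> + 1) * (1 / real (Suc n))) \<longlonglongrightarrow> 1 / (3 * sqrt \<kappa> + 1) * 0"
      by (intro tendsto_mult tendsto_const LIMSEQ_Suc[OF lim_1_over_n])
    then show ?thesis by (simp add: h_def[abs_def])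
  qed
  have "(\<lambda>n. \<integral>\<^sup>+x. indicator (square (3 * h n)) x * ennreal ((norm (g x))\<^sup>2) \<partial>lborel) \<longlonglongrightarrow> (\<integral>\<^sup>+x. 0 \<partial>(lborel :: (real^2) measure))"
  proof (rule nn_integral_dominated_convergence[where w = "\<lambda>x. ennreal ((norm (g x))\<^sup>2)"])
    show "(\<integral>\<^sup>+x. ennreal ((norm (g x))\<^sup>2) \<partial>lborel) < \<infinity>"
      using sq_integrable_nn[OF g] by simp
    show "AE x in lborel. (\<lambda>n. indicator (square (3 * h n)) x * ennreal ((norm (g x))\<^sup>2)) \<longlonglongrightarrow> 0"
      using AE_lborel_singleton[of 0]
    proof eventually_elim
      case (elim x)
      then obtain i where i: "x $ i \<noteq> 0" by (auto simp: vec_eq_iff)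
      have lim3: "(\<lambda>n. 3 * h n) \<longlonglongrightarrow> 3 * 0" by (intro tendsto_mult tendsto_const hlim)
      have "\<forall>\<^sub>F n in sequentially. 3 * h n < \<bar>x $ i\<bar>"
        by (rule order_tendstoD(2)[OF lim3]) (use i in simp)
      then have "\<forall>\<^sub>F n in sequentially. indicator (square (3 * h n)) x * ennreal ((norm (g x))\<^sup>2) = 0"
      proof eventually_elim
        case (elim n)
        have "x \<notin> square (3 * h n)"
        proof
          assume "x \<in> square (3 * h n)"
          then have "0 \<le> x $ i \<and> x $ i \<le> 3 * h n" by (auto simp: square_def mem_box_cart)
          then show False using elim by simp
        qed
        then show ?case by simp
      qed
      then show ?case by (rule tendsto_eventually)
    qed
  qed (auto simp: indicator_def)
  then have "(\<lambda>n. \<integral>\<^sup>+x. indicator (square (3 * h n)) x * ennreal ((norm (g x))\<^sup>2) \<partial>lborel) \<longlonglongrightarrow> 0"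
    by simp
  then have "ennreal d \<le> 0"
    by (rule tendsto_lowerbound) (use low[OF h0 h1] in auto)
  then show False using d by simp
qed

subsection \<open>The energy space\<close>

type_synonym jet = "(real^2, complex \<times> complex \<times> complex) l2"

text \<open>A function \<open>f \<in> H\<^sup>1\<close> is represented by the class of \<open>(\<surd>\<kappa> f, \<partial>\<^sub>1 f, \<partial>\<^sub>2 f)\<close>, so that the \<open>L\<^sup>2\<close> norm
  is the \<open>\<kappa>\<close>-dependent Sobolev norm.\<close>
definition jfun :: "real \<Rightarrow> jet \<Rightarrow> real^2 \<Rightarrow> complex" where
  "jfun \<kappa> F x = (1 / sqrt \<kappa>) *\<^sub>R fst (rep_l2 F x)"

definition jd1 :: "jet \<Rightarrow> real^2 \<Rightarrow> complex" where
  "jd1 F x = fst (snd (rep_l2 F x))"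

definition jd2 :: "jet \<Rightarrow> real^2 \<Rightarrow> complex" where
  "jd2 F x = snd (snd (rep_l2 F x))"

definition jets :: "real \<Rightarrow> jet set" where
  "jets \<kappa> = {F. weak_deriv 1 (jfun \<kappa> F) (jd1 F) \<and> weak_deriv 2 (jfun \<kappa> F) (jd2 F)}"

lemma jet_measurable [measurable]:
  "jfun \<kappa> F \<in> borel_measurable borel" "jd1 F \<in> borel_measurable borel" "jd2 F \<in> borel_measurable borel"
proof -
  have [measurable]: "(\<lambda>x. fst (rep_l2 F x)) \<in> borel_measurable borel"
      "(\<lambda>x. fst (snd (rep_l2 F x))) \<in> borel_measurable borel"
      "(\<lambda>x. snd (snd (rep_l2 F x))) \<in> borel_measurable borel"
    by (auto intro!: borel_measurable_continuous_on[where g = "rep_l2 F"] continuous_intros borel_measurable_rep_l2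
      simp del: borel_measurable_rep_l2)
  show "jfun \<kappa> F \<in> borel_measurable borel" "jd1 F \<in> borel_measurable borel" "jd2 F \<in> borel_measurable borel"
    unfolding jfun_def[abs_def] jd1_def[abs_def] jd2_def[abs_def] by measurable
qed

lemma norm_triple:
  fixes a b c :: complex
  shows "(norm (a, b, c))\<^sup>2 = (norm a)\<^sup>2 + (norm b)\<^sup>2 + (norm c)\<^sup>2"
  by (simp add: norm_Pair)

lemma sq_integrable_jet:
  "sq_integrable (jfun \<kappa> F)" "sq_integrable (jd1 F)" "sq_integrable (jd2 F)"
proof -
  have n: "norm (fst y) \<le> norm y" "norm (fst (snd y)) \<le> norm y" "norm (snd (snd y)) \<le> norm y"
    for y :: "complex \<times> complex \<times> complex"
    by (cases y; rule power2_le_imp_le; simp add: norm_triple)+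
  show "sq_integrable (jfun \<kappa> F)"
    by (rule sq_integrable_bound[OF sq_integrable_rep_l2[of F], where C = "\<bar>1 / sqrt \<kappa>\<bar>"])
      (use n in \<open>auto simp: jfun_def divide_right_mono\<close>)
  show "sq_integrable (jd1 F)" "sq_integrable (jd2 F)"
    by (rule sq_integrable_bound[OF sq_integrable_rep_l2[of F], where C = 1]; use n in \<open>auto simp: jd1_def jd2_def\<close>)+
qed

lemma jet_norm:
  assumes "\<kappa> > 0"
  shows "(norm F)\<^sup>2 = \<kappa> * (LINT x|lborel. (norm (jfun \<kappa> F x))\<^sup>2)
    + (LINT x|lborel. (norm (jd1 F x))\<^sup>2) + (LINT x|lborel. (norm (jd2 F x))\<^sup>2)"
proof -
  have "(norm (rep_l2 F x))\<^sup>2 = \<kappa> * (norm (jfun \<kappa> F x))\<^sup>2 + (norm (jd1 F x))\<^sup>2 + (norm (jd2 F x))\<^sup>2" for x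
  proof -
    have "(norm (rep_l2 F x))\<^sup>2 = (norm (fst (rep_l2 F x)))\<^sup>2 + (norm (jd1 F x))\<^sup>2 + (norm (jd2 F x))\<^sup>2"
      using norm_triple[of "fst (rep_l2 F x)" "jd1 F x" "jd2 F x"] by (simp add: jd1_def jd2_def)
    then show ?thesis
      using assms by (simp add: jfun_def power_divide)
  qed
  then have "(norm F)\<^sup>2 = (LINT x|lborel. \<kappa> * (norm (jfun \<kappa> F x))\<^sup>2 + (norm (jd1 F x))\<^sup>2 + (norm (jd2 F x))\<^sup>2)"
    by (simp add: norm_l2_sq)
  also have "\<dots> = \<kappa> * (LINT x|lborel. (norm (jfun \<kappa> F x))\<^sup>2)
    + (LINT x|lborel. (norm (jd1 F x))\<^sup>2) + (LINT x|lborel. (norm (jd2 F x))\<^sup>2)"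
    using sq_integrable_jet(1)[of \<kappa> F, THEN sq_integrableD(3)] sq_integrable_jet(2,3)[of F, THEN sq_integrableD(3)]
    by simp
  finally show ?thesis .
qed

text \<open>The inner product with this jet is the \<open>e\<close>-component of the defect in the
  weak derivative identity. The division by \<open>sqrt \<kappa>\<close> undoes the weight on the
  first component of a jet.\<close>

definition test_jet :: "real \<Rightarrow> 2 \<Rightarrow> (real^2 \<Rightarrow> real) \<Rightarrow> complex \<Rightarrow> jet" where
  "test_jet \<kappa> i \<phi> e = abs_l2 (\<lambda>x. ((frechet_derivative \<phi> (at x) (axis i 1) / sqrt \<kappa>) *\<^sub>R e,
     (if i = 1 then \<phi> x *\<^sub>R e else 0), (if i = 1 then 0 else \<phi> x *\<^sub>R e)))"

lemma sq_integrable_scale_vec: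
  fixes e :: "'b::euclidean_space" and \<psi> :: "'a::euclidean_space \<Rightarrow> real"
  assumes "sq_integrable \<psi>"
  shows "sq_integrable (\<lambda>x. \<psi> x *\<^sub>R e)"
  by (rule sq_integrable_bound[OF assms, where C = "norm e"])
    (use sq_integrableD(1)[OF assms] in \<open>auto simp: mult.commute\<close>)

lemma sq_integrable_Pair:
  fixes f :: "'a::euclidean_space \<Rightarrow> 'b::euclidean_space" and g :: "'a \<Rightarrow> 'c::euclidean_space"
  assumes f: "sq_integrable f" and g: "sq_integrable g"
  shows "sq_integrable (\<lambda>x. (f x, g x))"
proof -
  note [measurable] = sq_integrableD(1)[OF f] sq_integrableD(1)[OF g]
  show ?thesis
    unfolding sq_integrable_def norm_Pair
    using Bochner_Integration.integrable_add[OF sq_integrableD(3)[OF f] sq_integrableD(3)[OF g]]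
    by (auto simp: borel_measurable_Pair)
qed

lemma complex_inner_zero_iff: "z = 0 \<longleftrightarrow> z \<bullet> 1 = 0 \<and> z \<bullet> \<i> = 0" for z :: complex
  by (simp add: inner_complex_def complex_eq_iff)

lemma inner_test_jet:
  fixes F :: jet
  assumes \<kappa>: "\<kappa> > 0" and \<phi>: "test_function \<phi>"
  shows "F \<bullet> test_jet \<kappa> i \<phi> e = ((LINT x|lborel. frechet_derivative \<phi> (at x) (axis i 1) *\<^sub>R jfun \<kappa> F x)
    + (LINT x|lborel. \<phi> x *\<^sub>R (if i = 1 then jd1 F x else jd2 F x))) \<bullet> e"
proof -
  define d where "d x = frechet_derivative \<phi> (at x) (axis i 1)" for x
  have d: "sq_integrable d"
    unfolding d_def[abs_def] by (rule test_function_sq_integrable[OF test_function_frechet[OF \<phi>]])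
  have p: "sq_integrable \<phi>" by (rule test_function_sq_integrable[OF \<phi>])
  define G where "G x = (if i = 1 then jd1 F x else jd2 F x)" for x
  have G: "sq_integrable G" unfolding G_def using sq_integrable_jet by (cases "i = 1") (auto simp: eta_contract_eq)
  have sq: "sq_integrable (\<lambda>x. ((d x / sqrt \<kappa>) *\<^sub>R e, (if i = 1 then \<phi> x *\<^sub>R e else 0), (if i = 1 then 0 else \<phi> x *\<^sub>R e)))"
  proof (intro sq_integrable_Pair)
    show "sq_integrable (\<lambda>x. (d x / sqrt \<kappa>) *\<^sub>R e)"
      using sq_integrable_scaleR[OF sq_integrable_scale_vec[OF d, of e], of "1 / sqrt \<kappa>"] by simp
    show "sq_integrable (\<lambda>x. if i = 1 then \<phi> x *\<^sub>R e else 0)" "sq_integrable (\<lambda>x. if i = 1 then 0 else \<phi> x *\<^sub>R e)"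
      using sq_integrable_scale_vec[OF p, of e] by (cases "i = 1"; simp)+
  qed
  have I1: "integrable lborel (\<lambda>x. d x *\<^sub>R jfun \<kappa> F x)" and I2: "integrable lborel (\<lambda>x. \<phi> x *\<^sub>R G x)"
    by (intro sq_integrable_scaleR_integrable(1) d p G sq_integrable_jet)+
  have "F \<bullet> test_jet \<kappa> i \<phi> e
      = (LINT x|lborel. rep_l2 F x \<bullet> ((d x / sqrt \<kappa>) *\<^sub>R e, (if i = 1 then \<phi> x *\<^sub>R e else 0), (if i = 1 then 0 else \<phi> x *\<^sub>R e)))"
    unfolding test_jet_def d_def[symmetric] by (rule inner_rep_abs_l2[OF sq])
  also have "\<dots> = (LINT x|lborel. (d x *\<^sub>R jfun \<kappa> F x + \<phi> x *\<^sub>R G x) \<bullet> e)"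
    by (rule Bochner_Integration.integral_cong)
      (auto simp: inner_prod_def jfun_def G_def jd1_def jd2_def inner_add_left)
  also have "\<dots> = (LINT x|lborel. d x *\<^sub>R jfun \<kappa> F x + \<phi> x *\<^sub>R G x) \<bullet> e"
    by (rule integral_inner_left) (use I1 I2 in auto)
  also have "\<dots> = ((LINT x|lborel. d x *\<^sub>R jfun \<kappa> F x) + (LINT x|lborel. \<phi> x *\<^sub>R G x)) \<bullet> e"
    using I1 I2 by simp
  finally show ?thesis by (simp add: d_def G_def)
qed

text \<open>The jets form an orthogonal complement, hence a weakly closed subspace.\<close>
lemma jets_eq:
  assumes "\<kappa> > 0"
  shows "jets \<kappa> = {F. \<forall>\<phi> e i. test_function \<phi> \<longrightarrow> F \<bullet> test_jet \<kappa> i \<phi> e = 0}"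
proof -
  have w: "weak_deriv i (jfun \<kappa> F) (\<lambda>x. if i = 1 then jd1 F x else jd2 F x)
      \<longleftrightarrow> (\<forall>\<phi> e. test_function \<phi> \<longrightarrow> F \<bullet> test_jet \<kappa> i \<phi> e = 0)" for i and F :: jet
  proof -
    have "sq_integrable (\<lambda>x. if i = 1 then jd1 F x else jd2 F x)"
      using sq_integrable_jet by (cases "i = 1") (auto simp: eta_contract_eq)
    then have "weak_deriv i (jfun \<kappa> F) (\<lambda>x. if i = 1 then jd1 F x else jd2 F x) \<longleftrightarrow>
        (\<forall>\<phi>. test_function \<phi> \<longrightarrow> (LINT x|lborel. frechet_derivative \<phi> (at x) (axis i 1) *\<^sub>R jfun \<kappa> F x)
          + (LINT x|lborel. \<phi> x *\<^sub>R (if i = 1 then jd1 F x else jd2 F x)) = 0)"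
      by (simp add: weak_deriv_def sq_integrable_jet eq_neg_iff_add_eq_0)
    then show ?thesis
      using complex_inner_zero_iff by (auto simp: inner_test_jet[OF assms] simp del: complex_inner_1_right complex_inner_i_right)
  qed
  have "F \<in> jets \<kappa> \<longleftrightarrow> (\<forall>i. weak_deriv i (jfun \<kappa> F) (\<lambda>x. if i = 1 then jd1 F x else jd2 F x))" for F
    by (simp add: jets_def forall_2 eta_contract_eq)
  then show ?thesis
    by (auto simp: w)
qed

lemma jets_add: "\<kappa> > 0 \<Longrightarrow> F \<in> jets \<kappa> \<Longrightarrow> G \<in> jets \<kappa> \<Longrightarrow> F + G \<in> jets \<kappa>"
  and jets_diff: "\<kappa> > 0 \<Longrightarrow> F \<in> jets \<kappa> \<Longrightarrow> G \<in> jets \<kappa> \<Longrightarrow> F - G \<in> jets \<kappa>"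
  and jets_scaleR: "\<kappa> > 0 \<Longrightarrow> F \<in> jets \<kappa> \<Longrightarrow> r *\<^sub>R F \<in> jets \<kappa>"
  and jets_zero: "\<kappa> > 0 \<Longrightarrow> 0 \<in> jets \<kappa>"
  by (auto simp: jets_eq inner_add_left inner_diff_left)

lemma jets_weak_closed:
  assumes "\<kappa> > 0" "\<And>n. F n \<in> jets \<kappa>" "weak_conv F L"
  shows "L \<in> jets \<kappa>"
  unfolding jets_eq[OF assms(1)]
proof (intro CollectI allI impI)
  fix \<phi> e i assume \<phi>: "test_function \<phi>"
  have "(\<lambda>n. F n \<bullet> test_jet \<kappa> i \<phi> e) \<longlonglongrightarrow> L \<bullet> test_jet \<kappa> i \<phi> e"
    using assms(3) by (simp add: weak_conv_def)
  moreover have "F n \<bullet> test_jet \<kappa> i \<phi> e = 0" for n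
    using assms(2)[of n] \<phi> by (auto simp: jets_eq[OF assms(1)])
  ultimately show "L \<bullet> test_jet \<kappa> i \<phi> e = 0"
    by (simp add: LIMSEQ_const_iff)
qed

lemma AE_jfun_simps:
  shows AE_jfun_add: "AE x in lborel. jfun \<kappa> (F + G) x = jfun \<kappa> F x + jfun \<kappa> G x"
    and AE_jfun_scaleR: "AE x in lborel. jfun \<kappa> (r *\<^sub>R F) x = r *\<^sub>R jfun \<kappa> F x"
proof -
  show "AE x in lborel. jfun \<kappa> (F + G) x = jfun \<kappa> F x + jfun \<kappa> G x"
    using AE_rep_l2_plus[of F G] by eventually_elim (simp add: jfun_def scaleR_add_right)
  show "AE x in lborel. jfun \<kappa> (r *\<^sub>R F) x = r *\<^sub>R jfun \<kappa> F x"
    using AE_rep_l2_scaleR[of r F] by eventually_elim (simp add: jfun_def)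
qed

lemma weak_deriv_scaleR:
  assumes "weak_deriv i f g"
  shows "weak_deriv i (\<lambda>x. r *\<^sub>R f x) (\<lambda>x. r *\<^sub>R g x)"
proof -
  have "(LINT x|lborel. frechet_derivative \<phi> (at x) (axis i 1) *\<^sub>R r *\<^sub>R f x) = - (LINT x|lborel. \<phi> x *\<^sub>R r *\<^sub>R g x)"
    if "test_function \<phi>" for \<phi>
  proof -
    have "r *\<^sub>R (LINT x|lborel. frechet_derivative \<phi> (at x) (axis i 1) *\<^sub>R f x) = r *\<^sub>R (- (LINT x|lborel. \<phi> x *\<^sub>R g x))"
      using assms that by (simp add: weak_deriv_def)
    then show ?thesis
      by (simp add: scaleR_left_commute[of _ r] del: scaleR_scaleR)
  qed
  then show ?thesis
    using assms by (simp add: weak_deriv_def sq_integrable_scaleR del: scaleR_scaleR)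
qed

text \<open>The factor that takes functions from the unit ball of the
  \<open>\<kappa>\<close>-dependent norm into the standard Sobolev unit ball.\<close>

definition jscale :: "real \<Rightarrow> real" where
  "jscale \<kappa> = min 1 (sqrt \<kappa>)"

lemma jscale: "\<kappa> > 0 \<Longrightarrow> 0 < jscale \<kappa>" "jscale \<kappa> \<le> 1" "\<kappa> > 0 \<Longrightarrow> (jscale \<kappa>)\<^sup>2 \<le> \<kappa>"
proof -
  show "\<kappa> > 0 \<Longrightarrow> 0 < jscale \<kappa>" "jscale \<kappa> \<le> 1" by (auto simp: jscale_def)
  assume k: "\<kappa> > 0"
  have "(jscale \<kappa>)\<^sup>2 \<le> (sqrt \<kappa>)\<^sup>2"
    using k by (intro power_mono) (auto simp: jscale_def)
  then show "(jscale \<kappa>)\<^sup>2 \<le> \<kappa>" using k by simp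
qed

lemma unit_sobolev_jfun:
  assumes \<kappa>: "\<kappa> > 0" and F: "F \<in> jets \<kappa>" and n: "norm F \<le> 1"
  shows "unit_sobolev (\<lambda>x. jscale \<kappa> *\<^sub>R jfun \<kappa> F x)"
proof -
  define m where "m = jscale \<kappa>"
  have m: "0 < m" "m\<^sup>2 \<le> 1" "m\<^sup>2 \<le> \<kappa>"
    using jscale[of \<kappa>] \<kappa> by (auto simp: m_def power_le_one)
  have I: "(\<integral>\<^sup>+x. nsq (m *\<^sub>R f x) \<partial>lborel) = ennreal (m\<^sup>2 * (LINT x|lborel. (norm (f x))\<^sup>2))"
    if "sq_integrable f" for f :: "real^2 \<Rightarrow> complex"
    using sq_integrable_nn[OF sq_integrable_scaleR[OF that, of m]]
    by (simp add: nsq_def power_mult_distrib)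
  have "(\<integral>\<^sup>+x. nsq (m *\<^sub>R jfun \<kappa> F x) \<partial>lborel) + (\<integral>\<^sup>+x. nsq (m *\<^sub>R jd1 F x) \<partial>lborel) + (\<integral>\<^sup>+x. nsq (m *\<^sub>R jd2 F x) \<partial>lborel)
      = ennreal (m\<^sup>2 * (LINT x|lborel. (norm (jfun \<kappa> F x))\<^sup>2) + m\<^sup>2 * (LINT x|lborel. (norm (jd1 F x))\<^sup>2)
        + m\<^sup>2 * (LINT x|lborel. (norm (jd2 F x))\<^sup>2))"
    by (simp add: I sq_integrable_jet)
  also have "\<dots> \<le> ennreal ((norm F)\<^sup>2)"
    unfolding jet_norm[OF \<kappa>] using m
    by (intro ennreal_leI add_mono mult_right_mono mult_left_le_one_le) auto
  also have "\<dots> \<le> 1"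
    using n by (simp add: power_le_one)
  finally show ?thesis
    using F weak_deriv_scaleR[of _ "jfun \<kappa> F" _ m] unfolding unit_sobolev_def jets_def m_def by blast
qed

lemma nn_integral_powr_scaleR:
  fixes f :: "real^2 \<Rightarrow> complex"
  assumes [measurable]: "f \<in> borel_measurable borel"
  shows "(\<integral>\<^sup>+x. ennreal (norm (r *\<^sub>R f x) powr q) \<partial>lborel) = ennreal (\<bar>r\<bar> powr q) * (\<integral>\<^sup>+x. ennreal (norm (f x) powr q) \<partial>lborel)"
  by (simp add: powr_mult ennreal_mult nn_integral_cmult)

lemma jet_sobolev:
  assumes \<kappa>: "\<kappa> > 0" and q: "q \<ge> 2"
  obtains C where "C \<ge> 1" "\<And>F. F \<in> jets \<kappa> \<Longrightarrow> norm F \<le> 1 \<Longrightarrow>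
    (\<integral>\<^sup>+x. ennreal (norm (jfun \<kappa> F x) powr q) \<partial>lborel) \<le> ennreal C"
proof -
  obtain C where C: "C \<ge> 1"
    "\<And>f. unit_sobolev f \<Longrightarrow> (\<integral>\<^sup>+x. ennreal (norm (f x) powr q) \<partial>lborel) \<le> ennreal C"
    using sobolev_embedding[OF q] by blast
  define m where "m = jscale \<kappa>"
  have m: "m > 0" "m \<le> 1" using jscale[of \<kappa>] \<kappa> by (auto simp: m_def)
  show thesis
  proof (rule that[of "(1 / m) powr q * C"])
    have "1 \<le> (1 / m) powr q" using m q by (intro ge_one_powr_ge_zero) auto
    then show "1 \<le> (1 / m) powr q * C" using C(1) mult_mono[of 1 "(1 / m) powr q" 1 C] by simp
    fix F assume F: "F \<in> jets \<kappa>" "norm F \<le> 1"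
    have "(\<integral>\<^sup>+x. ennreal (norm (jfun \<kappa> F x) powr q) \<partial>lborel)
        = (\<integral>\<^sup>+x. ennreal (norm ((1 / m) *\<^sub>R (m *\<^sub>R jfun \<kappa> F x)) powr q) \<partial>lborel)"
      using m by simp
    also have "\<dots> = ennreal (\<bar>1 / m\<bar> powr q) * (\<integral>\<^sup>+x. ennreal (norm (m *\<^sub>R jfun \<kappa> F x) powr q) \<partial>lborel)"
      by (rule nn_integral_powr_scaleR) measurable
    also have "\<dots> \<le> ennreal (\<bar>1 / m\<bar> powr q) * ennreal C"
      unfolding m_def by (intro mult_left_mono C(2) unit_sobolev_jfun \<kappa> F) auto
    also have "\<dots> = ennreal ((1 / m) powr q * C)"
      using m C(1) by (simp add: ennreal_mult)
    finally show "(\<integral>\<^sup>+x. ennreal (norm (jfun \<kappa> F x) powr q) \<partial>lborel) \<le> ennreal ((1 / m) powr q * C)" .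
  qed
qed

lemma avg_scaleR:
  assumes [measurable]: "f \<in> borel_measurable borel"
  shows "avg h (\<lambda>x. r *\<^sub>R f x) x = ennreal (r\<^sup>2) * avg h f x"
proof -
  have "(\<integral>\<^sup>+z. indicator (square h) z * nsq (r *\<^sub>R f (x + z)) \<partial>lborel)
      = (\<integral>\<^sup>+z. ennreal (r\<^sup>2) * (indicator (square h) z * nsq (f (x + z))) \<partial>lborel)"
    by (intro nn_integral_cong) (auto simp: nsq_def power_mult_distrib ennreal_mult indicator_def)
  also have "\<dots> = ennreal (r\<^sup>2) * (\<integral>\<^sup>+z. indicator (square h) z * nsq (f (x + z)) \<partial>lborel)"
    by (rule nn_integral_cmult) measurable
  finally show ?thesis
    unfolding avg_def by (simp only: mult.left_commute)
qed

lemma jet_vanishing: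
  assumes \<kappa>: "\<kappa> > 0" and q: "q > 2" and \<delta>: "\<delta> > 0"
  obtains \<mu> where "\<mu> > 0" "\<And>F. F \<in> jets \<kappa> \<Longrightarrow> norm F \<le> 1 \<Longrightarrow> (\<And>x. avg 1 (jfun \<kappa> F) x \<le> ennreal \<mu>) \<Longrightarrow>
    (\<integral>\<^sup>+x. ennreal (norm (jfun \<kappa> F x) powr q) \<partial>lborel) \<le> ennreal \<delta>"
proof -
  define m where "m = jscale \<kappa>"
  have m: "m > 0" "m \<le> 1" using jscale[of \<kappa>] \<kappa> by (auto simp: m_def)
  \<comment> \<open>Undoing the rescaling by \<open>m\<close> costs \<open>(1 / m) powr q\<close>,
    so vanishing is required at this smaller threshold.\<close>
  have "\<delta> * m powr q > 0" using \<delta> m by simp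
  then obtain \<mu> where \<mu>: "\<mu> > 0"
    "\<And>f. unit_sobolev f \<Longrightarrow> (\<And>x. avg 1 f x \<le> ennreal \<mu>) \<Longrightarrow> (\<integral>\<^sup>+x. ennreal (norm (f x) powr q) \<partial>lborel) \<le> ennreal (\<delta> * m powr q)"
    using vanishing[OF q] by blast
  show thesis
  proof (rule that[OF \<mu>(1)])
    fix F assume F: "F \<in> jets \<kappa>" "norm F \<le> 1" and a: "\<And>x. avg 1 (jfun \<kappa> F) x \<le> ennreal \<mu>"
    have "avg 1 (\<lambda>x. m *\<^sub>R jfun \<kappa> F x) x \<le> ennreal \<mu>" for x
    proof -
      have "avg 1 (\<lambda>x. m *\<^sub>R jfun \<kappa> F x) x = ennreal (m\<^sup>2) * avg 1 (jfun \<kappa> F) x"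
        by (rule avg_scaleR) measurable
      also have "\<dots> \<le> 1 * ennreal \<mu>"
        using m by (intro mult_mono a) (auto simp: power_le_one)
      finally show ?thesis by simp
    qed
    then have *: "(\<integral>\<^sup>+x. ennreal (norm (m *\<^sub>R jfun \<kappa> F x) powr q) \<partial>lborel) \<le> ennreal (\<delta> * m powr q)"
      unfolding m_def using unit_sobolev_jfun[OF \<kappa> F] by (intro \<mu>(2)[unfolded m_def])
    have "(\<integral>\<^sup>+x. ennreal (norm (jfun \<kappa> F x) powr q) \<partial>lborel)
        = (\<integral>\<^sup>+x. ennreal (norm ((1 / m) *\<^sub>R (m *\<^sub>R jfun \<kappa> F x)) powr q) \<partial>lborel)"
      using m by simp
    also have "\<dots> = ennreal (\<bar>1 / m\<bar> powr q) * (\<integral>\<^sup>+x. ennreal (norm (m *\<^sub>R jfun \<kappa> F x) powr q) \<partial>lborel)"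
      by (rule nn_integral_powr_scaleR) measurable
    also have "\<dots> \<le> ennreal (\<bar>1 / m\<bar> powr q) * ennreal (\<delta> * m powr q)"
      by (intro mult_left_mono *) simp
    also have "\<dots> = ennreal (\<bar>1 / m\<bar> powr q * (\<delta> * m powr q))"
      using \<delta> by (intro ennreal_mult[symmetric]) auto
    also have "\<bar>1 / m\<bar> powr q * (\<delta> * m powr q) = \<delta>"
      using m by (simp add: powr_divide)
    finally show "(\<integral>\<^sup>+x. ennreal (norm (jfun \<kappa> F x) powr q) \<partial>lborel) \<le> ennreal \<delta>" .
  qed
qed

text \<open>A component of the mean over a square is the inner product with one fixed jet, a
  multiple of the indicator of the translated square in the first slot.\<close>

lemma mean_jfun_weak:
  assumes \<kappa>: "\<kappa> > 0" and F: "weak_conv F 0"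
  shows "(\<lambda>n. mean h (jfun \<kappa> (F n)) x) \<longlonglongrightarrow> 0"
proof -
  have "(\<lambda>n. mean h (jfun \<kappa> (F n)) x \<bullet> e) \<longlonglongrightarrow> 0" for e
  proof -
    define \<psi> where "\<psi> y = (indicator (square h) (y - x) / sqrt \<kappa> :: real)" for y
    have "sq_integrable (\<lambda>y. indicator (square h) (y + - x) :: real)"
      unfolding square_def by (rule sq_integrable_translate[OF sq_integrable_indicator_cbox])
    from sq_integrable_scaleR[OF this, of "1 / sqrt \<kappa>"]
    have \<psi>: "sq_integrable \<psi>" by (simp add: \<psi>_def[abs_def])
    have sq: "sq_integrable (\<lambda>y. (\<psi> y *\<^sub>R e, 0 :: complex, 0 :: complex))"
      using sq_integrable_scale_vec[OF \<psi>, of e] by (intro sq_integrable_Pair) auto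
    have "mean h (jfun \<kappa> G) x \<bullet> e = G \<bullet> abs_l2 (\<lambda>y. (\<psi> y *\<^sub>R e, 0, 0))" for G
    proof -
      have "mean h (jfun \<kappa> G) x \<bullet> e = (LINT z|lborel. (indicator (square h) z *\<^sub>R jfun \<kappa> G (x + z)) \<bullet> e)"
        unfolding mean_def by (rule integral_inner_left[symmetric]) (intro impI integrable_square sq_integrable_jet)
      also have "\<dots> = (LINT z|lborel. rep_l2 G (z + x) \<bullet> (\<psi> (z + x) *\<^sub>R e, 0, 0))"
        by (rule Bochner_Integration.integral_cong) (auto simp: jfun_def \<psi>_def inner_prod_def add.commute)
      also have "\<dots> = (LINT y|lborel. rep_l2 G y \<bullet> (\<psi> y *\<^sub>R e, 0, 0))"
        by (rule integral_lborel_translate(1)) (use sq_integrableD(1)[OF sq] in measurable)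
      also have "\<dots> = G \<bullet> abs_l2 (\<lambda>y. (\<psi> y *\<^sub>R e, 0, 0))"
        by (rule inner_rep_abs_l2[OF sq, symmetric])
      finally show ?thesis .
    qed
    then show ?thesis
      using F by (simp add: weak_conv_def)
  qed
  from this[of 1] this[of \<i>]
  have "(\<lambda>n. Re (mean h (jfun \<kappa> (F n)) x)) \<longlonglongrightarrow> Re 0" "(\<lambda>n. Im (mean h (jfun \<kappa> (F n)) x)) \<longlonglongrightarrow> Im 0"
    by simp_all
  then show ?thesis
    by (simp only: tendsto_complex_iff)
qed

lemma jet_local_compactness:
  fixes F :: "nat \<Rightarrow> jet"
  assumes \<kappa>: "\<kappa> > 0" and F: "\<And>n. F n \<in> jets \<kappa>" "\<And>n. norm (F n) \<le> 1" and wk: "weak_conv F 0"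
    and w [measurable]: "w \<in> borel_measurable borel" and w1: "\<And>x. w x \<le> 1"
    and wint: "(\<integral>\<^sup>+x. w x \<partial>lborel) < \<infinity>"
  shows "(\<lambda>n. \<integral>\<^sup>+x. w x * nsq (jfun \<kappa> (F n) x) \<partial>lborel) \<longlonglongrightarrow> 0"
proof -
  define m where "m = jscale \<kappa>"
  have m: "m > 0" using jscale[of \<kappa>] \<kappa> by (auto simp: m_def)
  have "(\<lambda>n. \<integral>\<^sup>+x. w x * nsq (m *\<^sub>R jfun \<kappa> (F n) x) \<partial>lborel) \<longlonglongrightarrow> 0"
  proof (rule local_compactness[OF _ _ w w1 wint])
    show "unit_sobolev (\<lambda>x. m *\<^sub>R jfun \<kappa> (F n) x)" for n
      unfolding m_def by (intro unit_sobolev_jfun \<kappa> F)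
    have "mean h (\<lambda>x. m *\<^sub>R jfun \<kappa> (F n) x) x = m *\<^sub>R mean h (jfun \<kappa> (F n)) x" for h n x
      unfolding mean_def by (simp add: mult.commute flip: integral_scaleR_right)
    moreover have "(\<lambda>n. m *\<^sub>R mean h (jfun \<kappa> (F n)) x) \<longlonglongrightarrow> m *\<^sub>R 0" for h x
      by (intro tendsto_scaleR tendsto_const mean_jfun_weak \<kappa> wk)
    ultimately show "(\<lambda>n. mean h (\<lambda>x. m *\<^sub>R jfun \<kappa> (F n) x) x) \<longlonglongrightarrow> 0" for h x
      by simp
  qed
  then have "(\<lambda>n. ennreal (1 / m\<^sup>2) * (\<integral>\<^sup>+x. w x * nsq (m *\<^sub>R jfun \<kappa> (F n) x) \<partial>lborel)) \<longlonglongrightarrow> ennreal (1 / m\<^sup>2) * 0"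
    by (intro ennreal_tendsto_cmult) auto
  moreover have "ennreal (1 / m\<^sup>2) * (\<integral>\<^sup>+x. w x * nsq (m *\<^sub>R jfun \<kappa> (F n) x) \<partial>lborel)
      = (\<integral>\<^sup>+x. w x * nsq (jfun \<kappa> (F n) x) \<partial>lborel)" for n
  proof -
    have "ennreal (1 / m\<^sup>2) * (\<integral>\<^sup>+x. w x * nsq (m *\<^sub>R jfun \<kappa> (F n) x) \<partial>lborel)
        = (\<integral>\<^sup>+x. ennreal (1 / m\<^sup>2) * (w x * nsq (m *\<^sub>R jfun \<kappa> (F n) x)) \<partial>lborel)"
      by (rule nn_integral_cmult[symmetric]) measurable
    also have "\<dots> = (\<integral>\<^sup>+x. w x * nsq (jfun \<kappa> (F n) x) \<partial>lborel)"
      using m by (intro nn_integral_cong) (simp add: nsq_def power_mult_distrib mult.left_commute[of "ennreal (1 / m\<^sup>2)"]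
          flip: ennreal_mult)
    finally show ?thesis .
  qed
  ultimately show ?thesis by simp
qed

definition jet_translate :: "real^2 \<Rightarrow> jet \<Rightarrow> jet" where
  "jet_translate z F = abs_l2 (\<lambda>x. rep_l2 F (x + z))"

lemma AE_jfun_translate: "AE x in lborel. jfun \<kappa> (jet_translate z F) x = jfun \<kappa> F (x + z)"
  using AE_rep_abs_l2[OF sq_integrable_translate[OF sq_integrable_rep_l2[of F]], of z]
  by (auto elim!: eventually_mono simp: jet_translate_def jfun_def)

lemma norm_jet_translate: "norm (jet_translate z F) = norm F"
proof -
  have "(norm (jet_translate z F))\<^sup>2 = (LINT x|lborel. (norm (rep_l2 F (x + z)))\<^sup>2)"
    unfolding jet_translate_def by (intro norm_abs_l2_sq sq_integrable_translate sq_integrable_rep_l2)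
  also have "\<dots> = (norm F)\<^sup>2"
    unfolding norm_l2_sq by (rule integral_lborel_translate(1)) measurable
  finally show ?thesis by (simp add: power2_eq_iff_nonneg)
qed

text \<open>Translating the jet amounts to translating the test function the other way, so
  orthogonality to all test jets is preserved.\<close>

lemma jets_translate:
  assumes \<kappa>: "\<kappa> > 0" and F: "F \<in> jets \<kappa>"
  shows "jet_translate z F \<in> jets \<kappa>"
  unfolding jets_eq[OF \<kappa>]
proof (intro CollectI allI impI)
  fix \<phi> and e :: complex and i assume \<phi>: "test_function \<phi>"
  define \<phi>' where "\<phi>' x = \<phi> (x + - z)" for x
  have \<phi>': "test_function \<phi>'" and d: "\<And>x. frechet_derivative \<phi>' (at x) = frechet_derivative \<phi> (at (x + - z))"
    using test_function_translate[OF \<phi>, of "- z"] by (auto simp: \<phi>'_def[abs_def])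
  define T where "T x = ((frechet_derivative \<phi> (at x) (axis i 1) / sqrt \<kappa>) *\<^sub>R e,
     (if i = 1 then \<phi> x *\<^sub>R e else 0), (if i = 1 then 0 else \<phi> x *\<^sub>R e))" for x
  have sqT: "sq_integrable T"
    unfolding T_def
  proof (intro sq_integrable_Pair)
    show "sq_integrable (\<lambda>x. (frechet_derivative \<phi> (at x) (axis i 1) / sqrt \<kappa>) *\<^sub>R e)"
      using sq_integrable_scaleR[OF sq_integrable_scale_vec[where e = e, OF test_function_sq_integrable[OF test_function_frechet[OF \<phi>]]], of "1 / sqrt \<kappa>"]
      by simp
    show "sq_integrable (\<lambda>x. if i = 1 then \<phi> x *\<^sub>R e else 0)" "sq_integrable (\<lambda>x. if i = 1 then 0 else \<phi> x *\<^sub>R e)"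
      using sq_integrable_scale_vec[OF test_function_sq_integrable[OF \<phi>], of e] by (cases "i = 1"; simp)+
  qed
  have "test_jet \<kappa> i \<phi>' e = abs_l2 (\<lambda>x. T (x + - z))"
    unfolding test_jet_def T_def d \<phi>'_def by simp
  then have "F \<bullet> test_jet \<kappa> i \<phi>' e = (LINT x|lborel. rep_l2 F x \<bullet> T (x + - z))"
    by (simp only: inner_rep_abs_l2[OF sq_integrable_translate[OF sqT]])
  also have "\<dots> = (LINT x|lborel. rep_l2 F (x + z) \<bullet> T (x + z + - z))"
    by (rule integral_lborel_translate(1)[symmetric]) (use sq_integrableD(1)[OF sqT] in measurable)
  also have "\<dots> = jet_translate z F \<bullet> abs_l2 T"
    unfolding jet_translate_def
    by (subst inner_abs_l2[OF sq_integrable_translate[OF sq_integrable_rep_l2] sqT]) simp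
  also have "abs_l2 T = test_jet \<kappa> i \<phi> e"
    by (simp add: T_def[abs_def] test_jet_def)
  finally show "jet_translate z F \<bullet> test_jet \<kappa> i \<phi> e = 0"
    using F \<phi>' by (auto simp: jets_eq[OF \<kappa>])
qed

subsection \<open>Existence of a maximizer\<close>

text \<open>Convexity of \<open>t powr q\<close> for \<open>x + y\<close> as the mean of
  \<open>x / (1 - \<epsilon>)\<close> and \<open>y / \<epsilon>\<close> with weights
  \<open>1 - \<epsilon>\<close> and \<open>\<epsilon>\<close>. As \<open>\<epsilon>\<close> tends to
  0 the factor of \<open>x powr q\<close> tends to 1; the factor of \<open>y powr q\<close> blows
  up, but it will cancel or multiply something that vanishes.\<close>

lemma powr_add_le:
  fixes x y q \<epsilon> :: real
  assumes "x \<ge> 0" "y \<ge> 0" "q > 1" "0 < \<epsilon>" "\<epsilon> < 1"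
  shows "(x + y) powr q \<le> (1 - \<epsilon>) powr (1 - q) * x powr q + \<epsilon> powr (1 - q) * y powr q"
proof -
  have p1: "1 \<le> s powr (1 - q)" if "0 < s" "s < 1" for s :: real
  proof -
    have "1 powr (1 - q) \<le> s powr (1 - q)"
      by (rule powr_mono2') (use that assms in auto)
    then show ?thesis by simp
  qed
  have A: "1 \<le> (1 - \<epsilon>) powr (1 - q)" "1 \<le> \<epsilon> powr (1 - q)"
    using p1 assms by auto
  consider "x = 0" | "y = 0" | "x > 0" "y > 0" using assms by linarith
  then show ?thesis
  proof cases
    case 1
    then show ?thesis using mult_right_mono[OF A(2), of "y powr q"] by simp
  next
    case 2
    then show ?thesis using mult_right_mono[OF A(1), of "x powr q"] by simp
  next
    case 3
    have s: "s * ((z / s) powr q) = s powr (1 - q) * z powr q" if "s > 0" "z > 0" for s z :: real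
      using that by (simp add: powr_divide powr_diff)
    have "((1 - \<epsilon>) *\<^sub>R (x / (1 - \<epsilon>)) + \<epsilon> *\<^sub>R (y / \<epsilon>)) powr q
        \<le> (1 - \<epsilon>) * (x / (1 - \<epsilon>)) powr q + \<epsilon> * (y / \<epsilon>) powr q"
      using 3 assms by (intro convex_onD[OF powr_convex]) auto
    then show ?thesis
      using 3 assms by (simp add: s)
  qed
qed

definition pw :: "real \<Rightarrow> (real^2 \<Rightarrow> complex) \<Rightarrow> ennreal" where
  "pw q v = (\<integral>\<^sup>+x. ennreal (norm (v x) powr q) \<partial>lborel)"

lemma pw_cong_AE: "AE x in lborel. v x = w x \<Longrightarrow> pw q v = pw q w"
  unfolding pw_def by (rule nn_integral_cong_AE) (auto elim!: eventually_mono)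

lemma pw_add_le:
  assumes [measurable]: "v \<in> borel_measurable borel" "w \<in> borel_measurable borel"
    and q: "q > 1" and \<epsilon>: "0 < \<epsilon>" "\<epsilon> < 1"
  shows "pw q (\<lambda>x. v x + w x) \<le> ennreal ((1 - \<epsilon>) powr (1 - q)) * pw q v + ennreal (\<epsilon> powr (1 - q)) * pw q w"
proof -
  have "pw q (\<lambda>x. v x + w x) \<le> (\<integral>\<^sup>+x. ennreal ((1 - \<epsilon>) powr (1 - q)) * ennreal (norm (v x) powr q)
      + ennreal (\<epsilon> powr (1 - q)) * ennreal (norm (w x) powr q) \<partial>lborel)"
    unfolding pw_def
  proof (rule nn_integral_mono)
    fix x
    have "norm (v x + w x) powr q \<le> (norm (v x) + norm (w x)) powr q"
      using q by (intro powr_mono2 norm_triangle_ineq) auto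
    also have "\<dots> \<le> (1 - \<epsilon>) powr (1 - q) * norm (v x) powr q + \<epsilon> powr (1 - q) * norm (w x) powr q"
      using q \<epsilon> by (intro powr_add_le) auto
    finally have "ennreal (norm (v x + w x) powr q)
        \<le> ennreal ((1 - \<epsilon>) powr (1 - q) * norm (v x) powr q + \<epsilon> powr (1 - q) * norm (w x) powr q)"
      by (rule ennreal_leI)
    then show "ennreal (norm (v x + w x) powr q) \<le> ennreal ((1 - \<epsilon>) powr (1 - q)) * ennreal (norm (v x) powr q)
      + ennreal (\<epsilon> powr (1 - q)) * ennreal (norm (w x) powr q)"
      by (simp add: ennreal_mult)
  qed
  also have "\<dots> = ennreal ((1 - \<epsilon>) powr (1 - q)) * pw q v + ennreal (\<epsilon> powr (1 - q)) * pw q w"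
    unfolding pw_def by (simp add: nn_integral_add nn_integral_cmult)
  finally show ?thesis .
qed

lemma pw_scale:
  assumes [measurable]: "v \<in> borel_measurable borel"
  shows "pw q (\<lambda>x. z * v x) = ennreal (norm z powr q) * pw q v"
  unfolding pw_def by (simp add: norm_mult powr_mult ennreal_mult nn_integral_cmult)

lemma weak_conv_fst:
  assumes "weak_conv u L"
  shows "weak_conv (\<lambda>n. fst (u n)) (fst L)"
  unfolding weak_conv_def
proof
  fix a
  have "(\<lambda>n. u n \<bullet> (a, 0)) \<longlonglongrightarrow> L \<bullet> (a, 0)"
    using assms by (simp only: weak_conv_def)
  then show "(\<lambda>n. fst (u n) \<bullet> a) \<longlonglongrightarrow> fst L \<bullet> a"
    by (simp add: inner_prod_def)
qed

lemma weak_conv_snd: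
  fixes u :: "nat \<Rightarrow> 'h::real_inner \<times> complex"
  assumes "weak_conv u L"
  shows "(\<lambda>n. snd (u n)) \<longlonglongrightarrow> snd L"
proof -
  have "(\<lambda>n. u n \<bullet> (0, e)) \<longlonglongrightarrow> L \<bullet> (0, e)" for e :: complex
    using assms by (simp only: weak_conv_def)
  then have *: "(\<lambda>n. snd (u n) \<bullet> e) \<longlonglongrightarrow> snd L \<bullet> e" for e
    by (simp add: inner_prod_def)
  show ?thesis
    using *[of 1] *[of \<i>] by (simp add: tendsto_complex_iff)
qed

lemma weak_conv_subseq:
  assumes "weak_conv u L" "strict_mono (r :: nat \<Rightarrow> nat)"
  shows "weak_conv (\<lambda>n. u (r n)) L"
  unfolding weak_conv_def
proof
  fix a
  have "(\<lambda>n. u n \<bullet> a) \<longlonglongrightarrow> L \<bullet> a"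
    using assms(1) by (simp only: weak_conv_def)
  from LIMSEQ_subseq_LIMSEQ[OF this assms(2)]
  show "(\<lambda>n. u (r n) \<bullet> a) \<longlonglongrightarrow> L \<bullet> a" by (simp only: o_def)
qed

lemma weak_conv_scaleR:
  assumes "weak_conv u 0"
  shows "weak_conv (\<lambda>n. c *\<^sub>R u n) 0"
  unfolding weak_conv_def
proof
  fix a
  have "(\<lambda>n. u n \<bullet> a) \<longlonglongrightarrow> 0 \<bullet> a"
    using assms by (simp only: weak_conv_def)
  from tendsto_mult[OF tendsto_const[of c] this]
  show "(\<lambda>n. c *\<^sub>R u n \<bullet> a) \<longlonglongrightarrow> 0 \<bullet> a" by simp
qed

text \<open>An element \<open>(F, d)\<close> stands for the function with regular part \<open>F\<close> and charge \<open>d / b\<close>,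
  where \<open>b\<^sup>2\<close> is the value of \<open>beta\<close>; its norm is then the form norm.\<close>
locale energy_space =
  fixes \<kappa> b q :: real
  assumes \<kappa>: "\<kappa> > 0" and b: "b > 0" and q: "q > 2"
begin

definition val :: "jet \<times> complex \<Rightarrow> real^2 \<Rightarrow> complex" where
  "val u x = jfun \<kappa> (fst u) x + (snd u / of_real b) * green \<kappa> x"

definition X :: "(jet \<times> complex) set" where
  "X = {u. fst u \<in> jets \<kappa>}"

definition T :: "jet \<times> complex \<Rightarrow> real" where
  "T u = enn2real (pw q (val u))"

lemma val_measurable [measurable]: "val u \<in> borel_measurable borel"
  unfolding val_def[abs_def] by measurable

lemma X_closed:
  "u \<in> X \<Longrightarrow> v \<in> X \<Longrightarrow> u + v \<in> X" "u \<in> X \<Longrightarrow> v \<in> X \<Longrightarrow> u - v \<in> X" "u \<in> X \<Longrightarrow> r *\<^sub>R u \<in> X"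
  by (auto simp: X_def jets_add[OF \<kappa>] jets_diff[OF \<kappa>] jets_scaleR[OF \<kappa>])

lemma AE_val_simps:
  shows AE_val_add: "AE x in lborel. val (u + v) x = val u x + val v x"
    and AE_val_scaleR: "AE x in lborel. val (r *\<^sub>R u) x = r *\<^sub>R val u x"
proof -
  show "AE x in lborel. val (u + v) x = val u x + val v x"
    using AE_jfun_add[of \<kappa> "fst u" "fst v"]
    by eventually_elim (simp add: val_def add_divide_distrib distrib_right)
  show "AE x in lborel. val (r *\<^sub>R u) x = r *\<^sub>R val u x"
    using AE_jfun_scaleR[of \<kappa> r "fst u"]
    by eventually_elim (simp add: val_def scaleR_conv_of_real distrib_left)
qed

lemma pw_green_finite: "pw q (green \<kappa>) < \<infinity>"
  unfolding pw_def by (rule nn_integral_green_powr) (use \<kappa> q in auto)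

text \<open>If the Green function vanished almost everywhere, 0 would be a weak derivative of it,
  against \<open>green_no_weak_deriv\<close>.\<close>

lemma pw_green_pos: "pw q (green \<kappa>) \<noteq> 0"
proof
  assume "pw q (green \<kappa>) = 0"
  then have "AE x in lborel. ennreal (norm (green \<kappa> x) powr q) = 0"
    unfolding pw_def by (subst (asm) nn_integral_0_iff_AE) auto
  then have 0: "AE x in lborel. green \<kappa> x = 0"
    by eventually_elim auto
  have "weak_deriv 1 (green \<kappa>) (\<lambda>x. 0)"
    unfolding weak_deriv_def
  proof (intro conjI allI impI)
    show "sq_integrable (green \<kappa>)" by (rule sq_integrable_green[OF \<kappa>])
    fix \<phi> assume "test_function \<phi>"
    have "(LINT x|lborel. frechet_derivative \<phi> (at x) (axis 1 1) *\<^sub>R green \<kappa> x) = 0"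
      by (rule integral_eq_zero_AE) (use 0 in eventually_elim, simp)
    then show "(LINT x|lborel. frechet_derivative \<phi> (at x) (axis 1 1) *\<^sub>R green \<kappa> x) = - (LINT x|lborel. \<phi> x *\<^sub>R 0)"
      by simp
  qed simp
  then show False using green_no_weak_deriv[OF \<kappa>] by blast
qed

lemma norm_components: "norm (fst u) \<le> norm u" "norm (snd u) \<le> norm u" for u :: "jet \<times> complex"
  by (cases u; simp add: norm_Pair)+

lemma pw_val_bound:
  obtains K where "K \<ge> 0" "\<And>u. u \<in> X \<Longrightarrow> norm u \<le> 1 \<Longrightarrow> pw q (val u) \<le> ennreal K"
proof -
  obtain C where C: "C \<ge> 1" "\<And>F. F \<in> jets \<kappa> \<Longrightarrow> norm F \<le> 1 \<Longrightarrow> pw q (jfun \<kappa> F) \<le> ennreal C"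
    using jet_sobolev[OF \<kappa>, of q] q unfolding pw_def by auto
  define g where "g = enn2real (pw q (green \<kappa>))"
  have g: "pw q (green \<kappa>) = ennreal g" using pw_green_finite by (simp add: g_def)
  define c where "c = (1 / 2 :: real) powr (1 - q)"
  have c: "c \<ge> 0" by (simp add: c_def)
  show thesis
  proof (rule that[of "c * C + c * ((1 / b) powr q * g)"])
    show "0 \<le> c * C + c * ((1 / b) powr q * g)" using C(1) c by (simp add: g_def)
    fix u assume u: "u \<in> X" "norm u \<le> 1"
    have n: "norm (fst u) \<le> 1" "norm (snd u) \<le> 1"
      using u(2) norm_components[of u] by linarith+
    have "pw q (val u) \<le> ennreal ((1 - 1 / 2) powr (1 - q)) * pw q (jfun \<kappa> (fst u))
        + ennreal ((1 / 2) powr (1 - q)) * pw q (\<lambda>x. snd u / of_real b * green \<kappa> x)"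
      unfolding val_def[abs_def] by (rule pw_add_le) (use q in auto)
    also have "\<dots> = ennreal c * pw q (jfun \<kappa> (fst u)) + ennreal c * (ennreal (norm (snd u / of_real b) powr q) * ennreal g)"
      by (simp only: pw_scale[OF borel_measurable_green] g c_def) simp
    also have "\<dots> \<le> ennreal c * ennreal C + ennreal c * (ennreal ((1 / b) powr q) * ennreal g)"
      using u(1) n b q
      by (intro add_mono mult_left_mono mult_right_mono C(2) ennreal_leI powr_mono2)
        (auto simp: X_def norm_divide divide_right_mono)
    also have "\<dots> = ennreal (c * C + c * ((1 / b) powr q * g))"
      using c C(1) by (simp add: ennreal_mult g_def)
    finally show "pw q (val u) \<le> ennreal (c * C + c * ((1 / b) powr q * g))" .
  qed
qed

lemma pw_val_scaleR: "pw q (val (r *\<^sub>R u)) = ennreal (\<bar>r\<bar> powr q) * pw q (val u)"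
proof -
  have "pw q (val (r *\<^sub>R u)) = pw q (\<lambda>x. of_real r * val u x)"
    by (rule pw_cong_AE) (use AE_val_scaleR[of r u] in \<open>simp add: scaleR_conv_of_real\<close>)
  then show ?thesis by (simp add: pw_scale)
qed

lemma pw_val_finite:
  assumes "u \<in> X"
  shows "pw q (val u) = ennreal (T u)"
proof -
  obtain K where K: "K \<ge> 0" "\<And>u. u \<in> X \<Longrightarrow> norm u \<le> 1 \<Longrightarrow> pw q (val u) \<le> ennreal K"
    using pw_val_bound by blast
  define s where "s = norm u + 1"
  have s: "s > 0" by (simp add: s_def add_nonneg_pos)
  have "norm ((1 / s) *\<^sub>R u) \<le> 1" using s by (simp add: s_def)
  then have "pw q (val ((1 / s) *\<^sub>R u)) \<le> ennreal K"
    by (intro K X_closed assms)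
  moreover have "pw q (val u) = ennreal (\<bar>s\<bar> powr q) * pw q (val ((1 / s) *\<^sub>R u))"
    using pw_val_scaleR[of s "(1 / s) *\<^sub>R u"] s by simp
  ultimately have "pw q (val u) < \<infinity>"
    by (auto simp: ennreal_mult_less_top intro: le_less_trans)
  then show ?thesis by (simp add: T_def)
qed

lemma T_nonneg: "T u \<ge> 0"
  by (simp add: T_def)

lemma T_scaleR: "T (r *\<^sub>R u) = \<bar>r\<bar> powr q * T u"
  by (simp add: T_def pw_val_scaleR enn2real_mult)

definition W :: real where
  "W = Sup (T ` {u \<in> X. norm u \<le> 1})"

lemma T_bdd: "bdd_above (T ` {u \<in> X. norm u \<le> 1})"
proof -
  obtain K where K: "K \<ge> 0" "\<And>u. u \<in> X \<Longrightarrow> norm u \<le> 1 \<Longrightarrow> pw q (val u) \<le> ennreal K"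
    using pw_val_bound by blast
  show ?thesis
    by (rule bdd_aboveI[of _ K]) (use K pw_val_finite in force)
qed

lemma T_le_W: "u \<in> X \<Longrightarrow> norm u \<le> 1 \<Longrightarrow> T u \<le> W"
  unfolding W_def by (rule cSup_upper[OF _ T_bdd]) auto

lemma zero_in_X: "(0, d) \<in> X"
  by (simp add: X_def jets_zero[OF \<kappa>])

lemma AE_val_charge: "AE x in lborel. val (0, d) x = (d / of_real b) * green \<kappa> x"
  using AE_rep_l2_zero[where 'a = "real^2" and 'b = "complex \<times> complex \<times> complex"]
  by eventually_elim (simp add: val_def jfun_def)

text \<open>The pure charge \<open>(0, 1)\<close> has norm 1 and is not a null function, so it is a
  competitor with positive value.\<close>

lemma W_pos: "W > 0"
proof -
  have "pw q (val (0, 1)) = ennreal (norm (1 / complex_of_real b) powr q) * pw q (green \<kappa>)"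
    using pw_cong_AE[OF AE_val_charge[of 1]] by (simp only: pw_scale[OF borel_measurable_green])
  then have "pw q (val (0, 1)) \<noteq> 0"
    using pw_green_pos b by (simp add: norm_divide)
  then have "0 < T (0, 1)"
    using pw_val_finite[OF zero_in_X[of 1]] T_nonneg[of "(0, 1)"] by (cases "T (0, 1) = 0") auto
  also have "\<dots> \<le> W"
    by (rule T_le_W) (auto simp: zero_in_X norm_Pair)
  finally show ?thesis .
qed

lemma T_le: "u \<in> X \<Longrightarrow> T u \<le> W * norm u powr q"
proof -
  assume u: "u \<in> X"
  show ?thesis
  proof (cases "u = 0")
    case True
    then have "T u = 0" using T_scaleR[of 0 u] q by simp
    then show ?thesis using W_pos by simp
  next
    case False
    have "T ((1 / norm u) *\<^sub>R u) \<le> W"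
      by (rule T_le_W) (use u False in \<open>auto intro: X_closed\<close>)
    then have "norm u powr q * T ((1 / norm u) *\<^sub>R u) \<le> norm u powr q * W"
      by (rule mult_left_mono) simp
    then show ?thesis
      using False T_scaleR[of "norm u" "(1 / norm u) *\<^sub>R u"] by (simp add: mult.commute)
  qed
qed

text \<open>For the regular parts, local compactness with a positive weight gives \<open>L1\<close>
  convergence of the weighted squares, hence almost everywhere convergence on the whole plane along
  a single subsequence. The charges are a coordinate and converge by themselves.\<close>

lemma val_weak_null_AE_subseq:
  assumes v: "\<And>n. v n \<in> X" "\<And>n. norm (v n) \<le> B" and wk: "weak_conv v 0"
  obtains r where "strict_mono (r :: nat \<Rightarrow> nat)" "AE x in lborel. (\<lambda>n. val (v (r n)) x) \<longlonglongrightarrow> 0"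
proof -
  \<comment> \<open>Rescaling into the unit ball, where local compactness is formulated.\<close>
  define s where "s = max B 1"
  have s: "s > 0" by (simp add: s_def)
  define F where "F n = (1 / s) *\<^sub>R fst (v n)" for n
  have F: "F n \<in> jets \<kappa>" "norm (F n) \<le> 1" for n
  proof -
    show "F n \<in> jets \<kappa>" using v(1) jets_scaleR[OF \<kappa>] by (auto simp: F_def X_def)
    have "norm (fst (v n)) \<le> s" using v(2)[of n] norm_components[of "v n"] by (simp add: s_def)
    then show "norm (F n) \<le> 1" using s by (simp add: F_def)
  qed
  have wF: "weak_conv F 0"
    unfolding F_def[abs_def] using weak_conv_fst[OF wk] by (intro weak_conv_scaleR) simp
  obtain w :: "real^2 \<Rightarrow> real" where w [measurable]: "w \<in> borel_measurable lborel"
    and w0: "\<And>x. w x > 0" and w1: "\<And>x. w x \<le> 1" and wint: "integrable lborel w"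
    using sigma_finite_measure.obtain_positive_integrable_function[OF sigma_finite_lborel] by metis
  have wfin: "(\<integral>\<^sup>+x. ennreal (w x) \<partial>lborel) < \<infinity>"
    using wint w0 by (simp add: nn_integral_eq_integral less_imp_le)
  define g where "g n x = w x * (norm (jfun \<kappa> (F n) x))\<^sup>2" for n x
  have gm [measurable]: "g n \<in> borel_measurable lborel" for n
    unfolding g_def[abs_def] by measurable
  have g0: "g n x \<ge> 0" for n x using w0[of x] by (simp add: g_def less_imp_le)
  have lim: "(\<lambda>n. \<integral>\<^sup>+x. ennreal (g n x) \<partial>lborel) \<longlonglongrightarrow> 0"
  proof -
    have "(\<lambda>n. \<integral>\<^sup>+x. ennreal (w x) * nsq (jfun \<kappa> (F n) x) \<partial>lborel) \<longlonglongrightarrow> 0"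
      by (rule jet_local_compactness[OF \<kappa> F wF]) (use w1 wfin in auto)
    then show ?thesis using w0 by (simp add: g_def nsq_def ennreal_mult less_imp_le)
  qed
  have gint: "integrable lborel (g n)" for n
  proof (rule Bochner_Integration.integrable_bound[OF sq_integrableD(3)[OF sq_integrable_jet(1)[of \<kappa> "F n"]]])
    show "AE x in lborel. norm (g n x) \<le> norm ((norm (jfun \<kappa> (F n) x))\<^sup>2)"
      using w0 w1 by (auto simp: g_def abs_mult less_imp_le intro!: AE_I2 mult_left_le_one_le)
  qed simp
  have "(\<lambda>n. LINT x|lborel. norm (g n x)) \<longlonglongrightarrow> 0"
  proof -
    have "(LINT x|lborel. norm (g n x)) = enn2real (\<integral>\<^sup>+x. ennreal (g n x) \<partial>lborel)" for n
      using g0 gint[of n] by (simp add: nn_integral_eq_integral)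
    moreover have "(\<lambda>n. enn2real (\<integral>\<^sup>+x. ennreal (g n x) \<partial>lborel)) \<longlonglongrightarrow> 0"
      using lim by (intro tendsto_enn2real) simp_all
    ultimately show ?thesis by simp
  qed
  from tendsto_L1_AE_subseq[OF gint this]
  obtain r where r: "strict_mono r" "AE x in lborel. (\<lambda>n. g (r n) x) \<longlonglongrightarrow> 0"
    by blast
  have "AE x in lborel. \<forall>n. jfun \<kappa> (F n) x = (1 / s) *\<^sub>R jfun \<kappa> (fst (v n)) x"
    unfolding AE_all_countable F_def using AE_jfun_scaleR by blast
  then have "AE x in lborel. (\<lambda>n. val (v (r n)) x) \<longlonglongrightarrow> 0"
    using r(2)
  proof eventually_elim
    case (elim x)
    have "(\<lambda>n. (1 / w x) * g (r n) x) \<longlonglongrightarrow> (1 / w x) * 0"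
      by (intro tendsto_mult tendsto_const elim)
    then have "(\<lambda>n. (norm (jfun \<kappa> (F (r n)) x))\<^sup>2) \<longlonglongrightarrow> 0"
      using w0[of x] by (simp add: g_def less_imp_neq[symmetric])
    then have "(\<lambda>n. sqrt ((norm (jfun \<kappa> (F (r n)) x))\<^sup>2)) \<longlonglongrightarrow> sqrt 0"
      by (rule tendsto_real_sqrt)
    then have "(\<lambda>n. jfun \<kappa> (F (r n)) x) \<longlonglongrightarrow> 0"
      by (simp add: tendsto_norm_zero_iff)
    then have "(\<lambda>n. s *\<^sub>R jfun \<kappa> (F (r n)) x) \<longlonglongrightarrow> s *\<^sub>R 0"
      by (intro tendsto_scaleR tendsto_const)
    then have 1: "(\<lambda>n. jfun \<kappa> (fst (v (r n))) x) \<longlonglongrightarrow> 0"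
      using elim(1) s by simp
    have "(\<lambda>n. snd (v (r n))) \<longlonglongrightarrow> 0"
      using weak_conv_snd[OF weak_conv_subseq[OF wk r(1)]] by simp
    then have "(\<lambda>n. jfun \<kappa> (fst (v (r n))) x + (snd (v (r n)) / of_real b) * green \<kappa> x) \<longlonglongrightarrow> 0 + (0 / of_real b) * green \<kappa> x"
      using b by (intro tendsto_add tendsto_mult tendsto_divide tendsto_const 1) auto
    then show ?case by (simp add: val_def)
  qed
  with r(1) show thesis by (rule that)
qed

text \<open>Write \<open>u = v + L\<close> with \<open>v\<close> weakly null. The defect
  \<open>h\<close> of \<open>powr_add_le\<close> is nonnegative and tends to
  \<open>(B - 1) * norm (val L x) powr q\<close> along a subsequence. Fatou's lemma compares its
  integral with the limit of \<open>B * T L + A * T v - T u\<close>, in which \<open>T v\<close> is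
  at most \<open>W * norm v powr q\<close>. The large constant \<open>B\<close> then cancels, and
  only \<open>A\<close>, which is close to 1 for small \<open>\<epsilon>\<close>, remains.\<close>

lemma T_weak_limit:
  assumes u: "\<And>n. u n \<in> X" "\<And>n. norm (u n) \<le> 1" and lim: "(\<lambda>n. T (u n)) \<longlonglongrightarrow> W"
    and wk: "weak_conv u L" and L: "L \<in> X" "norm L \<le> 1" and \<epsilon>: "0 < \<epsilon>" "\<epsilon> < 1"
  shows "W \<le> T L + (1 - \<epsilon>) powr (1 - q) * (W * (1 - (norm L)\<^sup>2) powr (q / 2))"
proof -
  define A where "A = (1 - \<epsilon>) powr (1 - q)"
  define B where "B = \<epsilon> powr (1 - q)"
  have B1: "B \<ge> 1"
    using powr_mono2'[of "1 - q" \<epsilon> 1] \<epsilon> q by (simp add: B_def)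
  have A0: "A \<ge> 0" by (simp add: A_def)
  define v where "v n = u n - L" for n
  have v: "v n \<in> X" for n using u L by (simp add: v_def X_closed)
  have vn: "norm (v n) \<le> 2" for n
    using norm_triangle_ineq4[of "u n" L] u(2)[of n] L(2) by (simp add: v_def)
  have wv: "weak_conv v 0"
    using wk unfolding weak_conv_def v_def
    by (auto simp: inner_diff_left intro: LIM_zero)
  obtain r where r: "strict_mono (r :: nat \<Rightarrow> nat)" "AE x in lborel. (\<lambda>n. val (v (r n)) x) \<longlonglongrightarrow> 0"
    using val_weak_null_AE_subseq[OF v vn wv] by blast
  define h where "h n x = B * norm (val L x) powr q + A * norm (val (v (r n)) x) powr q - norm (val (u (r n)) x) powr q" for n x
  have hm [measurable]: "h n \<in> borel_measurable lborel" for n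
    unfolding h_def[abs_def] by measurable
  have sum: "AE x in lborel. val (u (r n)) x = val (v (r n)) x + val L x" for n
    using AE_val_add[of "v (r n)" L] by (simp add: v_def)
  have h0: "AE x in lborel. 0 \<le> h n x" for n
    using sum[of n]
  proof eventually_elim
    case (elim x)
    have "norm (val (u (r n)) x) powr q \<le> (norm (val (v (r n)) x) + norm (val L x)) powr q"
      unfolding elim using q by (intro powr_mono2 norm_triangle_ineq) auto
    also have "\<dots> \<le> A * norm (val (v (r n)) x) powr q + B * norm (val L x) powr q"
      unfolding A_def B_def using q \<epsilon> by (intro powr_add_le) auto
    finally show ?case by (simp add: h_def)
  qed
  \<comment> \<open>The subtracted integral is first kept on the other side, since the integrals
    take values in the extended nonnegative reals; it is moved over once everything is known to be
    finite.\<close>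
  have hint: "(\<integral>\<^sup>+x. ennreal (h n x) \<partial>lborel) = ennreal (B * T L + A * T (v (r n)) - T (u (r n)))" for n
  proof -
    have "(\<integral>\<^sup>+x. ennreal (h n x) \<partial>lborel) + pw q (val (u (r n)))
        = (\<integral>\<^sup>+x. ennreal (h n x) + ennreal (norm (val (u (r n)) x) powr q) \<partial>lborel)"
      unfolding pw_def by (rule nn_integral_add[symmetric]) measurable
    also have "\<dots> = (\<integral>\<^sup>+x. ennreal B * ennreal (norm (val L x) powr q) + ennreal A * ennreal (norm (val (v (r n)) x) powr q) \<partial>lborel)"
    proof (rule nn_integral_cong_AE)
      show "AE x in lborel. ennreal (h n x) + ennreal (norm (val (u (r n)) x) powr q)
          = ennreal B * ennreal (norm (val L x) powr q) + ennreal A * ennreal (norm (val (v (r n)) x) powr q)"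
        using h0[of n]
      proof eventually_elim
        case (elim x)
        have "ennreal (h n x) + ennreal (norm (val (u (r n)) x) powr q) = ennreal (h n x + norm (val (u (r n)) x) powr q)"
          using elim by simp
        also have "h n x + norm (val (u (r n)) x) powr q = B * norm (val L x) powr q + A * norm (val (v (r n)) x) powr q"
          by (simp add: h_def)
        also have "ennreal \<dots> = ennreal B * ennreal (norm (val L x) powr q) + ennreal A * ennreal (norm (val (v (r n)) x) powr q)"
          using A0 B1 by (simp add: ennreal_mult)
        finally show ?case .
      qed
    qed
    also have "\<dots> = ennreal B * pw q (val L) + ennreal A * pw q (val (v (r n)))"
      unfolding pw_def by (simp add: nn_integral_add nn_integral_cmult)
    also have "\<dots> = ennreal (B * T L + A * T (v (r n)))"
      using A0 B1 T_nonneg v L by (simp add: pw_val_finite ennreal_mult)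
    finally have eq: "(\<integral>\<^sup>+x. ennreal (h n x) \<partial>lborel) + ennreal (T (u (r n))) = ennreal (B * T L + A * T (v (r n)))"
      using u by (simp add: pw_val_finite)
    then obtain z where z: "(\<integral>\<^sup>+x. ennreal (h n x) \<partial>lborel) = ennreal z" "z \<ge> 0"
      by (cases "\<integral>\<^sup>+x. ennreal (h n x) \<partial>lborel") auto
    have "ennreal (z + T (u (r n))) = ennreal (B * T L + A * T (v (r n)))"
      using eq z T_nonneg by simp
    then have "z + T (u (r n)) = B * T L + A * T (v (r n))"
      by (subst (asm) ennreal_inj) (use z A0 B1 T_nonneg in auto)
    then have "B * T L + A * T (v (r n)) - T (u (r n)) = z" by simp
    then show ?thesis by (simp only: z)
  qed
  \<comment> \<open>An upper bound for the integral of \<open>h n\<close> that involves only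
    \<open>u (r n) \<bullet> L\<close> and \<open>T (u (r n))\<close>; these converge, whereas
    convergence of \<open>T (v (r n))\<close> is not known.\<close>
  define Z where "Z n = B * T L + A * (W * (1 - 2 * (u (r n) \<bullet> L) + (norm L)\<^sup>2) powr (q / 2)) - T (u (r n))" for n
  have YZ: "B * T L + A * T (v (r n)) - T (u (r n)) \<le> Z n" 
    and base: "0 \<le> 1 - 2 * (u (r n) \<bullet> L) + (norm L)\<^sup>2" for n
  proof -
    have nv: "(norm (v (r n)))\<^sup>2 = (norm (u (r n)))\<^sup>2 - 2 * (u (r n) \<bullet> L) + (norm L)\<^sup>2"
      by (simp add: v_def power2_norm_eq_inner inner_diff inner_commute)
    have "(norm (u (r n)))\<^sup>2 \<le> 1" using u(2)[of "r n"] by (simp add: power_le_one)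
    then have le: "(norm (v (r n)))\<^sup>2 \<le> 1 - 2 * (u (r n) \<bullet> L) + (norm L)\<^sup>2"
      using nv by simp
    then show "0 \<le> 1 - 2 * (u (r n) \<bullet> L) + (norm L)\<^sup>2"
      using zero_le_power2[of "norm (v (r n))"] by linarith
    have "norm (v (r n)) powr q = ((norm (v (r n)))\<^sup>2) powr (q / 2)"
    proof (cases "v (r n) = 0")
      case False
      then have "(norm (v (r n)))\<^sup>2 = norm (v (r n)) powr 2" by (simp add: powr_numeral)
      moreover have "2 * (q / 2) = q" by simp
      ultimately show ?thesis by (simp only: powr_powr)
    qed simp
    also have "\<dots> \<le> (1 - 2 * (u (r n) \<bullet> L) + (norm L)\<^sup>2) powr (q / 2)"
      using le q by (intro powr_mono2) auto
    finally have "T (v (r n)) \<le> W * (1 - 2 * (u (r n) \<bullet> L) + (norm L)\<^sup>2) powr (q / 2)"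
      using T_le[OF v, of "r n"] W_pos by (meson mult_left_mono less_imp_le order_trans)
    then show "B * T L + A * T (v (r n)) - T (u (r n)) \<le> Z n"
      unfolding Z_def using A0 by (intro diff_right_mono add_left_mono mult_left_mono)
  qed
  define Z0 where "Z0 = B * T L + A * (W * (1 - (norm L)\<^sup>2) powr (q / 2)) - W"
  have Zlim: "Z \<longlonglongrightarrow> Z0"
  proof -
    have "(\<lambda>n. u (r n) \<bullet> L) \<longlonglongrightarrow> L \<bullet> L"
      using weak_conv_subseq[OF wk r(1)] unfolding weak_conv_def by blast
    then have "(\<lambda>n. 1 - 2 * (u (r n) \<bullet> L) + (norm L)\<^sup>2) \<longlonglongrightarrow> 1 - 2 * (L \<bullet> L) + (norm L)\<^sup>2"
      by (intro tendsto_add tendsto_diff tendsto_mult tendsto_const)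
    also have "1 - 2 * (L \<bullet> L) + (norm L)\<^sup>2 = 1 - (norm L)\<^sup>2"
      by (simp add: power2_norm_eq_inner)
    finally have "(\<lambda>n. (1 - 2 * (u (r n) \<bullet> L) + (norm L)\<^sup>2) powr (q / 2)) \<longlonglongrightarrow> (1 - (norm L)\<^sup>2) powr (q / 2)"
      by (rule tendsto_powr'[OF _ tendsto_const]) (use q base in auto)
    moreover have "(\<lambda>n. T (u (r n))) \<longlonglongrightarrow> W"
      using LIMSEQ_subseq_LIMSEQ[OF lim r(1)] by (simp add: o_def)
    ultimately show ?thesis
      unfolding Z_def Z0_def by (intro tendsto_add tendsto_diff tendsto_mult tendsto_const)
  qed
  \<comment> \<open>\<open>ennreal\<close> truncates negative reals, so the final comparison can be
    read back in the reals only once the limit \<open>Z0\<close> is known to be nonnegative.\<close>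
  have Y0: "0 \<le> Z n" for n
  proof (rule order_trans[OF _ YZ])
    have "pw q (val (u (r n))) \<le> ennreal A * pw q (val (v (r n))) + ennreal B * pw q (val L)"
      using pw_add_le[of "val (v (r n))" "val L" q \<epsilon>] pw_cong_AE[OF sum] q \<epsilon> by (simp add: A_def B_def)
    then have "ennreal (T (u (r n))) \<le> ennreal (A * T (v (r n)) + B * T L)"
      using A0 B1 T_nonneg u v L by (simp add: pw_val_finite ennreal_mult)
    then show "0 \<le> B * T L + A * T (v (r n)) - T (u (r n))"
      by (subst (asm) ennreal_le_iff) (use A0 B1 T_nonneg in auto)
  qed
  have Z00: "0 \<le> Z0"
    by (rule LIMSEQ_le_const[OF Zlim]) (use Y0 in auto)
  have "ennreal ((B - 1) * T L) = (\<integral>\<^sup>+x. ennreal ((B - 1) * norm (val L x) powr q) \<partial>lborel)"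
  proof -
    have "(\<integral>\<^sup>+x. ennreal ((B - 1) * norm (val L x) powr q) \<partial>lborel) = ennreal (B - 1) * pw q (val L)"
      unfolding pw_def using B1 by (simp add: ennreal_mult nn_integral_cmult)
    then show ?thesis using B1 T_nonneg L by (simp add: pw_val_finite ennreal_mult)
  qed
  also have "\<dots> = (\<integral>\<^sup>+x. liminf (\<lambda>n. ennreal (h n x)) \<partial>lborel)"
  proof (rule nn_integral_cong_AE)
    have "AE x in lborel. \<forall>n. val (u (r n)) x = val (v (r n)) x + val L x"
      unfolding AE_all_countable using sum by blast
    then show "AE x in lborel. ennreal ((B - 1) * norm (val L x) powr q) = liminf (\<lambda>n. ennreal (h n x))"
      using r(2)
    proof eventually_elim
      case (elim x)
      have 1: "(\<lambda>n. norm (val (v (r n)) x)) \<longlonglongrightarrow> 0"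
        using tendsto_norm[OF elim(2)] by simp
      have 2: "(\<lambda>n. norm (val (u (r n)) x)) \<longlonglongrightarrow> norm (val L x)"
        using tendsto_norm[OF tendsto_add[OF elim(2) tendsto_const[of "val L x"]]] elim(1) by simp
      have "(\<lambda>n. h n x) \<longlonglongrightarrow> B * norm (val L x) powr q + A * 0 powr q - norm (val L x) powr q"
        unfolding h_def using q
        by (intro tendsto_intros tendsto_powr'[OF 1 tendsto_const] tendsto_powr'[OF 2 tendsto_const]) auto
      then have "(\<lambda>n. ennreal (h n x)) \<longlonglongrightarrow> ennreal ((B - 1) * norm (val L x) powr q)"
        by (intro tendsto_ennrealI) (simp add: algebra_simps)
      then show ?case
        by (rule lim_imp_Liminf[OF sequentially_bot, symmetric])
    qed
  qed
  also have "\<dots> \<le> liminf (\<lambda>n. \<integral>\<^sup>+x. ennreal (h n x) \<partial>lborel)"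
    by (rule nn_integral_liminf) simp
  also have "\<dots> \<le> liminf (\<lambda>n. ennreal (Z n))"
    by (intro Liminf_mono always_eventually allI) (simp only: hint ennreal_leI[OF YZ])
  also have "\<dots> = ennreal Z0"
    by (rule lim_imp_Liminf[OF sequentially_bot]) (intro tendsto_ennrealI Zlim)
  finally have "(B - 1) * T L \<le> Z0"
    using Z00 by (simp add: ennreal_le_iff)
  then show ?thesis
    by (simp add: Z0_def A_def algebra_simps)
qed

text \<open>Put \<open>a = (norm L)\<^sup>2\<close>. Letting \<open>\<epsilon>\<close> tend to 0 in
  \<open>T_weak_limit\<close> and using \<open>T_le\<close> gives
  \<open>W \<le> W * (a powr (q / 2) + (1 - a) powr (q / 2))\<close>. Since
  \<open>q / 2 > 1\<close>, the bracket is below 1 for \<open>0 < a < 1\<close>; as \<open>L\<close>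
  is nonzero, this leaves \<open>a = 1\<close>.\<close>

lemma maximizer_of_weak_limit:
  assumes u: "\<And>n. u n \<in> X" "\<And>n. norm (u n) \<le> 1" and lim: "(\<lambda>n. T (u n)) \<longlonglongrightarrow> W"
    and wk: "weak_conv u L" and L0: "L \<noteq> 0"
  shows "L \<in> X \<and> norm L = 1 \<and> T L = W"
proof -
  have LX: "L \<in> X"
    using jets_weak_closed[OF \<kappa> _ weak_conv_fst[OF wk]] u(1) by (simp add: X_def)
  \<comment> \<open>Weak lower semicontinuity of the norm, by testing against \<open>L\<close>
    itself.\<close>
  have "(\<lambda>n. u n \<bullet> L) \<longlonglongrightarrow> L \<bullet> L" using wk unfolding weak_conv_def by blast
  then have "L \<bullet> L \<le> norm L"
  proof (rule LIMSEQ_le_const2)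
    have "u n \<bullet> L \<le> norm L" for n
      using norm_cauchy_schwarz[of "u n" L] u(2)[of n] mult_right_mono[of "norm (u n)" 1 "norm L"] by simp
    then show "\<exists>N. \<forall>n\<ge>N. u n \<bullet> L \<le> norm L" by blast
  qed
  then have "norm L * norm L \<le> 1 * norm L"
    by (simp add: power2_norm_eq_inner[symmetric] power2_eq_square)
  then have Ln: "norm L \<le> 1"
    using L0 by (simp only: mult_le_cancel_right) simp
  define a where "a = (norm L)\<^sup>2"
  have a: "0 < a" "a \<le> 1" using L0 Ln by (auto simp: a_def power_le_one)
  \<comment> \<open>The limit along \<open>\<epsilon> = 1 / (n + 2)\<close>, which stays strictly
    between 0 and 1.\<close>
  have "W \<le> T L + 1 * (W * (1 - a) powr (q / 2))"
  proof (rule LIMSEQ_le_const)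
    have "(\<lambda>n. 1 - 1 / real (Suc (Suc n))) \<longlonglongrightarrow> 1 - 0"
      by (intro tendsto_diff tendsto_const LIMSEQ_Suc[OF LIMSEQ_Suc[OF lim_1_over_n]])
    then have "(\<lambda>n. (1 - 1 / real (Suc (Suc n))) powr (1 - q)) \<longlonglongrightarrow> (1 - 0) powr (1 - q)"
      by (rule tendsto_powr[OF _ tendsto_const]) simp
    then show "(\<lambda>n. T L + (1 - 1 / real (Suc (Suc n))) powr (1 - q) * (W * (1 - a) powr (q / 2)))
        \<longlonglongrightarrow> T L + 1 * (W * (1 - a) powr (q / 2))"
      by (intro tendsto_intros) simp
    show "\<exists>N. \<forall>n\<ge>N. W \<le> T L + (1 - 1 / real (Suc (Suc n))) powr (1 - q) * (W * (1 - a) powr (q / 2))"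
      using T_weak_limit[OF u lim wk LX Ln] unfolding a_def
      by (intro exI allI impI) (simp add: divide_less_eq_1_pos)
  qed
  then have main: "W \<le> T L + W * (1 - a) powr (q / 2)" by simp
  have "norm L powr q = a powr (q / 2)"
  proof -
    have "a = norm L powr 2" using L0 by (simp add: a_def powr_numeral)
    moreover have "2 * (q / 2) = q" by simp
    ultimately show ?thesis by (simp only: powr_powr)
  qed
  then have TL: "T L \<le> W * a powr (q / 2)"
    using T_le[OF LX] by simp
  have "a = 1"
  proof (rule ccontr)
    assume "a \<noteq> 1"
    then have a1: "a < 1" using a by simp
    have "a powr (q / 2) < a powr 1" "(1 - a) powr (q / 2) < (1 - a) powr 1"
      using powr_less_mono'[of a 1 "q / 2"] powr_less_mono'[of "1 - a" 1 "q / 2"] a a1 q by simp_all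
    then have "a powr (q / 2) + (1 - a) powr (q / 2) < 1"
      using a a1 by simp
    then have "W * (a powr (q / 2) + (1 - a) powr (q / 2)) < W * 1"
      using W_pos by (rule mult_strict_left_mono)
    then show False using main TL by (simp add: distrib_left)
  qed
  then have n1: "norm L = 1"
    using L0 by (simp add: a_def power2_eq_1_iff) (metis abs_norm_cancel abs_one abs_minus norm_ge_zero one_neq_neg_one)
  have "T L = W"
    using main TL \<open>a = 1\<close> q by simp
  with LX n1 show ?thesis by simp
qed

lemma T_jet_part:
  assumes "u \<in> X" "norm u \<le> 1"
  shows "(fst u, 0) \<in> X" "norm (fst u, 0 :: complex) \<le> 1" "AE x in lborel. val (fst u, 0) x = jfun \<kappa> (fst u) x"
    "pw q (val (fst u, 0)) = pw q (jfun \<kappa> (fst u))"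
  using assms norm_components(1)[of u] by (auto simp: X_def norm_Pair val_def pw_def)

text \<open>A maximizing sequence converging weakly to 0 loses its charge; the remaining jets cannot vanish,
  so suitable translates converge weakly to a nonzero limit.\<close>
lemma nonzero_weak_limit:
  assumes u: "\<And>n. u n \<in> X" "\<And>n. norm (u n) \<le> 1" and lim: "(\<lambda>n. T (u n)) \<longlonglongrightarrow> W"
    and wk: "weak_conv u 0"
  obtains u' L where "\<And>n. u' n \<in> X" "\<And>n. norm (u' n) \<le> 1" "(\<lambda>n. T (u' n)) \<longlonglongrightarrow> W"
    "weak_conv u' L" "L \<noteq> 0"
proof -
  define f where "f n = (fst (u n), 0 :: complex)" for n
  have f: "f n \<in> X" "norm (f n) \<le> 1" for n
    using T_jet_part(1,2)[OF u] by (simp_all add: f_def)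
  define g where "g = enn2real (pw q (green \<kappa>))"
  have g: "pw q (green \<kappa>) = ennreal g" "g \<ge> 0" using pw_green_finite by (simp_all add: g_def)
  have d0: "(\<lambda>n. norm (snd (u n) / of_real b) powr q) \<longlonglongrightarrow> 0"
  proof -
    have "(\<lambda>n. norm (snd (u n) / of_real b)) \<longlonglongrightarrow> norm (snd 0 / complex_of_real b)"
      using b weak_conv_snd[OF wk] by (intro tendsto_intros) auto
    then have "(\<lambda>n. norm (snd (u n) / of_real b) powr q) \<longlonglongrightarrow> norm (snd 0 / complex_of_real b) powr q"
      by (rule tendsto_powr'[OF _ tendsto_const]) (use q in auto)
    then show ?thesis by simp
  qed
  have step: "T (u n) \<le> (1 - \<epsilon>) powr (1 - q) * T (f n) + \<epsilon> powr (1 - q) * (norm (snd (u n) / of_real b) powr q * g)"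
    if "0 < \<epsilon>" "\<epsilon> < 1" for n \<epsilon>
  proof -
    have "pw q (val (u n)) \<le> ennreal ((1 - \<epsilon>) powr (1 - q)) * pw q (jfun \<kappa> (fst (u n)))
        + ennreal (\<epsilon> powr (1 - q)) * pw q (\<lambda>x. snd (u n) / of_real b * green \<kappa> x)"
      unfolding val_def[abs_def] by (rule pw_add_le) (use q that in auto)
    also have "pw q (jfun \<kappa> (fst (u n))) = ennreal (T (f n))"
      using T_jet_part(4)[OF u] pw_val_finite[OF f(1)] by (simp add: f_def)
    also have "pw q (\<lambda>x. snd (u n) / of_real b * green \<kappa> x) = ennreal (norm (snd (u n) / of_real b) powr q) * ennreal g"
      by (simp only: pw_scale[OF borel_measurable_green] g)
    finally have "ennreal (T (u n)) \<le> ennreal ((1 - \<epsilon>) powr (1 - q) * T (f n) + \<epsilon> powr (1 - q) * (norm (snd (u n) / of_real b) powr q * g))"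
      using u T_nonneg g(2) by (simp add: pw_val_finite ennreal_mult)
    then show ?thesis
      by (subst (asm) ennreal_le_iff) (use T_nonneg g(2) in auto)
  qed
  have flim: "(\<lambda>n. T (f n)) \<longlonglongrightarrow> W"
  proof (rule order_tendstoI)
    fix c assume c: "c < W"
    \<comment> \<open>The splitting parameter is fixed before \<open>n\<close> grows: it is chosen
      so small that \<open>A * c < W\<close>. For this fixed value the charge term tends to 0, and
      \<open>step\<close> gives \<open>A * c < A * T (f n)\<close> eventually.\<close>
    have "(\<lambda>k. (1 - 1 / real (Suc (Suc k))) powr (1 - q) * c) \<longlonglongrightarrow> (1 - 0) powr (1 - q) * c"
      by (intro tendsto_mult tendsto_powr tendsto_diff tendsto_const LIMSEQ_Suc[OF LIMSEQ_Suc[OF lim_1_over_n]]) simp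
    then have "\<forall>\<^sub>F k in sequentially. (1 - 1 / real (Suc (Suc k))) powr (1 - q) * c < W"
      using c by (intro order_tendstoD(2)) auto
    then obtain k where k: "(1 - 1 / real (Suc (Suc k))) powr (1 - q) * c < W"
      by (auto simp: eventually_sequentially)
    define \<epsilon> where "\<epsilon> = 1 / real (Suc (Suc k))"
    have \<epsilon>: "0 < \<epsilon>" "\<epsilon> < 1" by (auto simp: \<epsilon>_def)
    define A where "A = (1 - \<epsilon>) powr (1 - q)"
    have A: "A > 0" using \<epsilon> by (simp add: A_def)
    have "(\<lambda>n. T (u n) - \<epsilon> powr (1 - q) * (norm (snd (u n) / of_real b) powr q * g)) \<longlonglongrightarrow> W - \<epsilon> powr (1 - q) * (0 * g)"
      by (intro tendsto_intros lim d0)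
    then have "\<forall>\<^sub>F n in sequentially. A * c < T (u n) - \<epsilon> powr (1 - q) * (norm (snd (u n) / of_real b) powr q * g)"
      using k by (intro order_tendstoD(1)) (auto simp: A_def \<epsilon>_def)
    then show "\<forall>\<^sub>F n in sequentially. c < T (f n)"
    proof eventually_elim
      case (elim n)
      then have "A * c < A * T (f n)" using step[OF \<epsilon>, of n] by (simp add: A_def)
      then show ?case using A by simp
    qed
  next
    fix c assume "W < c"
    then show "\<forall>\<^sub>F n in sequentially. T (f n) < c"
      by (intro always_eventually allI le_less_trans[OF T_le_W[OF f]])
  qed
  \<comment> \<open>Vanishing is excluded at the level \<open>W / 2\<close>, below the limit of
    \<open>T (f n)\<close>; hence, for large \<open>n\<close>, some unit square carries mass more
    than \<open>\<mu>\<close>.\<close>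
  obtain \<mu> where \<mu>: "\<mu> > 0" "\<And>F. F \<in> jets \<kappa> \<Longrightarrow> norm F \<le> 1 \<Longrightarrow> (\<And>x. avg 1 (jfun \<kappa> F) x \<le> ennreal \<mu>) \<Longrightarrow>
      pw q (jfun \<kappa> F) \<le> ennreal (W / 2)"
    using jet_vanishing[OF \<kappa> q, of "W / 2"] W_pos unfolding pw_def by auto
  have "\<forall>\<^sub>F n in sequentially. W / 2 < T (f n)"
    using W_pos by (intro order_tendstoD(1)[OF flim]) auto
  then obtain N where N: "\<And>n. n \<ge> N \<Longrightarrow> W / 2 < T (f n)"
    by (auto simp: eventually_sequentially)
  have "\<exists>z. ennreal \<mu> < avg 1 (jfun \<kappa> (fst (u n))) z" if "n \<ge> N" for n
  proof (rule ccontr)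
    assume "\<nexists>z. ennreal \<mu> < avg 1 (jfun \<kappa> (fst (u n))) z"
    then have "avg 1 (jfun \<kappa> (fst (u n))) z \<le> ennreal \<mu>" for z by (auto simp: not_less)
    then have "pw q (jfun \<kappa> (fst (u n))) \<le> ennreal (W / 2)"
      using u(1)[of n] u(2)[of n] norm_components(1)[of "u n"] by (intro \<mu>(2)) (auto simp: X_def)
    then have "ennreal (T (f n)) \<le> ennreal (W / 2)"
      using T_jet_part(4)[OF u] pw_val_finite[OF f(1)] by (simp add: f_def)
    then have "T (f n) \<le> W / 2"
      by (subst (asm) ennreal_le_iff) (use W_pos in auto)
    then show False using N[OF that] by simp
  qed
  then obtain z where z: "\<And>n. n \<ge> N \<Longrightarrow> ennreal \<mu> < avg 1 (jfun \<kappa> (fst (u n))) (z n)"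
    by metis
  \<comment> \<open>Centres are available only from index \<open>N\<close> on, so the sequence is
    shifted by \<open>N\<close>.\<close>
  define w where "w n = (jet_translate (z (n + N)) (fst (u (n + N))), 0 :: complex)" for n
  have wX: "w n \<in> X" "norm (w n) \<le> 1" for n
    using f[of "n + N"] by (auto simp: w_def f_def X_def norm_Pair norm_jet_translate jets_translate[OF \<kappa>])
  have wT: "T (w n) = T (f (n + N))" for n
  proof -
    define F where "F = fst (u (n + N))"
    have "pw q (val (w n)) = pw q (\<lambda>x. jfun \<kappa> F (x + z (n + N)))"
      by (rule pw_cong_AE) (use AE_jfun_translate[of \<kappa> "z (n + N)" F] in \<open>simp add: val_def w_def F_def\<close>)
    also have "\<dots> = pw q (jfun \<kappa> F)"
      unfolding pw_def by (rule nn_integral_lborel_translate) measurable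
    also have "\<dots> = pw q (val (f (n + N)))"
      using T_jet_part(4)[OF u] by (simp add: f_def F_def)
    finally show ?thesis by (simp add: T_def)
  qed
  have wlim: "(\<lambda>n. T (w n)) \<longlonglongrightarrow> W"
    unfolding wT by (rule LIMSEQ_ignore_initial_segment[OF flim])
  obtain r L where r: "strict_mono (r :: nat \<Rightarrow> nat)" and L: "weak_conv (w \<circ> r) L"
    using bounded_weakly_convergent_subseq[of w 1, OF wX(2)] by blast
  have "L \<noteq> 0"
  proof
    assume "L = 0"
    then have wk0: "weak_conv (\<lambda>n. fst (w (r n))) 0"
      using weak_conv_fst[OF L] by (simp add: o_def)
    \<comment> \<open>If the translates converged weakly to 0, their mass in the fixed square
      \<open>square 1\<close> would tend to 0; by the choice of the centres it stays above
      \<open>\<mu>\<close>.\<close>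
    have "(\<lambda>n. \<integral>\<^sup>+x. indicator (square 1) x * nsq (jfun \<kappa> (fst (w (r n))) x) \<partial>lborel) \<longlonglongrightarrow> 0"
    proof (rule jet_local_compactness[OF \<kappa> _ _ wk0])
      show "fst (w (r n)) \<in> jets \<kappa>" "norm (fst (w (r n))) \<le> 1" for n
        using wX[of "r n"] norm_components(1)[of "w (r n)"] by (auto simp: X_def)
      show "(indicator (square 1) x :: ennreal) \<le> 1" for x by (simp add: indicator_def)
      show "(\<integral>\<^sup>+x. indicator (square 1) x \<partial>lborel) < \<infinity>" by (simp add: emeasure_square)
    qed measurable
    then have "\<forall>\<^sub>F n in sequentially. (\<integral>\<^sup>+x. indicator (square 1) x * nsq (jfun \<kappa> (fst (w (r n))) x) \<partial>lborel) < ennreal \<mu>"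
      using \<mu>(1) by (intro order_tendstoD(2)) auto
    then obtain n where n: "(\<integral>\<^sup>+x. indicator (square 1) x * nsq (jfun \<kappa> (fst (w (r n))) x) \<partial>lborel) < ennreal \<mu>"
      by (auto simp: eventually_sequentially)
    have "(\<integral>\<^sup>+x. indicator (square 1) x * nsq (jfun \<kappa> (fst (w (r n))) x) \<partial>lborel)
        = (\<integral>\<^sup>+x. indicator (square 1) x * nsq (jfun \<kappa> (fst (u (r n + N))) (x + z (r n + N))) \<partial>lborel)"
      by (rule nn_integral_cong_AE)
        (use AE_jfun_translate[of \<kappa> "z (r n + N)" "fst (u (r n + N))"] in \<open>auto elim!: eventually_mono simp: w_def\<close>)
    also have "\<dots> = avg 1 (jfun \<kappa> (fst (u (r n + N)))) (z (r n + N))"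
      by (simp add: avg_def add.commute)
    finally show False using n z[of "r n + N"] by simp
  qed
  moreover have "(\<lambda>n. T (w (r n))) \<longlonglongrightarrow> W"
    using LIMSEQ_subseq_LIMSEQ[OF wlim r] by (simp add: o_def)
  ultimately show thesis
    using wX L by (intro that[of "\<lambda>n. w (r n)" L]) (auto simp: o_def)
qed

theorem maximizer_exists:
  obtains L where "L \<in> X" "norm L = 1" "T L = W"
proof -
  have "\<exists>u. u \<in> X \<and> norm u \<le> 1 \<and> W - 1 / real (Suc n) < T u" for n
  proof -
    have "W - 1 / real (Suc n) < Sup (T ` {u \<in> X. norm u \<le> 1})"
      by (simp add: W_def[symmetric])
    moreover have "(0, 0) \<in> {u \<in> X. norm u \<le> 1}"
      using zero_in_X[of 0] by (simp add: norm_Pair)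
    ultimately show ?thesis
      using less_cSupD[of "T ` {u \<in> X. norm u \<le> 1}"] by blast
  qed
  then obtain u where u: "\<And>n. u n \<in> X" "\<And>n. norm (u n) \<le> 1" "\<And>n. W - 1 / real (Suc n) < T (u n)"
    by metis
  have lim: "(\<lambda>n. T (u n)) \<longlonglongrightarrow> W"
  proof (rule tendsto_sandwich)
    have "(\<lambda>n. W - 1 / real (Suc n)) \<longlonglongrightarrow> W - 0"
      by (intro tendsto_diff tendsto_const LIMSEQ_Suc[OF lim_1_over_n])
    then show "(\<lambda>n. W - 1 / real (Suc n)) \<longlonglongrightarrow> W" by simp
    show "\<forall>\<^sub>F n in sequentially. W - 1 / real (Suc n) \<le> T (u n)" using u(3) by (simp add: less_imp_le)
    show "\<forall>\<^sub>F n in sequentially. T (u n) \<le> W" using T_le_W[OF u(1,2)] by simp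
  qed (rule tendsto_const)
  obtain r L where r: "strict_mono (r :: nat \<Rightarrow> nat)" and L: "weak_conv (u \<circ> r) L"
    using bounded_weakly_convergent_subseq[of u 1, OF u(2)] by blast
  have Lr: "weak_conv (\<lambda>n. u (r n)) L" using L by (simp add: o_def)
  have limr: "(\<lambda>n. T (u (r n))) \<longlonglongrightarrow> W"
    using LIMSEQ_subseq_LIMSEQ[OF lim r] by (simp add: o_def)
  show thesis
  proof (cases "L = 0")
    case False
    then show thesis
      using maximizer_of_weak_limit[OF u(1) u(2) limr Lr] that by blast
  next
    case True
    obtain u' L' where "\<And>n. u' n \<in> X" "\<And>n. norm (u' n) \<le> 1" "(\<lambda>n. T (u' n)) \<longlonglongrightarrow> W"
      "weak_conv u' L'" "L' \<noteq> 0"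
      using nonzero_weak_limit[OF u(1) u(2) limr] Lr True by metis
    then show thesis
      using maximizer_of_weak_limit[of u' L'] that by blast
  qed
qed

end

subsection \<open>Weak derivatives of Sobolev functions\<close>

lemma L2_iff: "f \<in> L2 \<longleftrightarrow> sq_integrable f"
  by (simp add: L2_def sq_integrable_def)

lemma sq_integrable_locally_integrable:
  assumes "sq_integrable f"
  shows "locally_integrable f"
proof -
  have "integrable lborel (\<lambda>x. indicator K x *\<^sub>R f x)" if "compact K" for K
    by (intro sq_integrable_scaleR_integrable(1) assms sq_integrable_indicator)
      (use that in \<open>auto simp: compact_imp_closed borel_closed emeasure_compact_finite[unfolded infinity_ennreal_def]
        intro: emeasure_bounded_finite[unfolded infinity_ennreal_def] compact_imp_bounded\<close>)
  then show ?thesis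
    using sq_integrableD(1)[OF assms] by (simp add: locally_integrable_def set_integrable_def)
qed

lemma has_weak_partial_iff:
  assumes "sq_integrable f" "sq_integrable g"
  shows "has_weak_partial i f g \<longleftrightarrow> weak_deriv i f g"
  using assms sq_integrable_locally_integrable by (auto simp: has_weak_partial_def weak_deriv_def)

lemma locally_integrable_test:
  assumes f: "locally_integrable f" and \<phi>: "test_function \<phi>"
  shows "integrable lborel (\<lambda>x. \<phi> x *\<^sub>R f x)"
proof -
  note [measurable] = test_function_measurable[OF \<phi>]
  have [measurable]: "f \<in> borel_measurable borel" using f by (simp add: locally_integrable_def)
  define K where "K = closure {x. \<phi> x \<noteq> 0}"
  obtain C where C: "C \<ge> 0" "\<And>x. \<bar>\<phi> x\<bar> \<le> C * indicator K x"
    using test_function_bounded[OF \<phi>] unfolding K_def by metis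
  have "integrable lborel (\<lambda>x. indicator K x *\<^sub>R f x)"
    using f test_functionD(2)[OF \<phi>] by (simp add: locally_integrable_def set_integrable_def K_def)
  then have "integrable lborel (\<lambda>x. C *\<^sub>R (indicator K x *\<^sub>R f x))"
    by (rule integrable_scaleR_right)
  then show ?thesis
  proof (rule Bochner_Integration.integrable_bound)
    show "AE x in lborel. norm (\<phi> x *\<^sub>R f x) \<le> norm (C *\<^sub>R (indicator K x *\<^sub>R f x))"
    proof (rule AE_I2)
      fix x
      have "\<bar>\<phi> x\<bar> * norm (f x) \<le> (C * indicator K x) * norm (f x)"
        by (intro mult_right_mono C) simp
      then show "norm (\<phi> x *\<^sub>R f x) \<le> norm (C *\<^sub>R (indicator K x *\<^sub>R f x))"
        using C(1) by (simp add: abs_mult)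
    qed
  qed simp
qed

lemma has_weak_partial_unique:
  assumes g: "has_weak_partial i f g" and g': "has_weak_partial i f g'"
  shows "AE x in lborel. g x = g' x"
proof -
  have li: "locally_integrable g" "locally_integrable g'"
    using g g' by (auto simp: has_weak_partial_def)
  have "AE x in lborel. g x - g' x = 0"
  proof (rule fundamental_lemma)
    show "(\<lambda>x. g x - g' x) \<in> borel_measurable borel"
      using li by (auto simp: locally_integrable_def)
    show "integrable lborel (\<lambda>x. indicator (cbox a c) x *\<^sub>R (g x - g' x))" for a c
      using li by (auto simp: locally_integrable_def set_integrable_def scaleR_diff_right)
    fix \<phi> assume \<phi>: "test_function \<phi>"
    have "(LINT x|lborel. \<phi> x *\<^sub>R g x) = (LINT x|lborel. \<phi> x *\<^sub>R g' x)"
    proof -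
      have "(LINT x|lborel. frechet_derivative \<phi> (at x) (axis i 1) *\<^sub>R f x) = - (LINT x|lborel. \<phi> x *\<^sub>R g x)"
        using g \<phi> unfolding has_weak_partial_def by blast
      moreover have "(LINT x|lborel. frechet_derivative \<phi> (at x) (axis i 1) *\<^sub>R f x) = - (LINT x|lborel. \<phi> x *\<^sub>R g' x)"
        using g' \<phi> unfolding has_weak_partial_def by blast
      ultimately show ?thesis by simp
    qed
    then show "(LINT x|lborel. \<phi> x *\<^sub>R (g x - g' x)) = 0"
      using locally_integrable_test[OF li(1) \<phi>] locally_integrable_test[OF li(2) \<phi>]
      by (simp add: scaleR_diff_right)
  qed
  then show ?thesis by eventually_elim simp
qed

lemma sq_integrable_cong_AE:
  assumes "sq_integrable f" "g \<in> borel_measurable borel" "AE x in lborel. g x = f x"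
  shows "sq_integrable g"
proof -
  note [measurable] = sq_integrableD(1)[OF assms(1)] assms(2)
  have "integrable lborel (\<lambda>x. (norm (g x))\<^sup>2) \<longleftrightarrow> integrable lborel (\<lambda>x. (norm (f x))\<^sup>2)"
    by (rule integrable_cong_AE) (use assms(3) in \<open>auto elim!: eventually_mono\<close>)
  then show ?thesis using assms by (simp add: sq_integrable_def)
qed

lemma weak_deriv_cong_AE:
  assumes w: "weak_deriv i f g" and m: "f' \<in> borel_measurable borel" "g' \<in> borel_measurable borel"
    and ae: "AE x in lborel. f' x = f x" "AE x in lborel. g' x = g x"
  shows "weak_deriv i f' g'"
proof -
  have fg: "sq_integrable f" "sq_integrable g" using w by (auto simp: weak_deriv_def)
  note [measurable] = sq_integrableD(1)[OF fg(1)] sq_integrableD(1)[OF fg(2)] m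
  have "(LINT x|lborel. frechet_derivative \<phi> (at x) (axis i 1) *\<^sub>R f' x) = - (LINT x|lborel. \<phi> x *\<^sub>R g' x)"
    if \<phi>: "test_function \<phi>" for \<phi>
  proof -
    note [measurable] = test_function_measurable[OF \<phi>] test_function_measurable[OF test_function_frechet[OF \<phi>, of "axis i 1"]]
    have "(LINT x|lborel. frechet_derivative \<phi> (at x) (axis i 1) *\<^sub>R f' x) = (LINT x|lborel. frechet_derivative \<phi> (at x) (axis i 1) *\<^sub>R f x)"
      by (rule integral_cong_AE) (use ae(1) in \<open>auto elim!: eventually_mono\<close>)
    moreover have "(LINT x|lborel. \<phi> x *\<^sub>R g' x) = (LINT x|lborel. \<phi> x *\<^sub>R g x)"
      by (rule integral_cong_AE) (use ae(2) in \<open>auto elim!: eventually_mono\<close>)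
    ultimately show ?thesis using w \<phi> by (simp add: weak_deriv_def)
  qed
  then show ?thesis
    using sq_integrable_cong_AE[OF fg(1) m(1) ae(1)] sq_integrable_cong_AE[OF fg(2) m(2) ae(2)]
    by (simp add: weak_deriv_def)
qed

lemma H1_iff: "f \<in> H1 \<longleftrightarrow> (\<forall>i. \<exists>g. weak_deriv i f g)"
proof
  assume "f \<in> H1"
  then show "\<forall>i. \<exists>g. weak_deriv i f g"
    using has_weak_partial_iff[of f] by (auto simp: H1_def L2_iff)
next
  assume *: "\<forall>i. \<exists>g. weak_deriv i f g"
  then have f: "sq_integrable f" by (auto simp: weak_deriv_def)
  have "\<exists>g\<in>L2. has_weak_partial i f g" for i
  proof -
    obtain g where g: "weak_deriv i f g" using * by blast
    then have "sq_integrable g" by (simp add: weak_deriv_def)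
    then show ?thesis using g f by (auto simp: L2_iff has_weak_partial_iff)
  qed
  then show "f \<in> H1" using f by (simp add: H1_def L2_iff)
qed

lemma weak_deriv_unique:
  assumes "weak_deriv i f g" "weak_deriv i f g'"
  shows "AE x in lborel. g x = g' x"
  by (rule has_weak_partial_unique[of i f]) (use assms has_weak_partial_iff in \<open>auto simp: weak_deriv_def\<close>)

text \<open>The choice in \<open>weak_partial\<close> may return any locally integrable weak
  derivative; uniqueness up to null sets makes the chosen one square integrable.\<close>

lemma H1_weak_partial:
  assumes "f \<in> H1"
  shows "weak_deriv i f (weak_partial i f)"
proof -
  obtain g where g: "weak_deriv i f g" using assms by (auto simp: H1_iff)
  then have sq: "sq_integrable f" "sq_integrable g" by (auto simp: weak_deriv_def)
  then have hg: "has_weak_partial i f g" using g by (simp add: has_weak_partial_iff)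
  have hw: "has_weak_partial i f (weak_partial i f)"
    using someI[of "has_weak_partial i f", OF hg] by (simp add: weak_partial_def)
  have "sq_integrable (weak_partial i f)"
    by (rule sq_integrable_cong_AE[OF sq(2) _ has_weak_partial_unique[OF hw hg]])
      (use hw in \<open>auto simp: has_weak_partial_def locally_integrable_def\<close>)
  then show ?thesis using hw sq has_weak_partial_iff by blast
qed

lemma weak_partial_eq_AE:
  assumes "f \<in> H1" "weak_deriv i f g"
  shows "AE x in lborel. weak_partial i f x = g x"
  by (rule weak_deriv_unique[OF H1_weak_partial[OF assms(1)] assms(2)])

lemma weak_deriv_add:
  assumes "weak_deriv i f g" "weak_deriv i f' g'"
  shows "weak_deriv i (\<lambda>x. f x + f' x) (\<lambda>x. g x + g' x)"
proof -
  have sq: "sq_integrable f" "sq_integrable g" "sq_integrable f'" "sq_integrable g'"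
    using assms by (auto simp: weak_deriv_def)
  have "(LINT x|lborel. frechet_derivative \<phi> (at x) (axis i 1) *\<^sub>R (f x + f' x)) = - (LINT x|lborel. \<phi> x *\<^sub>R (g x + g' x))"
    if \<phi>: "test_function \<phi>" for \<phi>
  proof -
    note I = sq_integrable_scaleR_integrable(1)[OF test_function_sq_integrable[OF \<phi>]]
      sq_integrable_scaleR_integrable(1)[OF test_function_sq_integrable[OF test_function_frechet[OF \<phi>, of "axis i 1"]]]
    show ?thesis
      using assms \<phi> I(1)[OF sq(2)] I(1)[OF sq(4)] I(2)[OF sq(1)] I(2)[OF sq(3)]
      by (simp add: weak_deriv_def scaleR_add_right)
  qed
  then show ?thesis using sq by (simp add: weak_deriv_def sq_integrable_add)
qed

lemma weak_deriv_cmult: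
  assumes "weak_deriv i f g"
  shows "weak_deriv i (\<lambda>x. c * f x) (\<lambda>x. c * g x)"
proof -
  have sq: "sq_integrable f" "sq_integrable g"
    using assms by (auto simp: weak_deriv_def)
  have sqc: "sq_integrable (\<lambda>x. c * h x)" if "sq_integrable h" for h :: "real^2 \<Rightarrow> complex"
    by (rule sq_integrable_bound[OF that, where C = "norm c"])
      (use sq_integrableD(1)[OF that] in \<open>auto simp: norm_mult\<close>)
  have "(LINT x|lborel. frechet_derivative \<phi> (at x) (axis i 1) *\<^sub>R (c * f x)) = - (LINT x|lborel. \<phi> x *\<^sub>R (c * g x))"
    if \<phi>: "test_function \<phi>" for \<phi>
  proof -
    have "c * (LINT x|lborel. frechet_derivative \<phi> (at x) (axis i 1) *\<^sub>R f x) = c * (- (LINT x|lborel. \<phi> x *\<^sub>R g x))"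
      using assms \<phi> by (simp add: weak_deriv_def)
    then show ?thesis
      by (simp add: mult_scaleR_right[symmetric] del: mult_scaleR_right)
  qed
  then show ?thesis using sq sqc by (simp add: weak_deriv_def)
qed

lemma H1_add: "f \<in> H1 \<Longrightarrow> g \<in> H1 \<Longrightarrow> (\<lambda>x. f x + g x) \<in> H1"
  unfolding H1_iff by (metis weak_deriv_add)

lemma H1_cmult: "f \<in> H1 \<Longrightarrow> (\<lambda>x. c * f x) \<in> H1"
  unfolding H1_iff by (metis weak_deriv_cmult)

section \<open>Uniqueness of the decomposition into regular part and charge\<close>

lemma green_notin_H1:
  assumes "\<kappa> > 0" "c \<noteq> 0"
  shows "(\<lambda>x. c * green \<kappa> x) \<notin> H1"
proof
  assume "(\<lambda>x. c * green \<kappa> x) \<in> H1"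
  from H1_cmult[OF this, of "1 / c"] have "green \<kappa> \<in> H1"
    using assms(2) by simp
  then show False
    using green_no_weak_deriv[OF assms(1)] by (auto simp: H1_iff)
qed

text \<open>Two decompositions of one function differ by a multiple of the Green function that lies
  in \<open>H1\<close>, so the multiple is 0.\<close>

lemma charge_eq:
  assumes "\<kappa> > 0" "f \<in> H1"
  shows "charge \<kappa> (\<lambda>x. f x + c * green \<kappa> x) = c"
  unfolding charge_def
proof (rule the_equality)
  show "\<exists>f'\<in>H1. (\<lambda>x. f x + c * green \<kappa> x) = (\<lambda>x. f' x + c * green \<kappa> x)"
    using assms by blast
  fix c' assume "\<exists>f'\<in>H1. (\<lambda>x. f x + c * green \<kappa> x) = (\<lambda>x. f' x + c' * green \<kappa> x)"
  then obtain f' where f': "f' \<in> H1" "\<And>x. f x + c * green \<kappa> x = f' x + c' * green \<kappa> x"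
    by (metis (mono_tags))
  have "(\<lambda>x. (c - c') * green \<kappa> x) = (\<lambda>x. f' x + (- 1) * f x)"
    using f'(2) by (auto simp: fun_eq_iff algebra_simps)
  then have "(\<lambda>x. (c - c') * green \<kappa> x) \<in> H1"
    using H1_add[OF f'(1) H1_cmult[OF assms(2), of "- 1"]] by simp
  then show "c' = c"
    using green_notin_H1[OF assms(1), of "c - c'"] by auto
qed

lemma regular_part_eq:
  assumes "\<kappa> > 0" "f \<in> H1"
  shows "regular_part \<kappa> (\<lambda>x. f x + c * green \<kappa> x) = f"
  by (simp add: regular_part_def charge_eq[OF assms])

lemma H1_alpha_cases:
  assumes "\<kappa> > 0" "g \<in> H1_alpha \<kappa>"
  shows "regular_part \<kappa> g \<in> H1" "g = (\<lambda>x. regular_part \<kappa> g x + charge \<kappa> g * green \<kappa> x)"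
  using assms by (auto simp: H1_alpha_def regular_part_eq charge_eq)

lemma H1_alpha_add:
  assumes "\<kappa> > 0" "g \<in> H1_alpha \<kappa>" "h \<in> H1_alpha \<kappa>"
  shows "(\<lambda>x. g x + h x) \<in> H1_alpha \<kappa>"
    "charge \<kappa> (\<lambda>x. g x + h x) = charge \<kappa> g + charge \<kappa> h"
    "regular_part \<kappa> (\<lambda>x. g x + h x) = (\<lambda>x. regular_part \<kappa> g x + regular_part \<kappa> h x)"
proof -
  define f where "f x = regular_part \<kappa> g x + regular_part \<kappa> h x" for x
  define c where "c = charge \<kappa> g + charge \<kappa> h"
  have f: "f \<in> H1"
    unfolding f_def[abs_def] using assms H1_alpha_cases(1) H1_add by blast
  have eq: "(\<lambda>x. g x + h x) = (\<lambda>x. f x + c * green \<kappa> x)"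
    using H1_alpha_cases(2)[OF assms(1,2)] H1_alpha_cases(2)[OF assms(1,3)]
    by (simp add: f_def c_def fun_eq_iff algebra_simps)
  show "(\<lambda>x. g x + h x) \<in> H1_alpha \<kappa>" using f by (auto simp: eq H1_alpha_def)
  show "charge \<kappa> (\<lambda>x. g x + h x) = charge \<kappa> g + charge \<kappa> h"
    unfolding eq charge_eq[OF assms(1) f] by (rule c_def)
  show "regular_part \<kappa> (\<lambda>x. g x + h x) = (\<lambda>x. regular_part \<kappa> g x + regular_part \<kappa> h x)"
    unfolding eq regular_part_eq[OF assms(1) f] by (simp add: f_def fun_eq_iff)
qed

lemma H1_alpha_scaleR:
  assumes "\<kappa> > 0" "g \<in> H1_alpha \<kappa>"
  shows "(\<lambda>x. r *\<^sub>R g x) \<in> H1_alpha \<kappa>"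
    "charge \<kappa> (\<lambda>x. r *\<^sub>R g x) = r *\<^sub>R charge \<kappa> g"
    "regular_part \<kappa> (\<lambda>x. r *\<^sub>R g x) = (\<lambda>x. r *\<^sub>R regular_part \<kappa> g x)"
proof -
  define f where "f x = r *\<^sub>R regular_part \<kappa> g x" for x
  define c where "c = r *\<^sub>R charge \<kappa> g"
  have f: "f \<in> H1"
    unfolding f_def[abs_def] scaleR_conv_of_real using assms H1_alpha_cases(1) H1_cmult by blast
  have eq: "(\<lambda>x. r *\<^sub>R g x) = (\<lambda>x. f x + c * green \<kappa> x)"
    using H1_alpha_cases(2)[OF assms]
    by (simp add: f_def c_def fun_eq_iff scaleR_conv_of_real algebra_simps)
  show "(\<lambda>x. r *\<^sub>R g x) \<in> H1_alpha \<kappa>" using f by (auto simp: eq H1_alpha_def)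
  show "charge \<kappa> (\<lambda>x. r *\<^sub>R g x) = r *\<^sub>R charge \<kappa> g"
    unfolding eq charge_eq[OF assms(1) f] by (rule c_def)
  show "regular_part \<kappa> (\<lambda>x. r *\<^sub>R g x) = (\<lambda>x. r *\<^sub>R regular_part \<kappa> g x)"
    unfolding eq regular_part_eq[OF assms(1) f] by (simp add: f_def fun_eq_iff)
qed

section \<open>The form domain and the energy space are isometric\<close>

context energy_space
begin

definition jet_of :: "(real^2 \<Rightarrow> complex) \<Rightarrow> jet" where
  "jet_of f = abs_l2 (\<lambda>x. (sqrt \<kappa> *\<^sub>R f x, weak_partial 1 f x, weak_partial 2 f x))"

text \<open>Inverse to \<open>val\<close> in an asymmetric sense: \<open>J (val u) = u\<close> holds
  exactly on \<open>X\<close>, while \<open>val (J g)\<close> equals \<open>g\<close> only almost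
  everywhere, because jets are classes.\<close>

definition J :: "(real^2 \<Rightarrow> complex) \<Rightarrow> jet \<times> complex" where
  "J g = (jet_of (regular_part \<kappa> g), of_real b * charge \<kappa> g)"

lemma sq_integrable_jet_of:
  assumes "f \<in> H1"
  shows "sq_integrable (\<lambda>x. (sqrt \<kappa> *\<^sub>R f x, weak_partial 1 f x, weak_partial 2 f x))"
  using H1_weak_partial[OF assms]
  by (intro sq_integrable_Pair sq_integrable_scaleR) (auto simp: weak_deriv_def)

lemma AE_jet_of:
  assumes "f \<in> H1"
  shows "AE x in lborel. jfun \<kappa> (jet_of f) x = f x" "AE x in lborel. jd1 (jet_of f) x = weak_partial 1 f x"
    "AE x in lborel. jd2 (jet_of f) x = weak_partial 2 f x"
  using AE_rep_abs_l2[OF sq_integrable_jet_of[OF assms]] \<kappa>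
  by (auto elim!: eventually_mono simp: jet_of_def jfun_def jd1_def jd2_def)

lemma jet_of_in_jets:
  assumes "f \<in> H1"
  shows "jet_of f \<in> jets \<kappa>"
  unfolding jets_def using assms
  by (auto intro!: weak_deriv_cong_AE[OF H1_weak_partial[OF assms]] AE_jet_of)

text \<open>The chosen weak derivatives are additive only up to null sets; in the quotient this
  becomes an equation.\<close>

lemma jet_of_add:
  assumes "f \<in> H1" "g \<in> H1"
  shows "jet_of (\<lambda>x. f x + g x) = jet_of f + jet_of g"
proof -
  have "AE x in lborel. weak_partial i (\<lambda>x. f x + g x) x = weak_partial i f x + weak_partial i g x" for i
    by (intro weak_partial_eq_AE H1_add weak_deriv_add H1_weak_partial assms)
  note ae = this[of 1] this[of 2]
  show ?thesis
  proof (rule l2_eqI)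
    show "AE x in lborel. rep_l2 (jet_of (\<lambda>x. f x + g x)) x = rep_l2 (jet_of f + jet_of g) x"
      using AE_rep_l2_plus[of "jet_of f" "jet_of g"] AE_rep_abs_l2[OF sq_integrable_jet_of[OF assms(1)]]
        AE_rep_abs_l2[OF sq_integrable_jet_of[OF assms(2)]] AE_rep_abs_l2[OF sq_integrable_jet_of[OF H1_add[OF assms]]] ae
      unfolding jet_of_def by eventually_elim (simp add: scaleR_add_right)
  qed
qed

lemma jet_of_scaleR:
  assumes "f \<in> H1"
  shows "jet_of (\<lambda>x. r *\<^sub>R f x) = r *\<^sub>R jet_of f"
proof -
  have H: "(\<lambda>x. r *\<^sub>R f x) \<in> H1"
    unfolding scaleR_conv_of_real by (rule H1_cmult[OF assms])
  have "AE x in lborel. weak_partial i (\<lambda>x. r *\<^sub>R f x) x = r *\<^sub>R weak_partial i f x" for i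
    by (intro weak_partial_eq_AE H weak_deriv_scaleR H1_weak_partial assms)
  note ae = this[of 1] this[of 2]
  show ?thesis
  proof (rule l2_eqI)
    show "AE x in lborel. rep_l2 (jet_of (\<lambda>x. r *\<^sub>R f x)) x = rep_l2 (r *\<^sub>R jet_of f) x"
      using AE_rep_l2_scaleR[of r "jet_of f"] AE_rep_abs_l2[OF sq_integrable_jet_of[OF assms]]
        AE_rep_abs_l2[OF sq_integrable_jet_of[OF H]] ae
      unfolding jet_of_def by eventually_elim simp
  qed
qed

lemma J_in_X: "g \<in> H1_alpha \<kappa> \<Longrightarrow> J g \<in> X"
  using H1_alpha_cases(1)[OF \<kappa>] by (simp add: J_def X_def jet_of_in_jets)

lemma J_add: "g \<in> H1_alpha \<kappa> \<Longrightarrow> h \<in> H1_alpha \<kappa> \<Longrightarrow> J (\<lambda>x. g x + h x) = J g + J h"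
  using H1_alpha_cases(1)[OF \<kappa>]
  by (simp add: J_def H1_alpha_add[OF \<kappa>] jet_of_add distrib_left)

lemma J_scaleR: "g \<in> H1_alpha \<kappa> \<Longrightarrow> J (\<lambda>x. r *\<^sub>R g x) = r *\<^sub>R J g"
  using H1_alpha_cases(1)[OF \<kappa>]
  by (simp add: J_def H1_alpha_scaleR[OF \<kappa>] jet_of_scaleR)

lemma AE_val_J:
  assumes "g \<in> H1_alpha \<kappa>"
  shows "AE x in lborel. val (J g) x = g x"
  using AE_jet_of(1)[OF H1_alpha_cases(1)[OF \<kappa> assms]]
proof eventually_elim
  case (elim x)
  have "g x = regular_part \<kappa> g x + charge \<kappa> g * green \<kappa> x"
    using H1_alpha_cases(2)[OF \<kappa> assms] by metis
  then show ?case using elim b by (simp add: val_def J_def)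
qed

lemma J_surj:
  assumes "u \<in> X"
  shows "val u \<in> H1_alpha \<kappa>" "J (val u) = u"
proof -
  define f where "f = jfun \<kappa> (fst u)"
  define c where "c = snd u / of_real b"
  have w: "weak_deriv 1 f (jd1 (fst u))" "weak_deriv 2 f (jd2 (fst u))"
    using assms by (auto simp: X_def jets_def f_def)
  have f: "f \<in> H1"
    unfolding H1_iff forall_2 using w by blast
  have v: "val u = (\<lambda>x. f x + c * green \<kappa> x)"
    by (simp add: val_def[abs_def] f_def c_def)
  show "val u \<in> H1_alpha \<kappa>" using f by (auto simp: v H1_alpha_def)
  have "jet_of f = fst u"
  proof (rule l2_eqI)
    show "AE x in lborel. rep_l2 (jet_of f) x = rep_l2 (fst u) x"
      using AE_rep_abs_l2[OF sq_integrable_jet_of[OF f]] weak_partial_eq_AE[OF f w(1)] weak_partial_eq_AE[OF f w(2)]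
      unfolding jet_of_def
      by eventually_elim (use \<kappa> in \<open>simp add: f_def jfun_def jd1_def jd2_def\<close>)
  qed
  moreover have "J (val u) = (jet_of f, of_real b * c)"
    unfolding v J_def by (simp only: regular_part_eq[OF \<kappa> f] charge_eq[OF \<kappa> f])
  ultimately show "J (val u) = u"
    using b by (simp add: c_def)
qed

lemma norm_J:
  assumes g: "g \<in> H1_alpha \<kappa>"
  shows "(norm (J g))\<^sup>2 = grad_norm_sq (regular_part \<kappa> g) + \<kappa> * L2_norm_sq (regular_part \<kappa> g) + b\<^sup>2 * (cmod (charge \<kappa> g))\<^sup>2"
proof -
  define f where "f = regular_part \<kappa> g"
  have f: "f \<in> H1" using H1_alpha_cases(1)[OF \<kappa> g] by (simp add: f_def)
  have sq: "sq_integrable f" "sq_integrable (weak_partial 1 f)" "sq_integrable (weak_partial 2 f)"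
    using H1_weak_partial[OF f] by (auto simp: weak_deriv_def)
  have "(norm (jet_of f))\<^sup>2 = (LINT x|lborel. (norm (sqrt \<kappa> *\<^sub>R f x, weak_partial 1 f x, weak_partial 2 f x))\<^sup>2)"
    unfolding jet_of_def by (rule norm_abs_l2_sq[OF sq_integrable_jet_of[OF f]])
  also have "\<dots> = (LINT x|lborel. \<kappa> * (norm (f x))\<^sup>2 + (norm (weak_partial 1 f x))\<^sup>2 + (norm (weak_partial 2 f x))\<^sup>2)"
    using \<kappa> by (simp add: norm_triple power_mult_distrib)
  also have "\<dots> = \<kappa> * L2_norm_sq f + grad_norm_sq f"
    using sq[THEN sq_integrableD(3)] by (simp add: L2_norm_sq_def grad_norm_sq_def UNIV_2)
  finally have jf: "(norm (jet_of f))\<^sup>2 = \<kappa> * L2_norm_sq f + grad_norm_sq f" .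
  have "(norm (J g))\<^sup>2 = (norm (jet_of f))\<^sup>2 + (norm (of_real b * charge \<kappa> g))\<^sup>2"
    by (simp add: J_def norm_Pair f_def)
  also have "(norm (of_real b * charge \<kappa> g))\<^sup>2 = b\<^sup>2 * (cmod (charge \<kappa> g))\<^sup>2"
    using b by (simp add: norm_mult power_mult_distrib)
  finally show ?thesis
    unfolding jf by (simp add: f_def)
qed

lemma integral_powr_J:
  assumes g: "g \<in> H1_alpha \<kappa>"
  shows "(LINT x|lborel. cmod (g x) powr q) = T (J g)"
proof -
  have "sq_integrable (regular_part \<kappa> g)"
    using H1_alpha_cases(1)[OF \<kappa> g] by (simp add: H1_def L2_iff)
  then have [measurable]: "regular_part \<kappa> g \<in> borel_measurable borel"
    by (rule sq_integrableD)
  have "(\<lambda>x. regular_part \<kappa> g x + charge \<kappa> g * green \<kappa> x) \<in> borel_measurable borel"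
    by measurable
  then have [measurable]: "g \<in> borel_measurable borel"
    using H1_alpha_cases(2)[OF \<kappa> g] by simp
  have "(LINT x|lborel. cmod (g x) powr q) = enn2real (pw q g)"
    unfolding pw_def by (rule integral_eq_nn_integral) auto
  also have "pw q g = pw q (val (J g))"
    by (rule pw_cong_AE) (use AE_val_J[OF g] in \<open>auto elim!: eventually_mono\<close>)
  finally show ?thesis by (simp add: T_def)
qed

subsection \<open>Critical points\<close>

definition S :: "jet \<times> complex \<Rightarrow> real" where
  "S u = (norm u)\<^sup>2 / 2 - T u / q"

text \<open>The splitting inequality at \<open>\<epsilon> = 1 / 2\<close>, rescaled by homogeneity:
  \<open>(1 / 2) powr (1 - q) * (1 / 2) powr q = 1 / 2\<close>.\<close>

lemma T_midpoint:
  assumes "u \<in> X" "k \<in> X"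
  shows "2 * T u \<le> T (u + k) + T (u - k)"
proof -
  define v where "v = (1 / 2) *\<^sub>R (u + k)"
  define w where "w = (1 / 2) *\<^sub>R (u - k)"
  have vw: "v \<in> X" "w \<in> X" using assms by (auto simp: v_def w_def intro!: X_closed)
  have u: "u = v + w"
    by (simp add: v_def w_def scaleR_add_right[symmetric] scaleR_2[symmetric])
  define c where "c = (1 / 2 :: real) powr (1 - q)"
  have c: "c \<ge> 0" by (simp add: c_def)
  have "pw q (val u) = pw q (\<lambda>x. val v x + val w x)"
    unfolding u by (rule pw_cong_AE[OF AE_val_add])
  also have "\<dots> \<le> ennreal c * pw q (val v) + ennreal c * pw q (val w)"
    using pw_add_le[of "val v" "val w" q "1 / 2"] q by (simp add: c_def)
  finally have "ennreal (T u) \<le> ennreal (c * T v + c * T w)"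
    using c vw assms T_nonneg by (simp add: pw_val_finite ennreal_mult)
  then have "T u \<le> c * T v + c * T w"
    by (subst (asm) ennreal_le_iff) (use c T_nonneg in auto)
  also have "\<dots> = c * (1 / 2) powr q * (T (u + k) + T (u - k))"
    by (simp add: v_def w_def T_scaleR distrib_left mult.assoc)
  also have "c * (1 / 2) powr q = 1 / 2"
    by (simp add: c_def flip: powr_add)
  finally show ?thesis by simp
qed

text \<open>The radial profile \<open>t\<^sup>2 / 2 - W t\<^sup>q / q\<close> bounds the action from below, and from above through
  the convexity of \<open>T\<close>; it is critical at the norm of a rescaled maximizer.\<close>
definition profile :: "real \<Rightarrow> real" where
  "profile t = t\<^sup>2 / 2 - W * t powr q / q"

text \<open>The positive zero of \<open>t - W * t powr (q - 1)\<close>, the derivative of the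
  profile.\<close>

definition radius :: real where
  "radius = (1 / W) powr (1 / (q - 2))"

lemma radius: "radius > 0" "W * radius powr q = radius\<^sup>2" "W * radius powr (q - 2) = 1"
proof -
  show r: "radius > 0" using W_pos by (simp add: radius_def)
  have "1 / (q - 2) * (q - 2) = 1" using q by simp
  then have "radius powr (q - 2) = (1 / W) powr 1"
    by (simp only: radius_def powr_powr)
  then show 1: "W * radius powr (q - 2) = 1" using W_pos by simp
  have "radius powr q = radius powr (q - 2) * radius powr 2"
    using powr_add[of radius "q - 2" 2] by simp
  then have "W * radius powr q = (W * radius powr (q - 2)) * radius powr 2" by simp
  then show "W * radius powr q = radius\<^sup>2" using 1 r by (simp add: powr_numeral)
qed

lemma profile_deriv: "(profile has_real_derivative 0) (at radius)"
proof -
  have "(profile has_real_derivative (2 * radius / 2 - W * (q * radius powr (q - 1)) / q)) (at radius)"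
    unfolding profile_def[abs_def] using radius(1) q
    by (auto intro!: derivative_eq_intros has_real_derivative_powr simp: field_simps)
  moreover have "W * radius powr (q - 1) = radius"
  proof -
    have "radius powr (q - 1) = radius powr (q - 2) * radius"
      using radius(1) powr_mult_base[of radius "q - 2"] by (simp add: mult.commute)
    then have "W * radius powr (q - 1) = (W * radius powr (q - 2)) * radius" by simp
    then show ?thesis using radius(3) by simp
  qed
  ultimately show ?thesis using q by simp
qed

lemma profile_flat:
  assumes "\<epsilon> > 0"
  obtains \<delta> where "\<delta> > 0" "\<And>t. \<bar>t - radius\<bar> < \<delta> \<Longrightarrow> \<bar>profile t - profile radius\<bar> \<le> \<epsilon> * \<bar>t - radius\<bar>"
proof -
  have "(\<lambda>h. (profile (radius + h) - profile radius) / h) \<midarrow>0\<rightarrow> 0"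
    using profile_deriv by (simp add: DERIV_def)
  from LIM_D[OF this assms] obtain \<delta> where \<delta>: "\<delta> > 0"
    "\<And>h. h \<noteq> 0 \<Longrightarrow> \<bar>h\<bar> < \<delta> \<Longrightarrow> \<bar>(profile (radius + h) - profile radius) / h\<bar> < \<epsilon>"
    by auto
  show thesis
  proof (rule that[OF \<delta>(1)])
    fix t assume t: "\<bar>t - radius\<bar> < \<delta>"
    show "\<bar>profile t - profile radius\<bar> \<le> \<epsilon> * \<bar>t - radius\<bar>"
    proof (cases "t = radius")
      case False
      then have "\<bar>profile t - profile radius\<bar> / \<bar>t - radius\<bar> < \<epsilon>"
        using \<delta>(2)[of "t - radius"] t by (simp add: abs_divide)
      then show ?thesis using False by (simp add: divide_less_eq)
    qed simp
  qed
qed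

lemma S_ge_profile: "u \<in> X \<Longrightarrow> profile (norm u) \<le> S u"
  using T_le[of u] q by (simp add: S_def profile_def divide_right_mono)

text \<open>At \<open>U = radius *\<^sub>R L\<close> the action equals the profile, and elsewhere it
  lies above; the profile is flat at \<open>radius\<close> and the norm is Lipschitz, which bounds
  \<open>S (U + k)\<close> and \<open>S (U - k)\<close> from below up to
  \<open>\<epsilon> / 2 * norm k\<close>. The parallelogram law and \<open>T_midpoint\<close> give
  \<open>S (U + k) + S (U - k) \<le> 2 * S U + (norm k)\<^sup>2\<close>, so the lower bound at
  \<open>U - k\<close> becomes an upper bound at \<open>U + k\<close>.\<close>

lemma maximizer_critical:
  assumes L: "L \<in> X" "norm L = 1" "T L = W" and \<epsilon>: "\<epsilon> > 0"
  obtains \<delta> where "\<delta> > 0"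
    "\<And>k. k \<in> X \<Longrightarrow> norm k < \<delta> \<Longrightarrow> \<bar>S (radius *\<^sub>R L + k) - S (radius *\<^sub>R L)\<bar> \<le> \<epsilon> * norm k"
proof -
  define U where "U = radius *\<^sub>R L"
  have U: "U \<in> X" "norm U = radius" using L radius(1) by (auto simp: U_def intro: X_closed)
  have TU: "T U = W * radius powr q" using L radius(1) by (simp add: U_def T_scaleR)
  have SU: "S U = profile radius" by (simp add: S_def profile_def U TU)
  obtain d where d: "d > 0" "\<And>t. \<bar>t - radius\<bar> < d \<Longrightarrow> \<bar>profile t - profile radius\<bar> \<le> (\<epsilon> / 2) * \<bar>t - radius\<bar>"
    using profile_flat[of "\<epsilon> / 2"] \<epsilon> by auto
  have p: "\<bar>profile (norm (U + k)) - profile radius\<bar> \<le> (\<epsilon> / 2) * norm k" if "norm k < d" for k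
  proof -
    have le: "\<bar>norm (U + k) - radius\<bar> \<le> norm k"
      using norm_triangle_ineq3[of "U + k" U] U(2) by simp
    then have "\<bar>profile (norm (U + k)) - profile radius\<bar> \<le> (\<epsilon> / 2) * \<bar>norm (U + k) - radius\<bar>"
      using that by (intro d(2)) simp
    also have "\<dots> \<le> (\<epsilon> / 2) * norm k" using le \<epsilon> by (intro mult_left_mono) auto
    finally show ?thesis .
  qed
  \<comment> \<open>The second entry of the minimum keeps the quadratic remainder
    \<open>(norm k)\<^sup>2\<close> below \<open>\<epsilon> / 2 * norm k\<close>.\<close>
  show thesis
  proof (rule that[of "min d (\<epsilon> / 2)"])
    show "0 < min d (\<epsilon> / 2)" using d \<epsilon> by simp
    fix k assume k: "k \<in> X" "norm k < min d (\<epsilon> / 2)"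
    have m: "- k \<in> X" using X_closed(3)[OF k(1), of "- 1"] by simp
    have low: "- (\<epsilon> / 2) * norm k \<le> S (U + k) - S U"
    proof -
      have "- (profile (norm (U + k)) - profile radius) \<le> (\<epsilon> / 2) * norm k"
        by (rule abs_le_D2[OF p]) (use k(2) in simp)
      then show ?thesis using S_ge_profile[OF X_closed(1)[OF U(1) k(1)]] SU by simp
    qed
    have par: "(norm (U + k))\<^sup>2 + (norm (U - k))\<^sup>2 = 2 * (norm U)\<^sup>2 + 2 * (norm k)\<^sup>2"
      by (simp add: power2_norm_eq_inner inner_add inner_diff inner_commute)
    have "- T (U + k) / q \<le> (T (U - k) - 2 * T U) / q"
      using T_midpoint[OF U(1) k(1)] q by (intro divide_right_mono) auto
    then have "S (U + k) + S (U - k) \<le> 2 * S U + (norm k)\<^sup>2"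
      using par by (simp add: S_def diff_divide_distrib)
    moreover have "profile radius - (\<epsilon> / 2) * norm k \<le> S (U - k)"
    proof -
      have "- (profile (norm (U + - k)) - profile radius) \<le> (\<epsilon> / 2) * norm (- k)"
        by (rule abs_le_D2[OF p]) (use k(2) in simp)
      then show ?thesis using S_ge_profile[OF X_closed(1)[OF U(1) m]] by simp
    qed
    ultimately have "S (U + k) - S U \<le> (norm k)\<^sup>2 + (\<epsilon> / 2) * norm k"
      using SU by simp
    also have "(norm k)\<^sup>2 \<le> (\<epsilon> / 2) * norm k"
      using k(2) unfolding power2_eq_square by (intro mult_right_mono) auto
    finally have "S (U + k) - S U \<le> \<epsilon> * norm k" by simp
    moreover have "- (\<epsilon> * norm k) \<le> - (\<epsilon> / 2) * norm k"
      using \<epsilon> by (simp add: mult_nonneg_nonneg)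
    ultimately show "\<bar>S (radius *\<^sub>R L + k) - S (radius *\<^sub>R L)\<bar> \<le> \<epsilon> * norm k"
      using low unfolding U_def[symmetric] by (simp add: abs_le_iff)
  qed
qed

text \<open>Along the ray through \<open>u\<close> the action is the explicit function
  \<open>\<phi>\<close>, whose derivative at 0 is \<open>(norm u)\<^sup>2 - T u\<close>; criticality
  along the ray makes this derivative 0.\<close>

lemma nehari_identity:
  assumes u: "u \<in> X"
    and crit: "\<And>\<epsilon>. \<epsilon> > 0 \<Longrightarrow> \<exists>\<delta>>0. \<forall>r. norm (r *\<^sub>R u) < \<delta> \<longrightarrow> \<bar>S (u + r *\<^sub>R u) - S u\<bar> \<le> \<epsilon> * norm (r *\<^sub>R u)"
  shows "(norm u)\<^sup>2 = T u"
proof -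
  define \<phi> where "\<phi> r = (1 + r)\<^sup>2 * (norm u)\<^sup>2 / 2 - \<bar>1 + r\<bar> powr q * T u / q" for r :: real
  have S\<phi>: "S (u + r *\<^sub>R u) = \<phi> r" for r
  proof -
    have "u + r *\<^sub>R u = (1 + r) *\<^sub>R u" by (simp add: scaleR_left_distrib)
    then show ?thesis by (simp only: S_def \<phi>_def T_scaleR norm_scaleR power_mult_distrib power2_abs)
  qed
  have "((\<lambda>r. (1 + r)\<^sup>2 * (norm u)\<^sup>2 / 2 - (1 + r) powr q * T u / q) has_real_derivative (norm u)\<^sup>2 - T u) (at 0)"
    using q by (auto intro!: derivative_eq_intros has_real_derivative_powr simp: field_simps)
  then have D1: "(\<phi> has_real_derivative (norm u)\<^sup>2 - T u) (at 0)"
    by (rule has_field_derivative_transform_within_open[of _ _ _ "{-1<..}"]) (auto simp: \<phi>_def)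
  have "(\<phi> has_real_derivative 0) (at 0)"
    unfolding DERIV_def
  proof (rule LIM_I)
    fix e :: real assume e: "e > 0"
    \<comment> \<open>Adding 1 to the norm keeps the denominators positive when
      \<open>u = 0\<close>.\<close>
    define \<epsilon> where "\<epsilon> = e / (2 * (norm u + 1))"
    have n1: "norm u + 1 > 0" by (simp add: add_nonneg_pos)
    have \<epsilon>: "\<epsilon> > 0" using e n1 by (simp add: \<epsilon>_def)
    have \<epsilon>u: "\<epsilon> * norm u < e"
    proof -
      have "\<epsilon> * norm u \<le> \<epsilon> * (norm u + 1)" using \<epsilon> by simp
      also have "\<dots> = e / 2"
      proof -
        have *: "e / (2 * m) * m = e / 2" if "m > 0" for m :: real using that by simp
        show ?thesis unfolding \<epsilon>_def by (rule *[OF n1])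
      qed
      finally show ?thesis using e by simp
    qed
    obtain \<delta> where \<delta>: "\<delta> > 0" "\<And>r. norm (r *\<^sub>R u) < \<delta> \<Longrightarrow> \<bar>S (u + r *\<^sub>R u) - S u\<bar> \<le> \<epsilon> * norm (r *\<^sub>R u)"
      using crit[OF \<epsilon>] by blast
    show "\<exists>s>0. \<forall>h. h \<noteq> 0 \<and> norm (h - 0) < s \<longrightarrow> norm ((\<phi> (0 + h) - \<phi> 0) / h - 0) < e"
    proof (intro exI[of _ "\<delta> / (norm u + 1)"] conjI allI impI)
      show "\<delta> / (norm u + 1) > 0" using \<delta> n1 by simp
      fix h :: real assume h: "h \<noteq> 0 \<and> norm (h - 0) < \<delta> / (norm u + 1)"
      have "\<bar>h\<bar> * norm u \<le> \<bar>h\<bar> * (norm u + 1)" by (intro mult_left_mono) auto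
      also have "\<dots> < \<delta>" using h n1 by (simp add: less_divide_eq)
      finally have "norm (h *\<^sub>R u) < \<delta>" by simp
      from \<delta>(2)[OF this] have "\<bar>\<phi> h - \<phi> 0\<bar> \<le> \<epsilon> * (\<bar>h\<bar> * norm u)"
        using S\<phi>[of h] S\<phi>[of 0] by simp
      then have "\<bar>\<phi> h - \<phi> 0\<bar> / \<bar>h\<bar> \<le> \<epsilon> * norm u"
        using h by (simp add: divide_le_eq mult_ac)
      then show "norm ((\<phi> (0 + h) - \<phi> 0) / h - 0) < e"
        using \<epsilon>u by (simp add: abs_divide)
    qed
  qed
  from DERIV_unique[OF D1 this] show ?thesis by simp
qed

text \<open>Dividing \<open>(norm u)\<^sup>2 = T u \<le> W * norm u powr q\<close> by the squared
  norm leaves \<open>1 \<le> W * norm u powr (q - 2)\<close>; the right-hand side increases with the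
  norm and equals 1 at \<open>radius\<close>.\<close>

lemma critical_norm_ge:
  assumes u: "u \<in> X" "u \<noteq> 0" and n: "(norm u)\<^sup>2 = T u"
  shows "radius \<le> norm u"
proof (rule ccontr)
  assume "\<not> radius \<le> norm u"
  then have lt: "norm u < radius" by simp
  have u0: "norm u > 0" using u by simp
  have "norm u powr q = norm u powr (q - 2) * (norm u)\<^sup>2"
    using u0 by (simp flip: powr_numeral powr_add)
  then have "(norm u)\<^sup>2 \<le> W * norm u powr (q - 2) * (norm u)\<^sup>2"
    using T_le[OF u(1)] n by (simp add: mult.assoc)
  then have "1 * (norm u)\<^sup>2 \<le> (W * norm u powr (q - 2)) * (norm u)\<^sup>2" by simp
  then have "1 \<le> W * norm u powr (q - 2)"
    by (rule mult_right_le_imp_le) (use u0 in simp)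
  also have "\<dots> < W * radius powr (q - 2)"
    using lt u0 q W_pos by (intro mult_strict_left_mono powr_less_mono2) auto
  finally show False using radius(3) by simp
qed

end

section \<open>Comparison of the rescaled maximizer with all stationary states\<close>

theorem theorem1p2:
  fixes \<alpha> p \<omega> :: real
  assumes "p > 1"
    and "\<omega> > - e_alpha \<alpha>"
  shows "ground_states \<alpha> p \<omega> \<noteq> {}"
proof -
  have e: "- e_alpha \<alpha> > 0" by (simp add: e_alpha_def)
  have \<omega>: "\<omega> > 0" using e assms(2) by linarith
  have \<beta>: "beta \<alpha> \<omega> > 0"
  proof -
    have "1 < \<omega> / (- e_alpha \<alpha>)" using e assms(2) by (simp only: less_divide_eq_1_pos)
    then have "0 < ln (\<omega> / (- e_alpha \<alpha>))" by (rule ln_gt_zero)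
    then show ?thesis unfolding beta_eq_ln[OF \<omega>] by (intro mult_pos_pos) auto
  qed
  define b where "b = sqrt (beta \<alpha> \<omega>)"
  have b_pos: "b > 0" and b_sq: "b\<^sup>2 = beta \<alpha> \<omega>" using \<beta> by (auto simp: b_def)
  interpret energy_space \<omega> b "p + 1"
    by unfold_locales (use \<omega> b_pos assms in auto)
  have N: "form_norm \<alpha> \<omega> g = norm (J g)" and A: "action \<alpha> p \<omega> g = S (J g)" if "g \<in> H1_alpha \<omega>" for g
  proof -
    have "form_norm_sq \<alpha> \<omega> g = (norm (J g))\<^sup>2"
      unfolding form_norm_sq_def norm_J[OF that] b_sq ..
    then show "form_norm \<alpha> \<omega> g = norm (J g)" "action \<alpha> p \<omega> g = S (J g)"
      by (simp_all add: form_norm_def action_def S_def integral_powr_J[OF that])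
  qed
  obtain L where L: "L \<in> X" "norm L = 1" "T L = W"
    using maximizer_exists by blast
  define U where "U = radius *\<^sub>R L"
  have U: "U \<in> X" "norm U = radius" "T U = radius\<^sup>2"
    using L radius by (auto simp: U_def T_scaleR mult.commute intro: X_closed)
  define \<phi> where "\<phi> = val U"
  have \<phi>: "\<phi> \<in> H1_alpha \<omega>" "J \<phi> = U"
    using J_surj[OF U(1)] by (simp_all add: \<phi>_def)
  \<comment> \<open>On the Nehari constraint the action is an increasing function of the norm alone,
    as \<open>p > 1\<close>.\<close>
  have S_eq: "S u = (1 / 2 - 1 / (p + 1)) * (norm u)\<^sup>2" if "(norm u)\<^sup>2 = T u" for u
    by (simp add: S_def left_diff_distrib that)
  have "\<phi> \<in> stationary_states \<alpha> p \<omega>"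
    unfolding stationary_states_def
  proof (intro CollectI conjI)
    show "\<phi> \<in> H1_alpha \<omega>" by (rule \<phi>(1))
    show "\<not> (AE x in lborel. \<phi> x = 0)"
    proof
      assume "AE x in lborel. \<phi> x = 0"
      then have "pw (p + 1) (val U) = pw (p + 1) (\<lambda>x. 0)"
        unfolding \<phi>_def by (rule pw_cong_AE)
      then have "T U = 0" by (simp add: T_def pw_def)
      then show False using U radius(1) by simp
    qed
    \<comment> \<open>The remainder estimate for the zero derivative is that of
      \<open>maximizer_critical\<close>, transported by the additive isometry
      \<open>J\<close>.\<close>
    show "has_frechet_derivative_on (H1_alpha \<omega>) (form_norm \<alpha> \<omega>) (action \<alpha> p \<omega>) \<phi> (\<lambda>h. 0)"
      unfolding has_frechet_derivative_on_def
    proof (intro conjI allI impI ballI)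
      show "\<exists>C. \<forall>h\<in>H1_alpha \<omega>. \<bar>0\<bar> \<le> C * form_norm \<alpha> \<omega> h"
        by (rule exI[of _ 0]) simp
      fix \<epsilon> :: real assume "\<epsilon> > 0"
      then obtain \<delta> where \<delta>: "\<delta> > 0" "\<And>k. k \<in> X \<Longrightarrow> norm k < \<delta> \<Longrightarrow> \<bar>S (U + k) - S U\<bar> \<le> \<epsilon> * norm k"
        using maximizer_critical[OF L] unfolding U_def by metis
      show "\<exists>\<delta>>0. \<forall>h\<in>H1_alpha \<omega>. form_norm \<alpha> \<omega> h < \<delta> \<longrightarrow>
          \<bar>action \<alpha> p \<omega> (\<lambda>x. \<phi> x + h x) - action \<alpha> p \<omega> \<phi> - 0\<bar> \<le> \<epsilon> * form_norm \<alpha> \<omega> h"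
        using \<delta> J_in_X \<phi>
        by (intro exI[of _ \<delta>]) (auto simp: N A J_add H1_alpha_add(1)[OF \<omega>])
    qed auto
  qed
  moreover have "action \<alpha> p \<omega> \<phi> \<le> action \<alpha> p \<omega> \<psi>" if \<psi>: "\<psi> \<in> stationary_states \<alpha> p \<omega>" for \<psi>
  proof -
    have H: "\<psi> \<in> H1_alpha \<omega>" and nz: "\<not> (AE x in lborel. \<psi> x = 0)"
      and fd: "has_frechet_derivative_on (H1_alpha \<omega>) (form_norm \<alpha> \<omega>) (action \<alpha> p \<omega>) \<psi> (\<lambda>h. 0)"
      using \<psi> by (auto simp: stationary_states_def)
    define u where "u = J \<psi>"
    have u: "u \<in> X" using J_in_X[OF H] by (simp add: u_def)
    have "u \<noteq> 0"
    proof
      assume "u = 0"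
      have "AE x in lborel. val u x = 0"
        using AE_val_scaleR[of 0 u] by (simp add: \<open>u = 0\<close>)
      then have "AE x in lborel. \<psi> x = 0"
        using AE_val_J[OF H] unfolding u_def by eventually_elim simp
      then show False using nz by blast
    qed
    \<comment> \<open>Stationarity is applied to the variations \<open>r *\<^sub>R \<psi>\<close>,
      which \<open>J\<close> maps to \<open>r *\<^sub>R u\<close>.\<close>
    have nehari: "(norm u)\<^sup>2 = T u"
    proof (rule nehari_identity[OF u])
      fix \<epsilon> :: real assume "\<epsilon> > 0"
      then obtain \<delta> where \<delta>: "\<delta> > 0" "\<And>h. h \<in> H1_alpha \<omega> \<Longrightarrow> form_norm \<alpha> \<omega> h < \<delta> \<Longrightarrow>
          \<bar>action \<alpha> p \<omega> (\<lambda>x. \<psi> x + h x) - action \<alpha> p \<omega> \<psi>\<bar> \<le> \<epsilon> * form_norm \<alpha> \<omega> h"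
        using fd unfolding has_frechet_derivative_on_def by auto
      have "\<bar>S (u + r *\<^sub>R u) - S u\<bar> \<le> \<epsilon> * norm (r *\<^sub>R u)" if "norm (r *\<^sub>R u) < \<delta>" for r
      proof -
        note h = H1_alpha_scaleR(1)[OF \<omega> H, of r]
        have "J (\<lambda>x. r *\<^sub>R \<psi> x) = r *\<^sub>R u" using J_scaleR[OF H] by (simp add: u_def)
        moreover have "J (\<lambda>x. \<psi> x + r *\<^sub>R \<psi> x) = u + r *\<^sub>R u"
          using J_add[OF H h] J_scaleR[OF H] by (simp add: u_def)
        ultimately show ?thesis
          using \<delta>(2)[OF h] that
          by (simp only: N[OF h] A[OF H] A[OF H1_alpha_add(1)[OF \<omega> H h]] u_def[symmetric])
      qed
      then show "\<exists>\<delta>>0. \<forall>r. norm (r *\<^sub>R u) < \<delta> \<longrightarrow> \<bar>S (u + r *\<^sub>R u) - S u\<bar> \<le> \<epsilon> * norm (r *\<^sub>R u)"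
        using \<delta>(1) by blast
    qed
    have "radius \<le> norm u" by (rule critical_norm_ge[OF u \<open>u \<noteq> 0\<close> nehari])
    then have "(norm U)\<^sup>2 \<le> (norm u)\<^sup>2"
      unfolding U(2) using radius(1) by (intro power_mono) auto
    moreover have "1 / 2 - 1 / (p + 1) \<ge> 0" using assms(1) by (simp add: field_simps)
    ultimately have "S U \<le> S u"
      unfolding S_eq[OF nehari] using S_eq[of U] U by (simp add: mult_left_mono)
    then show ?thesis using \<phi> H by (simp add: A u_def)
  qed
  ultimately show ?thesis
    by (auto simp: ground_states_def)
qed

end
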